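(* The $A_\infty$ morphism $\varphi:=\log\circ\lambda:\Omega^*([0,1])\to C^*_\infty([0,1])$ is a $C_\infty$ morphism.
   Context: **$A_\infty$ and $C_\infty$ conventions.** $\Bbbk$ is a field of characteristic zero. For a graded vector space $V$, $\mathbf{s}V$ is the suspension, $(\mathbf{s}V)^i=V^{i+1}$. $\overline{T}(V)=\bigoplus_{n\ge1}V^{\otimes n}$ carries the deconcatenation coproduct. An $A_\infty$ algebra structure on $V$ is a degree $1$ coderivation $Q$ of $\overline{T}(\mathbf{s}V)$ with $Q^2=0$; it is determined by its Taylor coefficients $Q_n:(\mathbf{s}V)^{\otimes n}\to\mathbf{s}V$. An $A_\infty$ morphism $F:V\to W$ is a morphism of dg coalgebras $\overline{T}(\mathbf{s}V)\to\overline{T}(\mathbf{s}W)$, determined by its Taylor coefficients $F_n:(\mathbf{s}V)^{\otimes n}\to\mathbf{s}W$; the composition has coefficients $(G\circ F)_n=\sum_{k}\sum_{i_1+\cdots+i_k=n}G_k(F_{i_1}\otimes\cdots\otimes F_{i_k})$. A dg algebra is an $A_\infty$ algebra via $Q_1(\mathbf{s}a)=-\mathbf{s}(da)$, $Q_2(\mathbf{s}a\otimes\mathbf{s}b)=(-1)^{|a|}\mathbf{s}(ab)$, $Q_n=0$ for $n\ge3$. The shuffle product on $\overline{T}(V)$ is $(v_1\otimes\cdots\otimes v_p)\circledast(v_{p+1}\otimes\cdots\otimes v_n)=\sum_{\sigma}\varepsilon(\sigma)v_{\sigma^{-1}(1)}\otimes\cdots\otimes v_{\sigma^{-1}(n)}$,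 over $\sigma\in S_n$ with $\sigma(i)<\sigma(i+1)$ for all $i\ne p$, $\varepsilon(\sigma)$ being the Koszul sign. A $C_\infty$ algebra is an $A_\infty$ algebra whose codifferential is also a derivation of $(\overline{T}(\mathbf{s}V),\circledast)$ (equivalently, all Taylor coefficients vanish on the image of $\circledast$); a $C_\infty$ morphism between $C_\infty$ algebras is an $A_\infty$ morphism which is also multiplicative for $\circledast$ (equivalently, all its Taylor coefficients vanish on the image of $\circledast$). Commutative dg algebras are $C_\infty$ algebras. **Forms and cochains.** $\Omega^*([0,1])$ is either the commutative dg algebra of smooth real forms on $[0,1]$ ($\Bbbk=\mathbb{R}$) or that of polynomial forms $\Bbbk[t]\oplus\Bbbk[t]dt$ (with polynomial integrals over simplices evaluated formally). $C^*([0,1])\subset\Omega^*([0,1])$ is the subcomplex of Whitney forms $\{at+b(1-t)\}\oplus\{c\,dt\}$, $a,b,c\in\Bbbk$. $C^*_\cup([0,1])$ is the dg algebra $(C^*([0,1]),d,\cup)$ with unit the constant function $1$ and $t\cup t=t$, $t\cup dt=0$, $dt\cup t=dt$. $C^*_\infty([0,1])$ is $C^*([0,1])$ with the $C_\infty$ structure, unital with respect to $1$, with Taylor coefficients: $m_1(\mathbf{s}t)=-\mathbf{s}dt$, $m_2(\mathbf{s}t\otimes\mathbf{s}t)=\mathbf{s}t$, $m_2(\mathbf{s}t\otimes\mathbf{s}dt)=\frac12\mathbf{s}dt=-m_2(\mathbf{s}dt\otimes\mathbf{s}t)$, and for $n>1$, $m_{n+1}$ vanishes unless precisely one argument is a function,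 with $m_{n+1}((\mathbf{s}dt)^{\otimes i}\otimes\mathbf{s}t\otimes(\mathbf{s}dt)^{\otimes n-i})=(-1)^{i+1}\binom{n}{i}\frac{B_n}{n!}\mathbf{s}dt$, where $\frac{z}{e^z-1}=\sum_{n\ge0}\frac{B_n}{n!}z^n$. **The morphism $\lambda$** is the $A_\infty$ morphism $\Omega^*([0,1])\to C^*_\cup([0,1])$ with $\lambda_1=\pi$, where $\pi(f)=f(1)t+f(0)(1-t)$ on functions and $\pi(a(t)dt)=\left(\int_0^1a(\tau)d\tau\right)dt$; for $n>1$, $\lambda_n$ vanishes if some factor is a zero-form; and $\lambda_n(\mathbf{s}a_1(t)dt\otimes\cdots\otimes\mathbf{s}a_n(t)dt)=\left(\int_{0\le t_1\le\cdots\le t_n\le1}a_1(t_1)\cdots a_n(t_n)dt_1\cdots dt_n\right)\mathbf{s}dt$ for $n\ge1$. **The morphism $\log$** is the $A_\infty$ isomorphism $C^*_\cup([0,1])\to C^*_\infty([0,1])$ with $\log_1=\mathrm{id}$, $\log_n$ ($n>1$) vanishing if some factor is a zero-form, and $\log_n((\mathbf{s}dt)^{\otimes n})=\frac{(-1)^{n+1}}{n}\mathbf{s}dt$ for $n\ge1$. *)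

theory Defs
  imports "HOL-Analysis.Analysis" "HOL-Library.Function_Algebras"
    "HOL-Computational_Algebra.Formal_Power_Series"
begin

section \<open>Graded vector spaces\<close>

text \<open>
  A graded vector space is given by its scalar multiplication and the projections
  \<open>cmp V i\<close> onto the homogeneous components \<open>V\<^sup>i\<close>; the vectors are all elements of the type.
  The suspension has the same underlying vectors (\<open>\<^bold>s\<close> is the identity on them) and
  the shifted grading \<open>(\<^bold>sV)\<^sup>i = V\<^sup>i\<^sup>+\<^sup>1\<close>.
\<close>

record ('k, 'v) gvs =
  scl :: "'k \<Rightarrow> 'v \<Rightarrow> 'v"
  cmp :: "int \<Rightarrow> 'v \<Rightarrow> 'v"

definition graded_vs :: "('k::field, 'v::ab_group_add) gvs \<Rightarrow> bool" where
  "graded_vs V \<longleftrightarrow>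
     vector_space (scl V) \<and>
     (\<forall>i. Vector_Spaces.linear (scl V) (scl V) (cmp V i)) \<and>
     (\<forall>i j v. cmp V i (cmp V j v) = (if i = j then cmp V j v else 0)) \<and>
     (\<forall>v. finite {i. cmp V i v \<noteq> 0} \<and> v = (\<Sum>i | cmp V i v \<noteq> 0. cmp V i v))"

definition homogeneous :: "('k, 'v) gvs \<Rightarrow> int \<Rightarrow> 'v \<Rightarrow> bool" where
  "homogeneous V i v \<longleftrightarrow> cmp V i v = v"

definition susp :: "('k, 'v) gvs \<Rightarrow> ('k, 'v) gvs" where
  "susp V = V\<lparr>cmp := \<lambda>i. cmp V (i + 1)\<rparr>"

text \<open>The sum of the components of odd (\<open>b = True\<close>) or even (\<open>b = False\<close>) degree.\<close>
definition parity_part :: "('k, 'v::ab_group_add) gvs \<Rightarrow> bool \<Rightarrow> 'v \<Rightarrow> 'v" where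
  "parity_part V b v = (\<Sum>i | cmp V i v \<noteq> 0 \<and> odd i = b. cmp V i v)"

text \<open>The linear map \<open>v \<mapsto> (-1)\<^bsup>|v|\<^esup> v\<close>, which carries the Koszul signs of degree one maps.\<close>
definition sgn_map :: "('k, 'v::ab_group_add) gvs \<Rightarrow> 'v \<Rightarrow> 'v" where
  "sgn_map V v = parity_part V False v - parity_part V True v"


section \<open>The reduced tensor coalgebra\<close>

text \<open>
  A function on words is multilinear if its restriction to the words of each length is.
  The tensor \<open>v\<^sub>1 \<otimes> \<dots> \<otimes> v\<^sub>n\<close> is realised as the functional \<open>M \<mapsto> M [v\<^sub>1, \<dots>, v\<^sub>n]\<close> on such
  functions.  Over a field multilinear forms separate the elements of \<open>V\<^sup>\<otimes>\<^sup>n\<close>, so the span of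
  these functionals over all nonempty words is \<open>\<Oplus>\<^sub>n\<^sub>\<ge>\<^sub>1 V\<^sup>\<otimes>\<^sup>n\<close>.  Functionals take the value 0 at
  arguments that are not multilinear, so that tensors are equal iff they are equal as functions.
  A multilinear function \<open>L\<close> on words with values in tensors extends linearly
  to \<open>x \<mapsto> (\<lambda>M. x (\<lambda>vs. L vs M))\<close>.
\<close>

type_synonym ('k, 'v) tens = "('v list \<Rightarrow> 'k) \<Rightarrow> 'k"
type_synonym ('k, 'v) tens2 = "('v list \<Rightarrow> 'v list \<Rightarrow> 'k) \<Rightarrow> 'k"

definition multilin :: "('k::field, 'v::ab_group_add) gvs \<Rightarrow> ('v list \<Rightarrow> 'k) \<Rightarrow> bool" where
  "multilin V M \<longleftrightarrow> (\<forall>us ws c x y.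
     M (us @ (scl V c x + y) # ws) = c * M (us @ x # ws) + M (us @ y # ws))"

definition ten :: "('k::field, 'v::ab_group_add) gvs \<Rightarrow> 'v list \<Rightarrow> ('k, 'v) tens" where
  "ten V vs = (\<lambda>M. if multilin V M then M vs else 0)"

definition tscale :: "'k::field \<Rightarrow> ('x \<Rightarrow> 'k) \<Rightarrow> ('x \<Rightarrow> 'k)" where
  "tscale c x = (\<lambda>M. c * x M)"

definition Tbar :: "('k::field, 'v::ab_group_add) gvs \<Rightarrow> ('k, 'v) tens set" where
  "Tbar V = module.span tscale (ten V ` {vs. vs \<noteq> []})"

definition Tbar_deg :: "('k::field, 'v::ab_group_add) gvs \<Rightarrow> int \<Rightarrow> ('k, 'v) tens set" where
  "Tbar_deg V d = module.span tscale
     {ten V vs |vs ds. vs \<noteq> [] \<and> list_all2 (homogeneous V) ds vs \<and> sum_list ds = d}"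

definition lin_ext ::
  "('k::field, 'w::ab_group_add) gvs \<Rightarrow> ('v list \<Rightarrow> ('k, 'w) tens) \<Rightarrow> ('k, 'v) tens \<Rightarrow> ('k, 'w) tens"
where
  "lin_ext W L x = (\<lambda>M. if multilin W M then x (\<lambda>vs. L vs M) else 0)"

text \<open>The map \<open>x \<mapsto> (-1)\<^bsup>|x|\<^esup> x\<close> on the tensor coalgebra.\<close>
definition tsgn :: "('k::field, 'v::ab_group_add) gvs \<Rightarrow> ('k, 'v) tens \<Rightarrow> ('k, 'v) tens" where
  "tsgn V = lin_ext V (\<lambda>vs. ten V (map (sgn_map V) vs))"

text \<open>
  \<open>Tbar V \<otimes> Tbar V\<close> is modelled in the same way, by functionals on functions of two words that
  are multilinear in each of them.  Only nonempty words matter.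
\<close>
definition bimultilin ::
  "('k::field, 'v::ab_group_add) gvs \<Rightarrow> ('v list \<Rightarrow> 'v list \<Rightarrow> 'k) \<Rightarrow> bool" where
  "bimultilin V B \<longleftrightarrow>
     (\<forall>ws. ws \<noteq> [] \<longrightarrow> multilin V (\<lambda>us. B us ws)) \<and> (\<forall>us. us \<noteq> [] \<longrightarrow> multilin V (B us))"

definition tensor2 ::
  "('k::field, 'v::ab_group_add) gvs \<Rightarrow> ('k, 'v) tens \<Rightarrow> ('k, 'v) tens \<Rightarrow> ('k, 'v) tens2" where
  "tensor2 V x y = (\<lambda>B. if bimultilin V B then x (\<lambda>us. y (B us)) else 0)"

text \<open>The map \<open>f \<otimes> g\<close>; no sign is inserted.\<close>
definition tensor_map ::
  "('k::field, 'v::ab_group_add) gvs \<Rightarrow> ('k, 'w::ab_group_add) gvs \<Rightarrow>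
   (('k, 'v) tens \<Rightarrow> ('k, 'w) tens) \<Rightarrow> (('k, 'v) tens \<Rightarrow> ('k, 'w) tens) \<Rightarrow>
   ('k, 'v) tens2 \<Rightarrow> ('k, 'w) tens2" where
  "tensor_map V W f g z = (\<lambda>B. if bimultilin W B
     then z (\<lambda>us ws. tensor2 W (f (ten V us)) (g (ten V ws)) B) else 0)"

text \<open>
  The reduced deconcatenation
  \<open>v\<^sub>1 \<otimes> \<dots> \<otimes> v\<^sub>n \<mapsto> \<Sum>\<^sub>0\<^sub><\<^sub>i\<^sub><\<^sub>n (v\<^sub>1 \<otimes> \<dots> \<otimes> v\<^sub>i) \<otimes> (v\<^sub>i\<^sub>+\<^sub>1 \<otimes> \<dots> \<otimes> v\<^sub>n)\<close>.
\<close>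
definition deconc :: "('k::field, 'v::ab_group_add) gvs \<Rightarrow> ('k, 'v) tens \<Rightarrow> ('k, 'v) tens2" where
  "deconc V x = (\<lambda>B. if bimultilin V B
     then x (\<lambda>vs. \<Sum>i\<in>{0<..<length vs}. B (take i vs) (drop i vs)) else 0)"

definition tbar_linear ::
  "('k::field, 'v::ab_group_add) gvs \<Rightarrow> ('k, 'w::ab_group_add) gvs \<Rightarrow> int \<Rightarrow>
   (('k, 'v) tens \<Rightarrow> ('k, 'w) tens) \<Rightarrow> bool" where
  "tbar_linear V W k f \<longleftrightarrow>
     f ` Tbar V \<subseteq> Tbar W \<and>
     (\<forall>x\<in>Tbar V. \<forall>y\<in>Tbar V. f (x + y) = f x + f y) \<and>
     (\<forall>c. \<forall>x\<in>Tbar V. f (tscale c x) = tscale c (f x)) \<and>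
     (\<forall>d. f ` Tbar_deg V d \<subseteq> Tbar_deg W (d + k))"


section \<open>The shuffle product\<close>

text \<open>Positions are counted from 0, so the exceptional descent is allowed at \<open>Suc i = p\<close>.\<close>
definition shuffle_perms :: "nat \<Rightarrow> nat \<Rightarrow> (nat \<Rightarrow> nat) set" where
  "shuffle_perms p n =
     {\<sigma>. \<sigma> permutes {..<n} \<and> (\<forall>i. Suc i < n \<and> Suc i \<noteq> p \<longrightarrow> \<sigma> i < \<sigma> (Suc i))}"

text \<open>The Koszul sign of \<open>\<sigma>\<close> for factors whose degrees have the parities \<open>b\<close> (\<open>True\<close> is odd).\<close>
definition koszul_sign :: "(nat \<Rightarrow> bool) \<Rightarrow> nat \<Rightarrow> (nat \<Rightarrow> nat) \<Rightarrow> 'k::field" where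
  "koszul_sign b n \<sigma> = (- 1) ^ card {(i, j). i < j \<and> j < n \<and> \<sigma> j < \<sigma> i \<and> b i \<and> b j}"

text \<open>Arbitrary vectors are split into their even and odd parts, on which the signs are defined.\<close>
definition shuffle_words ::
  "('k::field, 'v::ab_group_add) gvs \<Rightarrow> 'v list \<Rightarrow> 'v list \<Rightarrow> ('k, 'v) tens" where
  "shuffle_words V us ws = (let vs = us @ ws; n = length vs in
     \<Sum>bs | length bs = n. \<Sum>\<sigma>\<in>shuffle_perms (length us) n.
       tscale (koszul_sign ((!) bs) n \<sigma>)
         (ten V (map (\<lambda>k. parity_part V (bs ! inv \<sigma> k) (vs ! inv \<sigma> k)) [0..<n])))"

definition shuffle_prod ::
  "('k::field, 'v::ab_group_add) gvs \<Rightarrow> ('k, 'v) tens \<Rightarrow> ('k, 'v) tens \<Rightarrow> ('k, 'v) tens" where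
  "shuffle_prod V x y =
     (\<lambda>M. if multilin V M then x (\<lambda>us. y (\<lambda>ws. shuffle_words V us ws M)) else 0)"


section \<open>\<open>A\<^sub>\<infinity>\<close> and \<open>C\<^sub>\<infinity>\<close> structures\<close>

text \<open>Since \<open>|Q| = 1\<close>, \<open>(1 \<otimes> Q) (x \<otimes> y) = (-1)\<^bsup>|x|\<^esup> x \<otimes> Q y\<close>.\<close>
definition coderivation ::
  "('k::field, 'v::ab_group_add) gvs \<Rightarrow> (('k, 'v) tens \<Rightarrow> ('k, 'v) tens) \<Rightarrow> bool" where
  "coderivation V Q \<longleftrightarrow> tbar_linear V V 1 Q \<and>
     (\<forall>x\<in>Tbar V. deconc V (Q x) =
        tensor_map V V Q id (deconc V x) + tensor_map V V (tsgn V) Q (deconc V x))"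

definition Ainf_algebra ::
  "('k::field, 'v::ab_group_add) gvs \<Rightarrow> (('k, 'v) tens \<Rightarrow> ('k, 'v) tens) \<Rightarrow> bool" where
  "Ainf_algebra V Q \<longleftrightarrow>
     graded_vs V \<and> coderivation (susp V) Q \<and> (\<forall>x\<in>Tbar (susp V). Q (Q x) = 0)"

definition Cinf_algebra ::
  "('k::field, 'v::ab_group_add) gvs \<Rightarrow> (('k, 'v) tens \<Rightarrow> ('k, 'v) tens) \<Rightarrow> bool" where
  "Cinf_algebra V Q \<longleftrightarrow> Ainf_algebra V Q \<and>
     (\<forall>x\<in>Tbar (susp V). \<forall>y\<in>Tbar (susp V).
        Q (shuffle_prod (susp V) x y) =
          shuffle_prod (susp V) (Q x) y + shuffle_prod (susp V) (tsgn (susp V) x) (Q y))"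

definition coalgebra_morphism ::
  "('k::field, 'v::ab_group_add) gvs \<Rightarrow> ('k, 'w::ab_group_add) gvs \<Rightarrow>
   (('k, 'v) tens \<Rightarrow> ('k, 'w) tens) \<Rightarrow> bool" where
  "coalgebra_morphism V W F \<longleftrightarrow> tbar_linear V W 0 F \<and>
     (\<forall>x\<in>Tbar V. deconc W (F x) = tensor_map V W F F (deconc V x))"

definition Ainf_morphism ::
  "('k::field, 'v::ab_group_add) gvs \<Rightarrow> (('k, 'v) tens \<Rightarrow> ('k, 'v) tens) \<Rightarrow>
   ('k, 'w::ab_group_add) gvs \<Rightarrow> (('k, 'w) tens \<Rightarrow> ('k, 'w) tens) \<Rightarrow>
   (('k, 'v) tens \<Rightarrow> ('k, 'w) tens) \<Rightarrow> bool" where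
  "Ainf_morphism V Q W R F \<longleftrightarrow>
     Ainf_algebra V Q \<and> Ainf_algebra W R \<and> coalgebra_morphism (susp V) (susp W) F \<and>
     (\<forall>x\<in>Tbar (susp V). F (Q x) = R (F x))"

definition Cinf_morphism ::
  "('k::field, 'v::ab_group_add) gvs \<Rightarrow> (('k, 'v) tens \<Rightarrow> ('k, 'v) tens) \<Rightarrow>
   ('k, 'w::ab_group_add) gvs \<Rightarrow> (('k, 'w) tens \<Rightarrow> ('k, 'w) tens) \<Rightarrow>
   (('k, 'v) tens \<Rightarrow> ('k, 'w) tens) \<Rightarrow> bool" where
  "Cinf_morphism V Q W R F \<longleftrightarrow>
     Cinf_algebra V Q \<and> Cinf_algebra W R \<and> Ainf_morphism V Q W R F \<and>
     (\<forall>x\<in>Tbar (susp V). \<forall>y\<in>Tbar (susp V).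
        F (shuffle_prod (susp V) x y) = shuffle_prod (susp W) (F x) (F y))"

text \<open>
  The coderivation of \<open>Tbar V\<close> and the coalgebra morphism into \<open>Tbar W\<close> with given Taylor
  coefficients.  These are passed as one function on words, whose restriction to the words of
  length \<open>n\<close> is the \<open>n\<close>-th coefficient (of degree 1 and 0, respectively); the value at the
  empty word is not used.
\<close>

definition coder_of ::
  "('k::field, 'v::ab_group_add) gvs \<Rightarrow> ('v list \<Rightarrow> 'v) \<Rightarrow> ('k, 'v) tens \<Rightarrow> ('k, 'v) tens" where
  "coder_of V q = lin_ext V (\<lambda>vs. \<Sum>(i, j) | 1 \<le> j \<and> i + j \<le> length vs.
     ten V (map (sgn_map V) (take i vs) @ q (take j (drop i vs)) # drop (i + j) vs))"

definition comorph_of ::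
  "('k::field, 'w::ab_group_add) gvs \<Rightarrow> ('v list \<Rightarrow> 'w) \<Rightarrow> ('k, 'v) tens \<Rightarrow> ('k, 'w) tens" where
  "comorph_of W f = lin_ext W (\<lambda>vs. \<Sum>bs | concat bs = vs \<and> [] \<notin> set bs. ten W (map f bs))"

definition dga_taylor ::
  "('k, 'v::ab_group_add) gvs \<Rightarrow> ('v \<Rightarrow> 'v) \<Rightarrow> ('v \<Rightarrow> 'v \<Rightarrow> 'v) \<Rightarrow> 'v list \<Rightarrow> 'v" where
  "dga_taylor V d m vs =
     (case vs of [a] \<Rightarrow> - d a | [a, b] \<Rightarrow> m (sgn_map V a) b | _ \<Rightarrow> 0)"


section \<open>Differential forms on the unit interval\<close>

text \<open>The pair \<open>(f, a)\<close> stands for the form \<open>f + a dt\<close>.\<close>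
type_synonym 'a form = "'a \<times> 'a"

definition forms_gvs :: "('k \<Rightarrow> 'a \<Rightarrow> 'a) \<Rightarrow> ('k, 'a::ab_group_add form) gvs" where
  "forms_gvs s =
     \<lparr>scl = (\<lambda>c (f, a). (s c f, s c a)),
      cmp = (\<lambda>i (f, a). if i = 0 then (f, 0) else if i = 1 then (0, a) else 0)\<rparr>"

definition form_d :: "('a \<Rightarrow> 'a) \<Rightarrow> 'a::ab_group_add form \<Rightarrow> 'a form" where
  "form_d D = (\<lambda>(f, a). (0, D f))"

definition form_mult :: "'a::comm_ring form \<Rightarrow> 'a form \<Rightarrow> 'a form" where
  "form_mult = (\<lambda>(f, a) (g, b). (f * g, f * b + a * g))"

subsection \<open>Polynomial forms\<close>

definition poly_forms :: "('k::field_char_0, 'k poly form) gvs" where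
  "poly_forms = forms_gvs smult"

definition poly_forms_Q ::
  "('k::field_char_0, 'k poly form) tens \<Rightarrow> ('k, 'k poly form) tens" where
  "poly_forms_Q = coder_of (susp poly_forms) (dga_taylor poly_forms (form_d pderiv) form_mult)"

definition poly_antideriv :: "'k::field_char_0 poly \<Rightarrow> 'k poly" where
  "poly_antideriv p = (\<Sum>i\<le>degree p. monom (coeff p i / of_nat (Suc i)) (Suc i))"

text \<open>
  The formal integral of \<open>a\<^sub>1(t\<^sub>1) \<dots> a\<^sub>n(t\<^sub>n)\<close> over \<open>0 \<le> t\<^sub>1 \<le> \<dots> \<le> t\<^sub>n \<le> 1\<close>, evaluated
  iteratively: integrate \<open>t\<^sub>1\<close> from 0 to \<open>t\<^sub>2\<close>, and so on, and finally \<open>t\<^sub>n\<close> from 0 to 1.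
\<close>
definition poly_simplex_integral :: "'k::field_char_0 poly list \<Rightarrow> 'k" where
  "poly_simplex_integral as = poly (fold (\<lambda>a J. poly_antideriv (J * a)) as 1) 1"

subsection \<open>Smooth forms\<close>

primrec C_k :: "nat \<Rightarrow> (real \<Rightarrow> real) \<Rightarrow> bool" where
  "C_k 0 f \<longleftrightarrow> continuous_on {0..1} f"
| "C_k (Suc k) f \<longleftrightarrow>
     (\<exists>f'. (\<forall>x\<in>{0..1}. (f has_real_derivative f' x) (at x within {0..1})) \<and> C_k k f')"

lemma C_k_const: "C_k k (\<lambda>x. c)"
proof (induction k arbitrary: c)
  case (Suc k)
  have "\<forall>x\<in>{0..1}. ((\<lambda>x. c) has_real_derivative (\<lambda>_. 0) x) (at x within {0..1})"
    by simp
  with Suc show ?case by (metis C_k.simps(2))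
qed simp

lemma C_k_SucD: "C_k (Suc k) f \<Longrightarrow> C_k k f"
proof (induction k arbitrary: f)
  case 0
  then show ?case
    using DERIV_continuous_on by (metis C_k.simps)
next
  case (Suc k)
  then show ?case by (metis C_k.simps(2))
qed

lemma C_k_add: "C_k k f \<Longrightarrow> C_k k g \<Longrightarrow> C_k k (\<lambda>x. f x + g x)"
proof (induction k arbitrary: f g)
  case (Suc k)
  then obtain f' g' where
    "\<forall>x\<in>{0..1}. (f has_real_derivative f' x) (at x within {0..1})" "C_k k f'"
    "\<forall>x\<in>{0..1}. (g has_real_derivative g' x) (at x within {0..1})" "C_k k g'"
    by auto
  with Suc.IH show ?case
    by (auto intro!: exI[of _ "\<lambda>x. f' x + g' x"] DERIV_add)
qed (auto intro: continuous_intros)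

lemma C_k_mult: "C_k k f \<Longrightarrow> C_k k g \<Longrightarrow> C_k k (\<lambda>x. f x * g x)"
proof (induction k arbitrary: f g)
  case (Suc k)
  from Suc.prems obtain f' g' where *:
    "\<forall>x\<in>{0..1}. (f has_real_derivative f' x) (at x within {0..1})" "C_k k f'"
    "\<forall>x\<in>{0..1}. (g has_real_derivative g' x) (at x within {0..1})" "C_k k g'"
    by auto
  have "C_k k (\<lambda>x. f' x * g x + g' x * f x)"
    using * Suc.prems[THEN C_k_SucD] by (intro C_k_add Suc.IH)
  with * show ?case
    by (auto intro!: exI[of _ "\<lambda>x. f' x * g x + g' x * f x"] DERIV_mult)
qed (auto intro: continuous_intros)

lemma C_k_cong: "(\<And>x. x \<in> {0..1} \<Longrightarrow> f x = g x) \<Longrightarrow> C_k k f \<longleftrightarrow> C_k k g"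
proof (cases k)
  case (Suc k')
  assume "\<And>x. x \<in> {0..1} \<Longrightarrow> f x = g x"
  then have "(f has_real_derivative d) (at x within {0..1}) \<longleftrightarrow>
      (g has_real_derivative d) (at x within {0..1})" if "x \<in> {0..1}" for x d
    using that by (intro has_field_derivative_cong_ev) (auto simp: eventually_at_filter)
  with Suc show ?thesis by auto
next
  case 0
  assume "\<And>x. x \<in> {0..1} \<Longrightarrow> f x = g x"
  with 0 show ?thesis using continuous_on_cong[of "{0..1}" "{0..1}" f g] by simp
qed

text \<open>
  Smooth functions on the closed interval, with one-sided derivatives at the end points.
  Functions on the interval are represented by functions that vanish outside of it.
\<close>
typedef smooth01 = "{f :: real \<Rightarrow> real. (\<forall>k. C_k k f) \<and> (\<forall>x. x \<notin> {0..1} \<longrightarrow> f x = 0)}"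
  by (rule exI[of _ "\<lambda>_. 0"]) (simp add: C_k_const)

setup_lifting type_definition_smooth01

instantiation smooth01 :: "{comm_ring, real_vector}"
begin

lift_definition zero_smooth01 :: smooth01 is "\<lambda>_. 0"
  by (simp add: C_k_const)

lift_definition plus_smooth01 :: "smooth01 \<Rightarrow> smooth01 \<Rightarrow> smooth01" is "\<lambda>f g x. f x + g x"
  by (simp add: C_k_add)

lift_definition times_smooth01 :: "smooth01 \<Rightarrow> smooth01 \<Rightarrow> smooth01" is "\<lambda>f g x. f x * g x"
  by (simp add: C_k_mult)

lift_definition uminus_smooth01 :: "smooth01 \<Rightarrow> smooth01" is "\<lambda>f x. - f x"
  using C_k_mult[OF C_k_const[of _ "-1"]] by simp

lift_definition minus_smooth01 :: "smooth01 \<Rightarrow> smooth01 \<Rightarrow> smooth01" is "\<lambda>f g x. f x - g x"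
  using C_k_add[OF _ C_k_mult[OF C_k_const[of _ "-1"]]] by simp

lift_definition scaleR_smooth01 :: "real \<Rightarrow> smooth01 \<Rightarrow> smooth01" is "\<lambda>c f x. c * f x"
  by (simp add: C_k_mult C_k_const)

instance
  by standard (transfer; simp add: algebra_simps fun_eq_iff)+

end

lift_definition smooth_deriv :: "smooth01 \<Rightarrow> smooth01" is
  "\<lambda>f x. if x \<in> {0..1} then vector_derivative f (at x within {0..1}) else 0"
proof (intro conjI allI impI)
  fix f :: "real \<Rightarrow> real" and k
  assume "(\<forall>k. C_k k f) \<and> (\<forall>x. x \<notin> {0..1} \<longrightarrow> f x = 0)"
  then have "C_k (Suc k) f" by blast
  then obtain f' where f': "\<forall>x\<in>{0..1}. (f has_real_derivative f' x) (at x within {0..1})" "C_k k f'"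
    by auto
  have "f' x = vector_derivative f (at x within {0..1})" if "x \<in> {0..1}" for x
    using f'(1) that
    by (intro vector_derivative_within_cbox[symmetric, where a = "0::real" and b = 1, simplified])
      (auto simp: has_real_derivative_iff_has_vector_derivative)
  then have "C_k k f' \<longleftrightarrow>
      C_k k (\<lambda>x. if x \<in> {0..1} then vector_derivative f (at x within {0..1}) else 0)"
    by (intro C_k_cong) auto
  with f'(2) show "C_k k (\<lambda>x. if x \<in> {0..1} then vector_derivative f (at x within {0..1}) else 0)"
    by simp
qed auto

definition smooth_forms :: "(real, smooth01 form) gvs" where
  "smooth_forms = forms_gvs scaleR"

definition smooth_forms_Q :: "(real, smooth01 form) tens \<Rightarrow> (real, smooth01 form) tens" where
  "smooth_forms_Q =
     coder_of (susp smooth_forms) (dga_taylor smooth_forms (form_d smooth_deriv) form_mult)"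

definition smooth_simplex_integral :: "smooth01 list \<Rightarrow> real" where
  "smooth_simplex_integral as = (let n = length as in
     LINT t : {t. (\<forall>i<n. 0 \<le> t i \<and> t i \<le> 1) \<and> (\<forall>i j. i \<le> j \<and> j < n \<longrightarrow> t i \<le> t j)}
       | (\<Pi>\<^sub>M i\<in>{..<n}. lborel). (\<Prod>i<n. Rep_smooth01 (as ! i) (t i)))"


section \<open>Whitney forms\<close>

text \<open>
  The triple \<open>(a, b, c)\<close> stands for the form \<open>a t + b (1 - t) + c dt\<close>.  Hence the unit is
  \<open>(1, 1, 0)\<close>, \<open>t\<close> is \<open>(1, 0, 0)\<close> and \<open>dt\<close> is \<open>(0, 0, 1)\<close>.
\<close>
type_synonym 'k whitney = "'k \<times> 'k \<times> 'k"

definition whitney_gvs :: "('k::field_char_0, 'k whitney) gvs" where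
  "whitney_gvs =
     \<lparr>scl = (\<lambda>x (a, b, c). (x * a, x * b, x * c)),
      cmp = (\<lambda>i (a, b, c). if i = 0 then (a, b, 0) else if i = 1 then (0, 0, c) else 0)\<rparr>"

definition whitney_d :: "'k::field_char_0 whitney \<Rightarrow> 'k whitney" where
  "whitney_d = (\<lambda>(a, b, c). (0, 0, a - b))"

definition whitney_form :: "'k::field_char_0 whitney \<Rightarrow> 'k poly form" where
  "whitney_form = (\<lambda>(a, b, c). (smult a [:0, 1:] + smult b (1 - [:0, 1:]), [:c:]))"

lemma whitney_form_d: "whitney_form (whitney_d w) = form_d pderiv (whitney_form w)"
  by (cases w) (simp add: whitney_form_def whitney_d_def form_d_def pderiv_add pderiv_smult
      pderiv_diff pderiv_pCons)

text \<open>
  The cup product, which is the codomain structure of \<open>\<lambda>\<close> and the domain structure of \<open>log\<close>.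
  The composite \<open>log \<circ> \<lambda>\<close> itself involves only the underlying coalgebra.
\<close>
definition cup :: "'k::field_char_0 whitney \<Rightarrow> 'k whitney \<Rightarrow> 'k whitney" where
  "cup = (\<lambda>(a, b, c) (a', b', c'). (a * a', b * b', b * c' + c * a'))"

lemma cup_basis:
  "cup (1, 1, 0) w = w" "cup w (1, 1, 0) = w"
  "cup (1, 0, 0) (1, 0, 0) = (1, 0, 0)"
  "cup (1, 0, 0) (0, 0, 1) = 0"
  "cup (0, 0, 1) (1, 0, 0) = (0, 0, 1)"
  "cup (0, 0, 1) (0, 0, 1) = 0"
  by (cases w; simp add: cup_def zero_prod_def)+

definition cup_Q :: "('k::field_char_0, 'k whitney) tens \<Rightarrow> ('k, 'k whitney) tens" where
  "cup_Q = coder_of (susp whitney_gvs) (dga_taylor whitney_gvs whitney_d cup)"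

definition bernoulli :: "nat \<Rightarrow> 'k::field_char_0" where
  "bernoulli n = fact n * fps_nth (fps_X / (fps_exp 1 - 1)) n"

text \<open>
  The multilinear extension of the prescribed values on the basis \<open>1, t, dt\<close>, using
  \<open>a t + b (1 - t) = (a - b) t + b 1\<close>.  The unit contributes only to \<open>m\<^sub>2\<close>, where
  \<open>m\<^sub>2 (\<^bold>s1 \<otimes> \<^bold>sx) = \<^bold>sx\<close> and \<open>m\<^sub>2 (\<^bold>sx \<otimes> \<^bold>s1) = (-1)\<^bsup>|x|\<^esup> \<^bold>sx\<close>.
\<close>
definition whitney_Cinf_taylor :: "'k::field_char_0 whitney list \<Rightarrow> 'k whitney" where
  "whitney_Cinf_taylor ws = (case ws of
       [] \<Rightarrow> 0
     | [w] \<Rightarrow> - whitney_d w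
     | [(a, b, c), (a', b', c')] \<Rightarrow>
         (a * a', b * b',
          (a - b) * c' / 2 + b * c' - (c * (a' - b') / 2 + c * b'))
     | _ \<Rightarrow> (let n = length ws - 1 in
         (0, 0, \<Sum>i\<le>n. (- 1) ^ (i + 1) * of_nat (n choose i) * bernoulli n / fact n *
            (fst (ws ! i) - fst (snd (ws ! i))) * (\<Prod>j\<in>{..n} - {i}. snd (snd (ws ! j))))))"

definition whitney_Cinf_Q :: "('k::field_char_0, 'k whitney) tens \<Rightarrow> ('k, 'k whitney) tens" where
  "whitney_Cinf_Q = coder_of (susp whitney_gvs) whitney_Cinf_taylor"


section \<open>The morphisms \<open>\<lambda>\<close> and \<open>log\<close>\<close>

text \<open>
  The parameters are the evaluations at 1 and 0 and the integral over the simplices.  A factor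
  that is a zero-form has vanishing \<open>snd\<close>.
\<close>
definition lambda_taylor ::
  "('a \<Rightarrow> 'k) \<Rightarrow> ('a \<Rightarrow> 'k) \<Rightarrow> ('a list \<Rightarrow> 'k) \<Rightarrow> 'a form list \<Rightarrow> 'k::field_char_0 whitney" where
  "lambda_taylor ev1 ev0 I ws = (case ws of
       [(f, a)] \<Rightarrow> (ev1 f, ev0 f, I [a])
     | _ \<Rightarrow> (0, 0, I (map snd ws)))"

definition poly_lambda ::
  "('k::field_char_0, 'k poly form) tens \<Rightarrow> ('k, 'k whitney) tens" where
  "poly_lambda = comorph_of (susp whitney_gvs)
     (lambda_taylor (\<lambda>f. poly f 1) (\<lambda>f. poly f 0) poly_simplex_integral)"

definition smooth_lambda :: "(real, smooth01 form) tens \<Rightarrow> (real, real whitney) tens" where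
  "smooth_lambda = comorph_of (susp whitney_gvs)
     (lambda_taylor (\<lambda>f. Rep_smooth01 f 1) (\<lambda>f. Rep_smooth01 f 0) smooth_simplex_integral)"

definition log_taylor :: "'k::field_char_0 whitney list \<Rightarrow> 'k whitney" where
  "log_taylor ws = (case ws of
       [w] \<Rightarrow> w
     | _ \<Rightarrow> (let n = length ws in
         (0, 0, (- 1) ^ (n + 1) / of_nat n * (\<Prod>w\<leftarrow>ws. snd (snd w)))))"

definition log_morphism :: "('k::field_char_0, 'k whitney) tens \<Rightarrow> ('k, 'k whitney) tens" where
  "log_morphism = comorph_of (susp whitney_gvs) log_taylor"

end

theory Submission
  imports Defs
begin

text \<open>
  The coefficients of \<open>\<phi> = log \<circ> \<lambda>\<close> on one-forms \<open>a\<^sub>1 dt, \<dots>, a\<^sub>n dt\<close> form the logarithm, for the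
  convolution product dual to deconcatenation, of the functional \<open>I\<close> of iterated integrals.  A
  product of two integrals over simplices is the sum of the integrals over the simplices of all
  shuffles, so \<open>I\<close> is a character of the shuffle algebra (\<open>I_shuffle\<close>), and the logarithm of a
  character vanishes on nontrivial shuffles (\<open>log_character_kills_shuffles\<close>).  If one argument is
  a function, all coefficients of \<open>\<phi>\<close> of arity at least two vanish.  Hence the Taylor coefficients
  of \<open>\<phi>\<close> kill shuffles, which makes \<open>\<phi>\<close> multiplicative (\<open>shuffle_comorph\<close>,
  \<open>comorph_of_shuffle_prod\<close>).

  That \<open>\<phi>\<close> commutes with the codifferentials is an identity between Taylor coefficients
  (\<open>comorph_intertwines\<close>).  It is proved for \<open>\<lambda>\<close> and \<open>log\<close> separately.  For \<open>\<lambda>\<close> it is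
  integration by parts: the boundary terms at the inner faces of the simplex cancel against the
  products of a function with a neighbouring one-form, and those at the two outermost faces produce
  the cup product (\<open>lambda_intertwines\<close>).  For \<open>log\<close> all but one argument is \<open>dt\<close>, and
  the coefficients are those of the identity
  \<open>\<beta> (ln (1 + y) - ln (1 + x)) (y - x) = (1 + x) (ln (1 + y) - ln (1 + x))\<close>
  with \<open>\<beta> z = z / (exp z - 1)\<close> (\<open>bernoulli_log_identity\<close>, \<open>log_intertwines\<close>).

  The two sides must also be shown to be \<open>C\<^sub>\<infinity>\<close> algebras.  For the forms this is associativity,
  the Leibniz rule and commutativity (\<open>Cinf_algebra_forms\<close>).  For the Whitney forms no further
  computation with Bernoulli numbers is needed: \<open>\<phi>\<close> maps onto their tensor coalgebra, because
  its linear part does, and it commutes with the codifferentials and the shuffle products, so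
  \<open>Q\<^sup>2 = 0\<close> and the derivation rule are inherited from the forms (\<open>Cinf_algebra_image\<close>).

  Tensors are functionals on multilinear functions of words.  All maps in question are
  precompositions with operators on such functions, and every identity between them is an identity
  between these operators, which is proved by induction on the word.  The polynomial and the smooth
  case are instances of one locale of rings with a derivation, an antiderivative and two evaluations.
\<close>

section \<open>Operators dual to coderivations and coalgebra morphisms\<close>

text \<open>The deconcatenation coproduct with both empty factors included, dually.  Recursion on the word
  makes coassociativity and the compatibilities below provable by structural induction.\<close>
fun splits :: "('a list \<Rightarrow> 'a list \<Rightarrow> 'b::comm_monoid_add) \<Rightarrow> 'a list \<Rightarrow> 'b" where
  "splits B [] = B [] []"
| "splits B (a # u) = B [] (a # u) + splits (\<lambda>x y. B (a # x) y) u"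

lemma splits_eq_sum: "splits B u = (\<Sum>i\<le>length u. B (take i u) (drop i u))"
  by (induction u arbitrary: B) (simp_all add: sum.atMost_Suc_shift del: sum.atMost_Suc)

lemma splits_cong:
  assumes "\<And>x y. x @ y = u \<Longrightarrow> B x y = C x y"
  shows "splits B u = splits C u"
  by (simp add: splits_eq_sum assms)

lemma splits_add: "splits (\<lambda>x y. B x y + C x y) u = splits B u + splits C u"
  by (simp add: splits_eq_sum sum.distrib)

lemma splits_zero [simp]: "splits (\<lambda>x y. 0) u = 0"
  by (simp add: splits_eq_sum)

lemma splits_additive:
  fixes B :: "'a list \<Rightarrow> 'a list \<Rightarrow> 'b::ab_group_add" and L :: "'b \<Rightarrow> 'c::ab_group_add"
  assumes "Modules.additive L"
  shows "L (splits B u) = splits (\<lambda>x y. L (B x y)) u"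
  by (simp add: splits_eq_sum Modules.additive.sum[OF assms])

text \<open>Coassociativity of deconcatenation.\<close>
lemma splits_assoc:
  "splits (\<lambda>x z. splits (\<lambda>x1 x2. B x1 x2 z) x) u = splits (\<lambda>x z. splits (B x) z) u"
proof (induction u arbitrary: B)
  case (Cons a u)
  from Cons[of "\<lambda>x. B (a # x)"] show ?case
    by (simp add: splits_add add.assoc)
qed simp

lemma splits_append_Cons:
  "splits B (us @ v # ws) =
     splits (\<lambda>x y. B x (y @ v # ws)) us + splits (\<lambda>x y. B (us @ v # x) y) ws"
  by (induction us arbitrary: B) (simp_all add: add.assoc)

lemma splits_map: "splits B (map g u) = splits (\<lambda>x y. B (map g x) (map g y)) u"
  by (simp add: splits_eq_sum take_map drop_map)

lemma splits_left_Nil: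
  "splits (\<lambda>x y. if x = [] then B y else 0) u = B u"
  by (cases u) simp_all

definition blocks :: "'a list \<Rightarrow> 'a list list set" where
  "blocks u = {bs. concat bs = u \<and> [] \<notin> set bs}"

lemma blocks_Nil [simp]: "blocks [] = {[]}"
  unfolding blocks_def by (auto simp: last_in_set) (metis list.set_intros(1) neq_Nil_conv)

lemma blocks_rec:
  assumes "u \<noteq> []"
  shows "blocks u = (\<Union>i\<in>{1..length u}. (#) (take i u) ` blocks (drop i u))"
proof (intro equalityI subsetI)
  fix bs assume bs: "bs \<in> blocks u"
  then obtain b cs where bc: "bs = b # cs"
    using assms by (cases bs) (auto simp: blocks_def)
  with bs have b: "b \<noteq> []" "u = b @ concat cs" "[] \<notin> set cs"
    by (auto simp: blocks_def)
  then have "length b \<in> {1..length u}" by (cases b) auto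
  moreover have "take (length b) u = b" "drop (length b) u = concat cs" using b by auto
  ultimately show "bs \<in> (\<Union>i\<in>{1..length u}. (#) (take i u) ` blocks (drop i u))"
    using b bc by (intro UN_I[of "length b"]) (auto simp: blocks_def)
next
  fix bs assume "bs \<in> (\<Union>i\<in>{1..length u}. (#) (take i u) ` blocks (drop i u))"
  then show "bs \<in> blocks u" using assms by (auto simp: blocks_def)
qed

lemma finite_blocks [simp]: "finite (blocks u)"
proof (induction u rule: length_induct)
  case (1 u)
  show ?case
  proof (cases "u = []")
    case False
    then show ?thesis
      unfolding blocks_rec[OF False] using 1 by (intro finite_UN_I finite_imageI) auto
  qed simp
qed

text \<open>The operator dual to the coalgebra morphism with Taylor coefficients \<open>f\<close>: the morphism sends a word
  to the sum of the words obtained by cutting it into blocks and applying \<open>f\<close> to each block.\<close>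
definition comorph :: "('a list \<Rightarrow> 'c) \<Rightarrow> ('c list \<Rightarrow> 'b::comm_monoid_add) \<Rightarrow> 'a list \<Rightarrow> 'b" where
  "comorph f M u = (\<Sum>bs\<in>blocks u. M (map f bs))"

lemma comorph_Nil [simp]: "comorph f M [] = M []"
  by (simp add: comorph_def)

text \<open>Sorting the decompositions by their first block gives a recursion on shorter words, which is what
  the later inductions use.\<close>
lemma comorph_rec:
  assumes "u \<noteq> []"
  shows "comorph f M u = splits (\<lambda>x y. if x = [] then 0 else comorph f (\<lambda>ws. M (f x # ws)) y) u"
proof -
  have "comorph f M u = (\<Sum>i\<in>{1..length u}. \<Sum>bs\<in>(#) (take i u) ` blocks (drop i u). M (map f bs))"
    unfolding comorph_def blocks_rec[OF assms]
  proof (rule sum.UNION_disjoint)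
    show "\<forall>i\<in>{1..length u}. \<forall>j\<in>{1..length u}. i \<noteq> j \<longrightarrow>
      (#) (take i u) ` blocks (drop i u) \<inter> (#) (take j u) ` blocks (drop j u) = {}"
    proof (intro ballI impI)
      fix i j assume ij: "i \<in> {1..length u}" "j \<in> {1..length u}" "i \<noteq> j"
      then have "length (take i u) \<noteq> length (take j u)" by auto
      then have "take i u \<noteq> take j u" by metis
      then show "(#) (take i u) ` blocks (drop i u) \<inter> (#) (take j u) ` blocks (drop j u) = {}"
        by auto
    qed
  qed auto
  also have "\<dots> = (\<Sum>i\<in>{1..length u}. comorph f (\<lambda>ws. M (f (take i u) # ws)) (drop i u))"
    by (intro sum.cong refl) (simp add: comorph_def sum.reindex)
  also have "\<dots> = (\<Sum>i\<in>{1..length u}. if take i u = [] then 0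
      else comorph f (\<lambda>ws. M (f (take i u) # ws)) (drop i u))"
    using assms by (intro sum.cong refl) auto
  also have "\<dots> = (\<Sum>i\<le>length u. if take i u = [] then 0
      else comorph f (\<lambda>ws. M (f (take i u) # ws)) (drop i u))"
    by (intro sum.mono_neutral_left) (auto simp: not_less_eq_eq)
  finally show ?thesis by (simp add: splits_eq_sum)
qed

lemma length_blocks:
  assumes "bs \<in> blocks u"
  shows "length bs \<le> length u"
proof -
  have "length bs \<le> length (concat bs)" if "[] \<notin> set bs"
    using that
  proof (induction bs)
    case (Cons b bs) then show ?case by (cases b) auto
  qed simp
  with assms show ?thesis by (auto simp: blocks_def)
qed

lemma comorph_cong:
  assumes "\<And>ws. length ws \<le> length u \<Longrightarrow> (u \<noteq> [] \<Longrightarrow> ws \<noteq> []) \<Longrightarrow> M ws = N ws"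
  shows "comorph f M u = comorph f N u"
proof -
  show ?thesis unfolding comorph_def
  proof (intro sum.cong refl assms)
    fix bs assume bs: "bs \<in> blocks u"
    then have "concat bs = u" "[] \<notin> set bs" by (auto simp: blocks_def)
    then show "length (map f bs) \<le> length u" "u \<noteq> [] \<Longrightarrow> map f bs \<noteq> []"
      using length_blocks[OF bs] by auto
  qed
qed

lemma comorph_add: "comorph f (\<lambda>ws. M ws + N ws) u = comorph f M u + comorph f N u"
  by (simp add: comorph_def sum.distrib)

lemma comorph_additive:
  fixes M :: "'c list \<Rightarrow> 'b::ab_group_add" and L :: "'b \<Rightarrow> 'd::ab_group_add"
  assumes "Modules.additive L"
  shows "L (comorph f M u) = comorph f (\<lambda>ws. L (M ws)) u"
  by (simp add: comorph_def Modules.additive.sum[OF assms])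

lemma comorph_zero [simp]: "comorph f (\<lambda>ws. 0) u = 0"
  by (simp add: comorph_def)

lemma comorph_sum_swap: "comorph f (\<lambda>ws. splits (B ws) w) u = splits (\<lambda>x y. comorph f (\<lambda>ws. B ws x y) u) w"
  unfolding comorph_def splits_eq_sum by (rule sum.swap)

text \<open>Compatibility with the coproduct: cutting the list of blocks in two is the same as cutting the
  word at a boundary between blocks.\<close>
lemma comorph_splits:
  "comorph f (splits B) u = splits (\<lambda>x y. comorph f (\<lambda>x'. comorph f (B x') y) x) u"
proof (induction u arbitrary: B rule: length_induct)
  case (1 u)
  show ?case
  proof (cases "u = []")
    case False
    have "comorph f (splits B) u =
        splits (\<lambda>x y. if x = [] then 0 else
          comorph f (\<lambda>ws. B [] (f x # ws) + splits (\<lambda>a b. B (f x # a) b) ws) y) u"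
      by (subst comorph_rec[OF False]) (simp cong: if_cong)
    also have "\<dots> = splits (\<lambda>x y. (if x = [] then 0 else comorph f (\<lambda>ws. B [] (f x # ws)) y) +
        (if x = [] then 0 else splits (\<lambda>y1 y2. comorph f (\<lambda>x'. comorph f (B (f x # x')) y2) y1) y)) u"
      using 1 False by (intro splits_cong) (auto simp: comorph_add neq_Nil_conv)
    also have "\<dots> = comorph f (B []) u + splits (\<lambda>x y. splits (\<lambda>y1 y2. if x = [] then 0 else
          comorph f (\<lambda>x'. comorph f (B (f x # x')) y2) y1) y) u"
      unfolding splits_add by (subst comorph_rec[OF False], intro arg_cong2[of _ _ _ _ "(+)"] refl splits_cong) auto
    also have "\<dots> = comorph f (B []) u + splits (\<lambda>x y. splits (\<lambda>x1 x2. if x1 = [] then 0 else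
          comorph f (\<lambda>x'. comorph f (B (f x1 # x')) y) x2) x) u"
      by (subst splits_assoc) rule
    also have "\<dots> = splits (\<lambda>x y. (if x = [] then comorph f (B []) y else 0) +
        (if x = [] then 0 else comorph f (\<lambda>x'. comorph f (B x') y) x)) u"
      unfolding splits_add splits_left_Nil
      by (intro arg_cong2[of _ _ _ _ "(+)"] refl splits_cong) (auto simp: comorph_rec)
    also have "\<dots> = splits (\<lambda>x y. comorph f (\<lambda>x'. comorph f (B x') y) x) u"
      by (intro splits_cong) auto
    finally show ?thesis .
  qed simp
qed

text \<open>The operator dual to the coderivation with Taylor coefficients \<open>q\<close>.  The letters that \<open>q\<close> passes are
  acted on by \<open>s\<close>, the sign of a map of degree one.\<close>
fun coder :: "('a \<Rightarrow> 'a) \<Rightarrow> ('a list \<Rightarrow> 'a) \<Rightarrow> ('a list \<Rightarrow> 'b::comm_monoid_add) \<Rightarrow> 'a list \<Rightarrow> 'b" where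
  "coder s q M [] = 0"
| "coder s q M (a # u) =
     splits (\<lambda>x y. if x = [] then 0 else M (q x # y)) (a # u) + coder s q (\<lambda>ws. M (s a # ws)) u"

lemma coder_cong:
  assumes "\<And>ws. ws \<noteq> [] \<Longrightarrow> length ws \<le> length u \<Longrightarrow> M ws = N ws"
  shows "coder s q M u = coder s q N u"
  using assms
proof (induction u arbitrary: M N)
  case (Cons a u)
  have "coder s q (\<lambda>ws. M (s a # ws)) u = coder s q (\<lambda>ws. N (s a # ws)) u"
    by (intro Cons) auto
  moreover have "splits (\<lambda>x y. if x = [] then 0 else M (q x # y)) (a # u) =
      splits (\<lambda>x y. if x = [] then 0 else N (q x # y)) (a # u)"
  proof (intro splits_cong if_cong refl Cons.prems)
    fix x y assume "x @ y = a # u" "x \<noteq> []"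
    then have "length x + length y = Suc (length u)" "length x > 0"
      by (metis length_append length_Cons, simp)
    then have "length y \<le> length u" by linarith
    then show "length (q x # y) \<le> length (a # u)" by simp
  qed auto
  ultimately show ?case by simp
qed simp

lemma coder_add: "coder s q (\<lambda>ws. M ws + N ws) u = coder s q M u + coder s q N u"
proof (induction u arbitrary: M N)
  case (Cons a u)
  have "splits (\<lambda>x y. if x = [] then 0 else M (q x # y) + N (q x # y)) (a # u) =
    splits (\<lambda>x y. if x = [] then 0 else M (q x # y)) (a # u) +
    splits (\<lambda>x y. if x = [] then 0 else N (q x # y)) (a # u)"
    unfolding splits_add[symmetric] by (intro splits_cong) auto
  with Cons show ?case by (simp add: ac_simps)
qed simp

lemma coder_zero [simp]: "coder s q (\<lambda>ws. 0) u = 0"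
  by (induction u) simp_all

lemma coder_additive:
  fixes M :: "'a list \<Rightarrow> 'b::ab_group_add" and L :: "'b \<Rightarrow> 'd::ab_group_add"
  assumes "Modules.additive L"
  shows "L (coder s q M u) = coder s q (\<lambda>ws. L (M ws)) u"
proof (induction u arbitrary: M)
  case (Cons a u)
  then show ?case
    by (simp add: Modules.additive.add[OF assms] splits_additive[OF assms] del: splits.simps)
      (simp add: if_distrib[of L] Modules.additive.zero[OF assms] del: splits.simps cong: if_cong)
qed (simp add: Modules.additive.zero[OF assms])

text \<open>The co-Leibniz rule, with the sign \<open>s\<close> on the left factor.\<close>
lemma coder_splits:
  "coder s q (splits B) u =
     splits (\<lambda>x y. coder s q (\<lambda>x'. B x' y) x + coder s q (B (map s x)) y) u"
proof (induction u arbitrary: B)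
  case (Cons v vs)
  let ?H = "\<lambda>x y. if x = [] then 0 else splits (\<lambda>y1 y2. B (q x # y1) y2) y"
  have 1: "splits (\<lambda>x y. if x = [] then 0 else splits B (q x # y)) (v # vs) =
      splits (\<lambda>x y. if x = [] then 0 else B [] (q x # y)) (v # vs) + splits ?H (v # vs)"
    unfolding splits_add[symmetric] by (intro splits_cong) auto
  have "splits ?H (v # vs) =
      splits (\<lambda>x y. splits (\<lambda>y1 y2. if x = [] then 0 else B (q x # y1) y2) y) (v # vs)"
    by (intro splits_cong) auto
  also have "\<dots> = splits (\<lambda>x y. splits (\<lambda>x1 x2. if x1 = [] then 0 else B (q x1 # x2) y) x) (v # vs)"
    by (subst splits_assoc) rule
  finally have 2: "splits ?H (v # vs) =
      splits (\<lambda>x y. splits (\<lambda>x1 x2. if x1 = [] then 0 else B (q x1 # x2) y) (v # x)) vs"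
    by simp
  have 3: "coder s q (\<lambda>ws. splits B (s v # ws)) vs = coder s q (\<lambda>ws. B [] (s v # ws)) vs +
      splits (\<lambda>x y. coder s q (\<lambda>x'. B (s v # x') y) x + coder s q (B (s v # map s x)) y) vs"
    using Cons[of "\<lambda>x. B (s v # x)"] by (simp add: coder_add)
  show ?case
    unfolding coder.simps(2)[of s q "splits B"] 1 2 3
    by (simp add: splits_add ac_simps)
qed simp

text \<open>Additivity in every letter.  It suffices wherever scalars are irrelevant, and unlike
  multilinearity it makes sense for values in any abelian group.\<close>
definition multiadd :: "('a::ab_group_add list \<Rightarrow> 'b::ab_group_add) \<Rightarrow> bool" where
  "multiadd M \<longleftrightarrow> (\<forall>us ws. Modules.additive (\<lambda>v. M (us @ v # ws)))"

lemma multiadd_Cons: "multiadd M \<Longrightarrow> multiadd (\<lambda>ws. M (v # ws))"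
  unfolding multiadd_def append_Cons[symmetric] by blast

lemma multiadd_head: "multiadd M \<Longrightarrow> Modules.additive (\<lambda>v. M (v # ws))"
  unfolding multiadd_def by (auto dest: spec[of _ "[]"])

lemma additive_comorph_head:
  assumes "multiadd M"
  shows "Modules.additive (\<lambda>v. comorph f (\<lambda>ws. M (v # ws)) u)"
  unfolding Modules.additive_def comorph_add[symmetric] Modules.additive.add[OF multiadd_head[OF assms]] by simp

text \<open>A morphism commutes with two coderivations as soon as the Taylor coefficients agree: the difference
  of both sides is a coderivation along the morphism and is determined by its corestriction.
  In terms of words, both sides are expanded by the first block, and the remaining block sums agree
  by induction on the length.\<close>
lemma comorph_intertwines:
  assumes taylor: "\<And>x. x \<noteq> [] \<Longrightarrow> coder s q f x = comorph f r x"
    and s: "\<And>x. x \<noteq> [] \<Longrightarrow> f (map s x) = s' (f x)"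
    and M: "multiadd M"
  shows "coder s q (comorph f M) u = comorph f (coder s' r M) u"
  using M
proof (induction u arbitrary: M rule: length_induct)
  case (1 u)
  show ?case
  proof (cases "u = []")
    case False
    \<comment> \<open>The block sums over \<open>y\<close> depend additively on the value \<open>v\<close> of the first block.\<close>
    define L where "L y v = comorph f (\<lambda>ws. M (v # ws)) y" for y v
    have L: "Modules.additive (L y)" for y
      unfolding L_def using 1(2) by (rule additive_comorph_head)
    let ?B = "\<lambda>x y. if x = [] then 0 else L y (f x)"
    let ?C = "\<lambda>x y. if x = [] then 0 else M (r x # y)"
    let ?T = "\<lambda>x y. if x = [] then 0 else comorph f (coder s' r (\<lambda>ws. M (s' (f x) # ws))) y"
    have "coder s q (comorph f M) u = coder s q (splits ?B) u"
      by (intro coder_cong) (simp add: comorph_rec L_def cong: if_cong)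
    also have "\<dots> = splits (\<lambda>x y. (if x = [] then 0 else L y (comorph f r x)) + ?T x y) u"
      unfolding coder_splits
    proof (intro splits_cong arg_cong2[of _ _ _ _ "(+)"])
      fix x y assume xy: "x @ y = u"
      have "coder s q (\<lambda>x'. ?B x' y) x = coder s q (\<lambda>x'. L y (f x')) x"
        by (intro coder_cong) auto
      also have "\<dots> = (if x = [] then 0 else L y (comorph f r x))"
        by (simp add: coder_additive[OF L, symmetric] taylor Modules.additive.zero[OF L])
      finally show "coder s q (\<lambda>x'. ?B x' y) x = (if x = [] then 0 else L y (comorph f r x))" .
      show "coder s q (?B (map s x)) y = ?T x y"
      proof (cases "x = []")
        case False
        then have "length y < length u" using xy by auto
        with 1 False show ?thesis
          by (simp add: L_def s multiadd_Cons cong: if_cong)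
      qed simp
    qed
    also have "\<dots> = comorph f (splits ?C) u + splits ?T u"
      unfolding splits_add comorph_splits
    proof (intro splits_cong arg_cong2[of _ _ _ _ "(+)"] refl)
      fix x y
      have "comorph f (\<lambda>x'. comorph f (?C x') y) x = comorph f (\<lambda>x'. if x = [] then 0 else L y (r x')) x"
        by (intro comorph_cong) (auto simp: L_def)
      then show "(if x = [] then 0 else L y (comorph f r x)) = comorph f (\<lambda>x'. comorph f (?C x') y) x"
        by (simp add: comorph_additive[OF L])
    qed
    also have "\<dots> = splits (\<lambda>x y. (if x = [] then 0 else comorph f (\<lambda>ws. splits ?C (f x # ws)) y) + ?T x y) u"
      by (simp add: splits_add comorph_rec[OF False, of _ "splits ?C"])
    also have "\<dots> = comorph f (coder s' r M) u"
      unfolding comorph_rec[OF False, of _ "coder s' r M"]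
      by (intro splits_cong) (simp add: comorph_add del: splits.simps)
    finally show ?thesis .
  qed simp
qed

text \<open>The composition formula for Taylor coefficients, by induction on the word along its first block.\<close>
lemma comorph_comp:
  assumes "multiadd M"
  shows "comorph f (comorph g M) u = comorph (comorph f g) M u"
  using assms
proof (induction u arbitrary: M rule: length_induct)
  case (1 u)
  show ?case
  proof (cases "u = []")
    case False
    let ?B = "\<lambda>x y. if x = [] then 0 else comorph g (\<lambda>ws. M (g x # ws)) y"
    have "comorph f (comorph g M) u = comorph f (splits ?B) u"
      using False by (intro comorph_cong) (simp add: comorph_rec)
    also have "\<dots> = splits (\<lambda>x y. if x = [] then 0 else
        comorph (comorph f g) (\<lambda>ws. M (comorph f g x # ws)) y) u"
      unfolding comorph_splits
    proof (intro splits_cong)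
      fix x y assume xy: "x @ y = u"
      show "comorph f (\<lambda>x'. comorph f (?B x') y) x =
          (if x = [] then 0 else comorph (comorph f g) (\<lambda>ws. M (comorph f g x # ws)) y)"
      proof (cases "x = []")
        case False
        then have "length y < length u" using xy by auto
        with 1 have IH: "comorph f (comorph g (\<lambda>ws. M (v # ws))) y = comorph (comorph f g) (\<lambda>ws. M (v # ws)) y" for v
          by (simp add: multiadd_Cons)
        have "comorph f (\<lambda>x'. comorph f (?B x') y) x = comorph f (\<lambda>x'. comorph (comorph f g) (\<lambda>ws. M (g x' # ws)) y) x"
          using False by (intro comorph_cong) (simp add: IH)
        with False show ?thesis
          by (simp add: comorph_additive[OF additive_comorph_head[OF 1(2)], symmetric])
      qed simp
    qed
    finally show ?thesis by (simp add: comorph_rec[OF False])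
  qed simp
qed

section \<open>Shuffles of words with signs\<close>

text \<open>The sign \<open>(-1)\<^sup>b\<close>, in a form that makes sense in every abelian group.\<close>
definition signed :: "bool \<Rightarrow> 'b::ab_group_add \<Rightarrow> 'b" where
  "signed b x = (if b then - x else x)"

lemma additive_sg: "Modules.additive (signed b)"
  by (simp add: Modules.additive_def signed_def)

lemma signed_0 [simp]: "signed b 0 = 0" and signed_False [simp]: "signed False x = x"
  by (simp_all add: signed_def)

lemma signed_sg: "signed a (signed b x) = signed (a \<noteq> b) x"
  by (simp add: signed_def)

lemma signed_eqI: "a = b \<Longrightarrow> x = y \<Longrightarrow> signed a x = signed b y"
  by simp

text \<open>Letters are tagged with the parity of their degree; this is the parity of a word.  The tags keep
  Koszul signs well-defined even when a letter is zero.\<close>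
fun parity :: "(bool \<times> 'a) list \<Rightarrow> bool" where
  "parity [] = False"
| "parity (a # u) = (fst a \<noteq> parity u)"

lemma parity_append: "parity (u @ w) = (parity u \<noteq> parity w)"
  by (induction u) auto

text \<open>The signed sum of \<open>M\<close> over the shuffles of two words, by the usual recursion on the first letters:
  moving \<open>b\<close> to the front means moving it past the whole first word.\<close>
fun shuffle :: "('a list \<Rightarrow> 'b::ab_group_add) \<Rightarrow> (bool \<times> 'a) list \<Rightarrow> (bool \<times> 'a) list \<Rightarrow> 'b" where
  "shuffle M [] w = M (map snd w)"
| "shuffle M (a # u) [] = M (map snd (a # u))"
| "shuffle M (a # u) (b # w) =
     shuffle (\<lambda>z. M (snd a # z)) u (b # w) + signed (fst b \<and> parity (a # u)) (shuffle (\<lambda>z. M (snd b # z)) (a # u) w)"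

lemma shuffle_Nil2 [simp]: "shuffle M u [] = M (map snd u)"
  by (cases u) simp_all

lemma shuffle_Nil1: "shuffle M [] = (\<lambda>w. M (map snd w))"
  by (rule ext) simp

lemma shuffle_cong:
  assumes "\<And>z. mset z = mset (map snd u) + mset (map snd w) \<Longrightarrow> M z = N z"
  shows "shuffle M u w = shuffle N u w"
  using assms
proof (induction M u w arbitrary: N rule: shuffle.induct)
  case (3 M a u b w)
  have "shuffle (\<lambda>z. M (snd a # z)) u (b # w) = shuffle (\<lambda>z. N (snd a # z)) u (b # w)"
    by (intro 3(1) 3(3)) simp
  moreover have "shuffle (\<lambda>z. M (snd b # z)) (a # u) w = shuffle (\<lambda>z. N (snd b # z)) (a # u) w"
    by (intro 3(2) 3(3)) simp
  ultimately show ?case by simp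
qed simp_all

lemma shuffle_add: "shuffle (\<lambda>z. M z + N z) u w = shuffle M u w + shuffle N u w"
proof (induction M u w arbitrary: N rule: shuffle.induct)
  case (3 M a u b w)
  show ?case
    unfolding shuffle.simps 3 Modules.additive.add[OF additive_sg] by (simp only: ac_simps)
qed simp_all

lemma shuffle_additive:
  assumes "Modules.additive L"
  shows "L (shuffle M u w) = shuffle (\<lambda>z. L (M z)) u w"
proof (induction M u w rule: shuffle.induct)
  case (3 M a u b w)
  then show ?case
    by (simp add: Modules.additive.add[OF assms] signed_def Modules.additive.minus[OF assms])
qed simp_all

lemma shuffle_zero [simp]: "shuffle (\<lambda>z. 0) u w = 0"
  using shuffle_additive[of "\<lambda>_. 0" "\<lambda>_. 0" u w] by (simp add: Modules.additive_def)

lemma additive_shuffle: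
  assumes "\<And>z. Modules.additive (\<lambda>v. G v z)"
  shows "Modules.additive (\<lambda>v. shuffle (G v) u w)"
  unfolding Modules.additive_def shuffle_add[symmetric] Modules.additive.add[OF assms] by simp

text \<open>The shuffle product is a morphism for deconcatenation.  The sign comes from exchanging the second
  part of the first word with the first part of the second word.\<close>
lemma shuffle_splits:
  "shuffle (splits B) u w = splits (\<lambda>u1 u2. splits (\<lambda>w1 w2.
     signed (parity u2 \<and> parity w1) (shuffle (\<lambda>x. shuffle (B x) u2 w2) u1 w1)) w) u"
proof (induction "length u + length w" arbitrary: u w B rule: less_induct)
  case less
  show ?case
  proof (cases "u = [] \<or> w = []")
    case True
    then show ?thesis by (auto simp: splits_map)
  next
    case False
    then obtain a u' b w' where uw: "u = a # u'" "w = b # w'"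
      by (meson neq_Nil_conv)
    have 1: "shuffle (splits (\<lambda>x y. B (snd a # x) y)) u' w =
        splits (\<lambda>u1 u2. splits (\<lambda>w1 w2.
          signed (parity u2 \<and> parity w1) (shuffle (\<lambda>x. shuffle (B (snd a # x)) u2 w2) u1 w1)) w) u'"
      by (rule less) (simp add: uw)
    have 2: "shuffle (splits (\<lambda>x y. B (snd b # x) y)) u w' =
        splits (\<lambda>u1 u2. splits (\<lambda>w1 w2.
          signed (parity u2 \<and> parity w1) (shuffle (\<lambda>x. shuffle (B (snd b # x)) u2 w2) u1 w1)) w') u"
      by (rule less) (simp add: uw)
    have 3: "signed (fst b \<and> parity u) (splits (\<lambda>u1 u2. splits (\<lambda>w1 w2.
          signed (parity u2 \<and> parity w1) (shuffle (\<lambda>x. shuffle (B (snd b # x)) u2 w2) u1 w1)) w') u) =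
        splits (\<lambda>u1 u2. splits (\<lambda>w1 w2.
          signed (fst b \<and> parity u) (signed (parity u2 \<and> parity w1) (shuffle (\<lambda>x. shuffle (B (snd b # x)) u2 w2) u1 w1))) w') u"
      by (simp add: splits_additive[OF additive_sg])
    have 4: "splits (\<lambda>u1 u2. splits (\<lambda>w1 w2.
          signed (fst b \<and> parity u) (signed (parity u2 \<and> parity w1) (shuffle (\<lambda>x. shuffle (B (snd b # x)) u2 w2) u1 w1))) w') u
        = splits (\<lambda>w1 w2. signed (parity u \<and> parity (b # w1)) (shuffle (B (map snd (b # w1))) u w2)) w'
          + splits (\<lambda>u1 u2. splits (\<lambda>w1 w2. signed (parity u2 \<and> parity (b # w1))
              (signed (fst b \<and> parity (a # u1)) (shuffle (\<lambda>x. shuffle (B (snd b # x)) u2 w2) (a # u1) w1))) w') u'"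
      unfolding uw splits.simps
    proof (intro arg_cong2[of _ _ _ _ "(+)"] splits_cong)
      fix u1 u2 w1 w2 assume "u1 @ u2 = u'"
      then have "parity u' = (parity u1 \<noteq> parity u2)" by (auto simp: parity_append)
      then show "signed (fst b \<and> parity (a # u')) (signed (parity u2 \<and> parity w1)
            (shuffle (\<lambda>x. shuffle (B (snd b # x)) u2 w2) (a # u1) w1)) =
          signed (parity u2 \<and> parity (b # w1))
              (signed (fst b \<and> parity (a # u1)) (shuffle (\<lambda>x. shuffle (B (snd b # x)) u2 w2) (a # u1) w1))"
        unfolding signed_sg by (intro signed_eqI) auto
    next
      fix w1 w2
      show "signed (fst b \<and> parity (a # u')) (signed (parity (a # u') \<and> parity w1)
            (shuffle (\<lambda>x. shuffle (B (snd b # x)) (a # u') w2) [] w1)) =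
          signed (parity (a # u') \<and> parity (b # w1)) (shuffle (B (map snd (b # w1))) (a # u') w2)"
        unfolding signed_sg by (intro signed_eqI) auto
    qed
    show ?thesis
      unfolding uw shuffle.simps splits.simps shuffle_add
      using 1 2 3 4
      by (simp add: uw splits_add Modules.additive.add[OF additive_sg] ac_simps)
  qed
qed

text \<open>If the first factor of a split is fed to a map that kills shuffles, only those splits of a shuffle
  survive whose first part comes from one of the two words alone.\<close>
lemma shuffle_splits_primitive:
  assumes G: "\<And>z. Modules.additive (\<lambda>v. G v z)"
    and kill: "\<And>u' w'. u' \<noteq> [] \<Longrightarrow> w' \<noteq> [] \<Longrightarrow> set u' \<subseteq> P \<Longrightarrow> set w' \<subseteq> P \<Longrightarrow> shuffle f u' w' = 0"
    and P: "set u \<subseteq> P" "set w \<subseteq> P"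
  shows "shuffle (splits (\<lambda>x y. if x = [] then 0 else G (f x) y)) u w =
     splits (\<lambda>u1 u2. if u1 = [] then 0 else shuffle (G (f (map snd u1))) u2 w) u +
     splits (\<lambda>w1 w2. if w1 = [] then 0 else
       signed (parity u \<and> parity w1) (shuffle (G (f (map snd w1))) u w2)) w"
proof -
  let ?B = "\<lambda>x y. if x = [] then 0 else G (f x) y"
  have "shuffle (splits ?B) u w = splits (\<lambda>u1 u2. splits (\<lambda>w1 w2.
      (if w1 = [] then if u1 = [] then 0 else shuffle (G (f (map snd u1))) u2 w2 else 0) +
      (if u1 = [] then if w1 = [] then 0 else
        signed (parity u2 \<and> parity w1) (shuffle (G (f (map snd w1))) u2 w2) else 0)) w) u"
    unfolding shuffle_splits
  proof (intro splits_cong)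
    fix u1 u2 w1 w2 assume uw: "u1 @ u2 = u" "w1 @ w2 = w"
    let ?L = "\<lambda>v. shuffle (G v) u2 w2"
    have L: "Modules.additive ?L" by (rule additive_shuffle) (rule G)
    show "signed (parity u2 \<and> parity w1) (shuffle (\<lambda>x. shuffle (?B x) u2 w2) u1 w1) =
      (if w1 = [] then if u1 = [] then 0 else shuffle (G (f (map snd u1))) u2 w2 else 0) +
      (if u1 = [] then if w1 = [] then 0 else
        signed (parity u2 \<and> parity w1) (shuffle (G (f (map snd w1))) u2 w2) else 0)"
    proof (cases "u1 = [] \<or> w1 = []")
      case True then show ?thesis by auto
    next
      case False
      have "shuffle (\<lambda>x. shuffle (?B x) u2 w2) u1 w1 = shuffle (\<lambda>x. ?L (f x)) u1 w1"
        using False by (intro shuffle_cong) auto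
      also have "\<dots> = ?L (shuffle f u1 w1)" by (simp add: shuffle_additive[OF L])
      also have "shuffle f u1 w1 = 0" using False P uw by (intro kill) auto
      finally show ?thesis using False by (simp add: Modules.additive.zero[OF L])
    qed
  qed
  also have "\<dots> = splits (\<lambda>u1 u2. splits (\<lambda>w1 w2.
      if w1 = [] then if u1 = [] then 0 else shuffle (G (f (map snd u1))) u2 w2 else 0) w) u +
      splits (\<lambda>u1 u2. if u1 = [] then splits (\<lambda>w1 w2. if w1 = [] then 0 else
        signed (parity u2 \<and> parity w1) (shuffle (G (f (map snd w1))) u2 w2)) w else 0) u"
    unfolding splits_add by (intro arg_cong2[of _ _ _ _ "(+)"] refl splits_cong) auto
  finally show ?thesis by (simp only: splits_left_Nil)
qed

lemma comorph_map:
  "comorph f M (map g u) = comorph (\<lambda>x. f (map g x)) M u"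
proof (induction u arbitrary: M rule: length_induct)
  case (1 u)
  show ?case
  proof (cases "u = []")
    case False
    then have "comorph f M (map g u) =
        splits (\<lambda>x y. if x = [] then 0 else comorph f (\<lambda>ws. M (f (map g x) # ws)) (map g y)) u"
      by (simp add: comorph_rec splits_map)
    also have "\<dots> = comorph (\<lambda>x. f (map g x)) M u"
      unfolding comorph_rec[OF False, of "\<lambda>x. f (map g x)"] using 1
      by (intro splits_cong) auto
    finally show ?thesis .
  qed simp
qed

lemma comorph_map_out: "comorph f (\<lambda>ws. M (map g ws)) u = comorph (\<lambda>x. g (f x)) M u"
  by (simp add: comorph_def comp_def)

lemma coder_map:
  assumes "\<And>a. g (s' a) = s (g a)" "\<And>x. g (q' x) = q (map g x)"
  shows "coder s q M (map g u) = coder s' q' (\<lambda>ws. M (map g ws)) u"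
proof (induction u arbitrary: M)
  case (Cons a u)
  have "splits (\<lambda>x y. if x = [] then 0 else M (q x # y)) (map g (a # u)) =
      splits (\<lambda>x y. if x = [] then 0 else M (map g (q' x # y))) (a # u)"
    unfolding splits_map by (intro splits_cong) (simp add: assms)
  with Cons show ?case by (simp add: assms del: splits.simps)
qed simp

text \<open>A Taylor coefficient of degree 0, acting on tagged words.\<close>
definition tag_comorph :: "('a list \<Rightarrow> 'c) \<Rightarrow> (bool \<times> 'a) list \<Rightarrow> bool \<times> 'c" where
  "tag_comorph f x = (parity x, f (map snd x))"

lemma tag_comorph_simps [simp]: "fst (tag_comorph f x) = parity x" "snd (tag_comorph f x) = f (map snd x)"
  by (simp_all add: tag_comorph_def)

lemma parity_map_tag_com: "parity (map (tag_comorph f) bs) = parity (concat bs)"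
  by (induction bs) (simp_all add: parity_append)

lemma comorph_par:
  "comorph (tag_comorph f) (\<lambda>u'. H (parity u') u') u = comorph (tag_comorph f) (H (parity u)) u"
  unfolding comorph_def by (intro sum.cong) (auto simp: parity_map_tag_com blocks_def)

lemma shuffle_rec:
  assumes "u \<noteq> []" "w \<noteq> []"
  shows "shuffle M u w = shuffle (\<lambda>z. M (snd (hd u) # z)) (tl u) w +
    signed (fst (hd w) \<and> parity u) (shuffle (\<lambda>z. M (snd (hd w) # z)) u (tl w))"
  using assms by (cases u; cases w) simp_all

lemma comorph_hd_tl:
  assumes "u \<noteq> []"
  shows "comorph f (\<lambda>ws. M (hd ws) (tl ws)) u =
    splits (\<lambda>x y. if x = [] then 0 else comorph f (M (f x)) y) u"
  by (simp add: comorph_rec[OF assms] cong: if_cong)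

text \<open>A coalgebra morphism whose Taylor coefficients kill nontrivial shuffles is multiplicative.  In a
  shuffle of two words the first block comes from one word only (\<open>shuffle_splits_primitive\<close>), and the
  remainder is handled by induction.  This is the recursion that the shuffle product of the
  two images satisfies.\<close>
lemma shuffle_comorph:
  assumes M: "multiadd M"
    and kill: "\<And>u' w'. u' \<noteq> [] \<Longrightarrow> w' \<noteq> [] \<Longrightarrow> set u' \<subseteq> P \<Longrightarrow> set w' \<subseteq> P \<Longrightarrow> shuffle f u' w' = 0"
    and P: "set u \<subseteq> P" "set w \<subseteq> P"
  shows "shuffle (comorph f M) u w = comorph (tag_comorph f) (\<lambda>u'. comorph (tag_comorph f) (shuffle M u') w) u"
  using M P
proof (induction "length u + length w" arbitrary: u w M rule: less_induct)
  case less
  let ?T = "tag_comorph f"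
  let ?R = "\<lambda>v u w. comorph ?T (\<lambda>u'. comorph ?T (shuffle (\<lambda>z. M (v # z)) u') w) u"
  show ?case
  proof (cases "u = [] \<or> w = []")
    case True
    then show ?thesis
      by (auto simp: comorph_map comorph_map_out shuffle_Nil1)
  next
    case False
    have IH: "shuffle (comorph f (\<lambda>z. M (v # z))) u' w' = ?R v u' w'"
      if "length u' + length w' < length u + length w" "set u' \<subseteq> set u" "set w' \<subseteq> set w" for u' w' v
      using that less.prems by (intro less.hyps) (auto simp: multiadd_Cons)
    have "shuffle (comorph f M) u w =
        shuffle (splits (\<lambda>x y. if x = [] then 0 else comorph f (\<lambda>z. M (f x # z)) y)) u w"
      using False by (intro shuffle_cong comorph_rec) auto
    also have "\<dots> =
       splits (\<lambda>u1 u2. if u1 = [] then 0 else shuffle (comorph f (\<lambda>z. M (f (map snd u1) # z))) u2 w) u +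
       splits (\<lambda>w1 w2. if w1 = [] then 0 else
         signed (parity u \<and> parity w1) (shuffle (comorph f (\<lambda>z. M (f (map snd w1) # z))) u w2)) w"
      using less.prems by (intro shuffle_splits_primitive[where P = P] additive_comorph_head kill)
    also have "\<dots> =
       splits (\<lambda>u1 u2. if u1 = [] then 0 else ?R (f (map snd u1)) u2 w) u +
       splits (\<lambda>w1 w2. if w1 = [] then 0 else signed (parity u \<and> parity w1) (?R (f (map snd w1)) u w2)) w"
      by (intro arg_cong2[of _ _ _ _ "(+)"] splits_cong) (auto simp: IH)
    also have "splits (\<lambda>u1 u2. if u1 = [] then 0 else ?R (f (map snd u1)) u2 w) u =
        comorph ?T (\<lambda>u'. comorph ?T (shuffle (\<lambda>z. M (snd (hd u') # z)) (tl u')) w) u"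
      using False
      by (subst comorph_hd_tl[where M = "\<lambda>a u'. comorph ?T (shuffle (\<lambda>z. M (snd a # z)) u') w"])
        (simp_all cong: if_cong)
    also have "splits (\<lambda>w1 w2. if w1 = [] then 0 else signed (parity u \<and> parity w1) (?R (f (map snd w1)) u w2)) w =
        splits (\<lambda>w1 w2. comorph ?T (\<lambda>u'. if w1 = [] then 0 else
          comorph ?T (\<lambda>w'. signed (parity w1 \<and> parity u') (shuffle (\<lambda>z. M (f (map snd w1) # z)) u' w')) w2) u) w"
    proof (intro splits_cong)
      fix w1 w2
      show "(if w1 = [] then 0 else signed (parity u \<and> parity w1) (?R (f (map snd w1)) u w2)) =
        comorph ?T (\<lambda>u'. if w1 = [] then 0 else
          comorph ?T (\<lambda>w'. signed (parity w1 \<and> parity u') (shuffle (\<lambda>z. M (f (map snd w1) # z)) u' w')) w2) u"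
        using comorph_par[of f "\<lambda>p u'. comorph ?T (\<lambda>w'. signed (parity w1 \<and> p) (shuffle (\<lambda>z. M (f (map snd w1) # z)) u' w')) w2" u]
        by (simp add: comorph_additive[OF additive_sg] conj_commute)
    qed
    also have "\<dots> = comorph ?T (\<lambda>u'. comorph ?T (\<lambda>w'. signed (fst (hd w') \<and> parity u')
        (shuffle (\<lambda>z. M (snd (hd w') # z)) u' (tl w'))) w) u"
      using False
      by (subst comorph_hd_tl[where M = "\<lambda>b w'. signed (fst b \<and> parity _) (shuffle (\<lambda>z. M (snd b # z)) _ w')"])
        (simp_all add: comorph_sum_swap cong: if_cong)
    finally show ?thesis
      using False unfolding comorph_add[symmetric]
      by (simp add: shuffle_rec cong: comorph_cong)
  qed
qed

text \<open>A Taylor coefficient of degree 1, acting on tagged words.\<close>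
definition tag_coder :: "('a list \<Rightarrow> 'a) \<Rightarrow> (bool \<times> 'a) list \<Rightarrow> bool \<times> 'a" where
  "tag_coder q x = (\<not> parity x, q (map snd x))"

definition tag_sgn :: "('a \<Rightarrow> 'a) \<Rightarrow> bool \<times> 'a \<Rightarrow> bool \<times> 'a" where
  "tag_sgn s a = (fst a, s (snd a))"

lemma tag_sgn_simps [simp]: "fst (tag_sgn s a) = fst a" "snd (tag_sgn s a) = s (snd a)"
  by (simp_all add: tag_sgn_def)

lemma tag_coder_simps [simp]: "fst (tag_coder q x) = (\<not> parity x)" "snd (tag_coder q x) = q (map snd x)"
  by (simp_all add: tag_coder_def)

lemma parity_map_tag_sgn: "parity (map (tag_sgn s) u) = parity u"
  by (induction u) (simp_all)

lemma coder_par: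
  "coder (tag_sgn s) (tag_coder q) (\<lambda>u'. H (parity u') u') u =
   coder (tag_sgn s) (tag_coder q) (H (\<not> parity u)) u"
proof (induction u arbitrary: H)
  case (Cons a u)
  have 1: "splits (\<lambda>x y. if x = [] then 0 else H (parity (tag_coder q x # y)) (tag_coder q x # y)) (a # u) =
      splits (\<lambda>x y. if x = [] then 0 else H (\<not> parity (a # u)) (tag_coder q x # y)) (a # u)"
  proof (intro splits_cong)
    fix x y assume "x @ y = a # u"
    then have "parity (a # u) = (parity x \<noteq> parity y)" by (metis parity_append)
    then have "(\<not> parity (a # u)) = parity (tag_coder q x # y)" by auto
    then show "(if x = [] then 0 else H (parity (tag_coder q x # y)) (tag_coder q x # y)) =
      (if x = [] then 0 else H (\<not> parity (a # u)) (tag_coder q x # y))" by (simp only:)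
  qed
  have 2: "coder (tag_sgn s) (tag_coder q) (\<lambda>u'. H (parity (tag_sgn s a # u')) (tag_sgn s a # u')) u =
    coder (tag_sgn s) (tag_coder q) (\<lambda>u'. H (\<not> parity (a # u)) (tag_sgn s a # u')) u"
    using Cons[of "\<lambda>p u'. H (fst a \<noteq> p) (tag_sgn s a # u')"] by (simp)
  show ?case
    unfolding coder.simps 1 2 ..
qed simp

lemma shuffle_tag_sgn:
  assumes "multiadd N" "\<And>a. a \<in> set u \<Longrightarrow> s (snd a) = signed (fst a) (snd a)"
  shows "shuffle N (map (tag_sgn s) u) w = signed (parity u) (shuffle N u w)"
  using assms
proof (induction N u w rule: shuffle.induct)
  case (1 M w) then show ?case by simp
next
  have *: "M (map snd (map (tag_sgn s) u)) = signed (parity u) (M (map snd u))"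
    if "multiadd M" "\<And>a. a \<in> set u \<Longrightarrow> s (snd a) = signed (fst a) (snd a)" for M :: "'a list \<Rightarrow> 'b" and u
    using that
  proof (induction u arbitrary: M)
    case (Cons a u)
    from Cons(1)[of "\<lambda>z. M (s (snd a) # z)"] Cons(2,3) show ?case
      by (auto simp: multiadd_Cons signed_def Modules.additive.minus[OF multiadd_head])
  qed simp
  { case (2 M a u) then show ?case unfolding shuffle_Nil2 by (intro *) }
  case (3 M a u b w)
  have "(\<lambda>z. M (s (snd a) # z)) = (\<lambda>z. signed (fst a) (M (snd a # z)))"
    using 3(3,4) by (auto simp: signed_def Modules.additive.minus[OF multiadd_head] fun_eq_iff)
  then have "shuffle (\<lambda>z. M (s (snd a) # z)) (map (tag_sgn s) u) (b # w) =
      signed (fst a) (shuffle (\<lambda>z. M (snd a # z)) (map (tag_sgn s) u) (b # w))"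
    by (simp add: shuffle_additive[OF additive_sg])
  also have "\<dots> = signed (parity (a # u)) (shuffle (\<lambda>z. M (snd a # z)) u (b # w))"
    using 3 by (simp add: multiadd_Cons) (simp add: signed_def)
  finally show ?case
    using 3(2)[OF multiadd_Cons[OF 3(3)] 3(4)] parity_map_tag_sgn[of s "a # u"]
    by (simp add: Modules.additive.add[OF additive_sg]) (simp add: signed_def)
qed

text \<open>The analogue for coderivations: they are derivations of the shuffle product if their Taylor
  coefficients kill nontrivial shuffles.  The two recursions differ by the signs of the
  letters that are moved, which is accounted for by \<open>coder_parity\<close> and \<open>shuffle_tag_sgn\<close>.\<close>
lemma shuffle_coder:
  fixes M :: "'a::ab_group_add list \<Rightarrow> 'b::ab_group_add"
  assumes M: "multiadd M"
    and kill: "\<And>u' w'. u' \<noteq> [] \<Longrightarrow> w' \<noteq> [] \<Longrightarrow> set u' \<subseteq> P \<Longrightarrow> set w' \<subseteq> P \<Longrightarrow> shuffle q u' w' = 0"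
    and s: "\<And>a. a \<in> P \<Longrightarrow> s (snd a) = signed (fst a) (snd a)"
    and P: "set u \<subseteq> P" "set w \<subseteq> P"
  shows "shuffle (coder s q M) u w = coder (tag_sgn s) (tag_coder q) (\<lambda>u'. shuffle M u' w) u +
    coder (tag_sgn s) (tag_coder q) (shuffle M (map (tag_sgn s) u)) w"
  using M P
proof (induction "length u + length w" arbitrary: u w M rule: less_induct)
  case less
  let ?S = "tag_sgn s" and ?Q = "tag_coder q"
  let ?C = "coder ?S ?Q"
  show ?case
  proof (cases "u = [] \<or> w = []")
    case True
    then show ?thesis
      by (auto simp: shuffle_Nil1 coder_map[of snd ?S s ?Q q])
  next
    case False
    then obtain a u' b w' where uw: "u = a # u'" "w = b # w'"
      by (meson neq_Nil_conv)
    let ?Ma = "\<lambda>z. M (s (snd a) # z)" and ?Mb = "\<lambda>z. M (s (snd b) # z)"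
    note M = less.prems(1)
    have u: "\<And>a. a \<in> set u \<Longrightarrow> s (snd a) = signed (fst a) (snd a)" using less.prems s by blast
    have 1: "shuffle (splits (\<lambda>x y. if x = [] then 0 else M (q x # y))) u w =
       splits (\<lambda>u1 u2. if u1 = [] then 0 else shuffle (\<lambda>z. M (q (map snd u1) # z)) u2 w) u +
       splits (\<lambda>w1 w2. if w1 = [] then 0 else
         signed (parity u \<and> parity w1) (shuffle (\<lambda>z. M (q (map snd w1) # z)) u w2)) w"
      using less.prems by (intro shuffle_splits_primitive[where P = P] multiadd_head kill)
    have 2: "shuffle (coder s q ?Ma) u' w = ?C (\<lambda>x. shuffle ?Ma x w) u' + ?C (shuffle ?Ma (map ?S u')) w"
      using less.prems by (intro less.hyps) (auto simp: multiadd_Cons uw)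
    have 3: "shuffle (coder s q ?Mb) u w' = ?C (\<lambda>x. shuffle ?Mb x w') u + ?C (shuffle ?Mb (map ?S u)) w'"
      using less.prems by (intro less.hyps) (auto simp: multiadd_Cons uw)
    have L: "shuffle (coder s q M) u w =
        shuffle (splits (\<lambda>x y. if x = [] then 0 else M (q x # y))) u w +
        (shuffle (coder s q ?Ma) u' w + signed (fst b \<and> parity u) (shuffle (coder s q ?Mb) u w'))"
      unfolding uw by (simp add: shuffle_add Modules.additive.add[OF additive_sg] ac_simps)
    have R1: "?C (\<lambda>x. shuffle M x w) u =
        ?C (\<lambda>x. shuffle (\<lambda>z. M (snd (hd x) # z)) (tl x) w) u +
        ?C (\<lambda>x. signed (fst b \<and> parity x) (shuffle (\<lambda>z. M (snd b # z)) x w')) u"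
      unfolding coder_add[symmetric] using False
      by (intro coder_cong) (simp add: shuffle_rec uw)
    have R11: "?C (\<lambda>x. shuffle (\<lambda>z. M (snd (hd x) # z)) (tl x) w) u =
        splits (\<lambda>u1 u2. if u1 = [] then 0 else shuffle (\<lambda>z. M (q (map snd u1) # z)) u2 w) u +
        ?C (\<lambda>x. shuffle ?Ma x w) u'"
      unfolding uw by (simp cong: if_cong)
    have Mb: "?Mb = (\<lambda>z. signed (fst b) (M (snd b # z)))"
      using s[of b] less.prems by (auto simp: uw signed_def Modules.additive.minus[OF multiadd_head] fun_eq_iff)
    have R12: "?C (\<lambda>x. signed (fst b \<and> parity x) (shuffle (\<lambda>z. M (snd b # z)) x w')) u =
        signed (fst b \<and> parity u) (?C (\<lambda>x. shuffle ?Mb x w') u)"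
      unfolding Mb coder_par[of s q "\<lambda>p x. signed (fst b \<and> p) (shuffle (\<lambda>z. M (snd b # z)) x w')"]
        shuffle_additive[OF additive_sg, symmetric] coder_additive[OF additive_sg, symmetric]
      by (simp add: signed_def)
    have R2: "?C (shuffle M (map ?S u)) w =
        ?C (\<lambda>x. shuffle ?Ma (map ?S u') x) w +
        ?C (\<lambda>x. signed (fst (hd x) \<and> parity u) (shuffle (\<lambda>z. M (snd (hd x) # z)) (map ?S u) (tl x))) w"
      unfolding coder_add[symmetric] using False
      by (intro coder_cong) (simp add: shuffle_rec uw, simp add: parity_map_tag_sgn)
    have R22: "?C (\<lambda>x. signed (fst (hd x) \<and> parity u) (shuffle (\<lambda>z. M (snd (hd x) # z)) (map ?S u) (tl x))) w =
        splits (\<lambda>w1 w2. if w1 = [] then 0 else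
         signed (\<not> parity w1 \<and> parity u) (shuffle (\<lambda>z. M (q (map snd w1) # z)) (map ?S u) w2)) w +
        signed (fst b \<and> parity u) (?C (shuffle ?Mb (map ?S u)) w')"
      unfolding uw(2) coder_additive[OF additive_sg]
      by (simp cong: if_cong)
    have R221: "splits (\<lambda>w1 w2. if w1 = [] then 0 else
         signed (\<not> parity w1 \<and> parity u) (shuffle (\<lambda>z. M (q (map snd w1) # z)) (map ?S u) w2)) w =
       splits (\<lambda>w1 w2. if w1 = [] then 0 else
         signed (parity u \<and> parity w1) (shuffle (\<lambda>z. M (q (map snd w1) # z)) u w2)) w"
      by (intro splits_cong) (auto simp: shuffle_tag_sgn[OF multiadd_Cons[OF M] u] signed_def)
    show ?thesis
      unfolding L 1 2 3 R1 R11 R12 R2 R22 R221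
      by (simp add: Modules.additive.add[OF additive_sg] ac_simps)
  qed
qed

section \<open>Logarithms of characters\<close>

lemma parity_even: "set u \<subseteq> {a. \<not> fst a} \<Longrightarrow> \<not> parity u"
  by (induction u) auto

lemma shuffle_sum: "shuffle (\<lambda>z. \<Sum>k\<in>A. M k z) u w = (\<Sum>k\<in>A. shuffle (M k) u w)"
  by (induction A rule: infinite_finite_induct) (simp_all add: shuffle_add)

lemma additive_times: "Modules.additive (\<lambda>x. c * x :: 'k::ring)"
  by (simp add: Modules.additive_def algebra_simps)

lemma splits_times:
  fixes B :: "'a list \<Rightarrow> 'a list \<Rightarrow> 'k::ring"
  shows "c * splits B u = splits (\<lambda>x y. c * B x y) u"
  using splits_additive[OF additive_times] .

lemma splits_mult:
  fixes B :: "'a list \<Rightarrow> 'a list \<Rightarrow> 'k::ring"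
  shows "splits B u * splits C w = splits (\<lambda>u1 u2. splits (\<lambda>w1 w2. B u1 u2 * C w1 w2) w) u"
  by (simp add: splits_eq_sum sum_product)

text \<open>The convolution powers of the part of \<open>g\<close> that vanishes on the empty word.\<close>
primrec reduced_conv_power :: "('a list \<Rightarrow> 'k::comm_ring_1) \<Rightarrow> nat \<Rightarrow> 'a list \<Rightarrow> 'k" where
  "reduced_conv_power g 0 u = (if u = [] then 1 else 0)"
| "reduced_conv_power g (Suc k) u = splits (\<lambda>x y. if x = [] then 0 else g x * reduced_conv_power g k y) u"

lemma reduced_conv_power_eq_0: "length u < k \<Longrightarrow> reduced_conv_power g k u = 0"
proof (induction k arbitrary: u)
  case (Suc k)
  have "reduced_conv_power g (Suc k) u = splits (\<lambda>x y. 0) u"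
    unfolding reduced_conv_power.simps
  proof (intro splits_cong)
    fix x y assume "x @ y = u"
    then have "x \<noteq> [] \<Longrightarrow> length y < k"
      using Suc.prems by (cases x) auto
    then show "(if x = [] then 0 else g x * reduced_conv_power g k y) = 0"
      using Suc.IH by auto
  qed
  then show ?case by simp
qed simp

lemma splits_sum: "splits (\<lambda>x y. \<Sum>k\<in>A. B k x y) u = (\<Sum>k\<in>A. splits (B k) u)"
  unfolding splits_eq_sum by (rule sum.swap)

lemma splits_cpow_sum:
  "splits (\<lambda>x y. if x = [] then 0 else g x * (\<Sum>k\<in>A. h k * reduced_conv_power g k y)) u =
   (\<Sum>k\<in>A. h k * reduced_conv_power g (Suc k) u)"
proof -
  have "(\<Sum>k\<in>A. h k * reduced_conv_power g (Suc k) u) =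
      splits (\<lambda>x y. \<Sum>k\<in>A. h k * (if x = [] then 0 else g x * reduced_conv_power g k y)) u"
    by (simp add: splits_sum splits_times)
  also have "\<dots> = splits (\<lambda>x y. if x = [] then 0 else g x * (\<Sum>k\<in>A. h k * reduced_conv_power g k y)) u"
    by (intro splits_cong) (auto simp: sum_distrib_left ac_simps)
  finally show ?thesis ..
qed

text \<open>Sums over block decompositions, sorted by the number of blocks, are power series in convolution
  powers.\<close>
lemma comorph_eq_conv_power:
  assumes "length u \<le> N"
  shows "comorph g (\<lambda>ws. h (length ws) * prod_list ws) u = (\<Sum>k\<le>N. h k * reduced_conv_power g k u)"
  using assms
proof (induction N arbitrary: u h)
  case (Suc N)
  show ?case
  proof (cases "u = []")
    case False
    have "comorph g (\<lambda>ws. h (length ws) * prod_list ws) u =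
        splits (\<lambda>x y. if x = [] then 0 else g x * (\<Sum>k\<le>N. h (Suc k) * reduced_conv_power g k y)) u"
      unfolding comorph_rec[OF False]
    proof (intro splits_cong)
      fix x y assume "x @ y = u"
      then have *: "x \<noteq> [] \<Longrightarrow> length y \<le> N"
        using Suc.prems by (cases x) auto
      have "comorph g (\<lambda>ws. h (length (g x # ws)) * prod_list (g x # ws)) y =
          g x * comorph g (\<lambda>ws. h (Suc (length ws)) * prod_list ws) y"
        by (simp add: comorph_additive[OF additive_times] ac_simps)
      with * show "(if x = [] then 0
         else comorph g (\<lambda>ws. h (length (g x # ws)) * prod_list (g x # ws)) y) =
           (if x = [] then 0 else g x * (\<Sum>k\<le>N. h (Suc k) * reduced_conv_power g k y))"
        using Suc.IH[of y "\<lambda>k. h (Suc k)"] by simp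
    qed
    then show ?thesis
      using False by (simp add: splits_cpow_sum sum.atMost_Suc_shift del: sum.atMost_Suc reduced_conv_power.simps(2))
  qed (simp add: sum.atMost_Suc_shift del: sum.atMost_Suc)
qed simp

primrec conv_power :: "('a list \<Rightarrow> 'k::comm_ring_1) \<Rightarrow> nat \<Rightarrow> 'a list \<Rightarrow> 'k" where
  "conv_power g 0 u = (if u = [] then 1 else 0)"
| "conv_power g (Suc s) u = splits (\<lambda>x y. g x * conv_power g s y) u"

text \<open>The binomial theorem for \<open>g = 1 + (g - 1)\<close> in the convolution algebra.\<close>
lemma conv_power_binomial:
  assumes "g [] = 1" "length u \<le> N"
  shows "conv_power g s u = (\<Sum>k\<le>N. of_nat (s choose k) * reduced_conv_power g k u)"
  using assms(2)
proof (induction s arbitrary: u)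
  case 0
  have "(\<Sum>k\<le>N. of_nat (0 choose k) * reduced_conv_power g k u) = (\<Sum>k\<in>{0}. of_nat (0 choose k) * reduced_conv_power g k u)"
    by (intro sum.mono_neutral_right) (auto simp: binomial_eq_0)
  then show ?case by simp
next
  case (Suc s)
  have "conv_power g (Suc s) u = splits (\<lambda>x y. (if x = [] then conv_power g s y else 0) +
      (if x = [] then 0 else g x * conv_power g s y)) u"
    using assms(1) unfolding conv_power.simps by (intro splits_cong) auto
  also have "\<dots> = conv_power g s u + splits (\<lambda>x y. if x = [] then 0 else g x * conv_power g s y) u"
    by (simp add: splits_add splits_left_Nil)
  also have "splits (\<lambda>x y. if x = [] then 0 else g x * conv_power g s y) u =
      splits (\<lambda>x y. if x = [] then 0 else g x * (\<Sum>k\<le>N. of_nat (s choose k) * reduced_conv_power g k y)) u"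
    using Suc by (intro splits_cong) auto
  also have "\<dots> = (\<Sum>k\<le>N. of_nat (s choose k) * reduced_conv_power g (Suc k) u)"
    by (rule splits_cpow_sum)
  also have "\<dots> = (\<Sum>k<N. of_nat (s choose k) * reduced_conv_power g (Suc k) u)"
    using Suc.prems by (simp add: lessThan_Suc_atMost[symmetric] reduced_conv_power_eq_0 del: reduced_conv_power.simps)
  also have "conv_power g s u = reduced_conv_power g 0 u + (\<Sum>k<N. of_nat (s choose Suc k) * reduced_conv_power g (Suc k) u)"
    using Suc by (simp add: sum.atMost_shift del: reduced_conv_power.simps)
  finally show ?case
    by (simp add: sum.atMost_shift sum.distrib algebra_simps del: reduced_conv_power.simps)
qed

text \<open>The binomial coefficient \<open>x choose k\<close> as a polynomial in \<open>x\<close>.\<close>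
definition binom_poly :: "nat \<Rightarrow> 'k::field_char_0 poly" where
  "binom_poly k = smult (1 / fact k) (\<Prod>i<k. [:- of_nat i, 1:])"

lemma poly_binom_poly: "poly (binom_poly k) (of_nat s) = of_nat (s choose k)"
  by (simp add: binom_poly_def poly_prod binomial_gbinomial gbinomial_prod_rev lessThan_atLeast0)

text \<open>The linear coefficients are those of the logarithm.\<close>
lemma coeff_binom_poly:
  "coeff (binom_poly (Suc k) :: 'k::field_char_0 poly) 0 = 0"
  "coeff (binom_poly (Suc k)) (Suc 0) = (-1) ^ k / (of_nat (Suc k) :: 'k)"
proof -
  let ?P = "\<Prod>i<k. [:- of_nat (Suc i), 1:] :: 'k poly"
  have b: "binom_poly (Suc k) = smult (1 / fact (Suc k)) (pCons 0 ?P)"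
    by (simp add: binom_poly_def prod.lessThan_Suc_shift del: prod.lessThan_Suc)
  have "coeff ?P 0 = (\<Prod>i<k. - of_nat (Suc i))"
    by (simp flip: poly_0_coeff_0 add: poly_prod)
  also have "\<dots> = (-1) ^ k * fact k"
    by (induction k) (simp_all add: algebra_simps)
  finally show "coeff (binom_poly (Suc k)) (Suc 0) = (-1) ^ k / (of_nat (Suc k) :: 'k)"
    unfolding b by (simp add: fact_reduce[of "Suc k"] del: of_nat_Suc)
  show "coeff (binom_poly (Suc k) :: 'k poly) 0 = 0"
    unfolding b by simp
qed

text \<open>Convolution powers of a character are characters, because the shuffle product is compatible with
  deconcatenation.\<close>
lemma conv_power_mult:
  fixes g :: "'a list \<Rightarrow> 'k::comm_ring_1"
  assumes ev: "set u \<union> set w \<subseteq> {a. \<not> fst a}"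
    and char: "\<And>u w. set u \<union> set w \<subseteq> {a. \<not> fst a} \<Longrightarrow>
      shuffle g u w = g (map snd u) * g (map snd w)"
  shows "shuffle (conv_power g s) u w = conv_power g s (map snd u) * conv_power g s (map snd w)"
  using ev
proof (induction s arbitrary: u w)
  case 0
  show ?case
  proof (cases "u = [] \<and> w = []")
    case False
    then have eq: "shuffle (conv_power g 0) u w = shuffle (\<lambda>z. 0) u w"
      by (intro shuffle_cong) auto
    show ?thesis unfolding eq using False by auto
  qed auto
next
  case (Suc s)
  have "shuffle (conv_power g (Suc s)) u w = splits (\<lambda>u1 u2. splits (\<lambda>w1 w2.
       (g (map snd u1) * conv_power g s (map snd u2)) * (g (map snd w1) * conv_power g s (map snd w2))) w) u"
    unfolding conv_power.simps shuffle_splits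
  proof (intro splits_cong)
    fix u1 u2 w1 w2 assume uw: "u1 @ u2 = u" "w1 @ w2 = w"
    have "parity u2 = False" using Suc.prems uw parity_even[of u2] by auto
    moreover have "shuffle (\<lambda>x. g x * shuffle (conv_power g s) u2 w2) u1 w1 =
        shuffle (conv_power g s) u2 w2 * shuffle g u1 w1"
      using shuffle_additive[OF additive_times[of "shuffle (conv_power g s) u2 w2"], of g u1 w1]
      by (simp only: mult.commute)
    moreover have "shuffle (\<lambda>y. g x * conv_power g s y) u2 w2 = g x * shuffle (conv_power g s) u2 w2" for x
      by (rule shuffle_additive[OF additive_times, symmetric])
    moreover have "shuffle g u1 w1 = g (map snd u1) * g (map snd w1)"
      using Suc.prems uw by (intro char) auto
    moreover have "shuffle (conv_power g s) u2 w2 = conv_power g s (map snd u2) * conv_power g s (map snd w2)"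
      using Suc.prems uw by (intro Suc.IH) auto
    ultimately show "signed (parity u2 \<and> parity w1) (shuffle (\<lambda>x. shuffle (\<lambda>y. g x * conv_power g s y) u2 w2) u1 w1) =
      (g (map snd u1) * conv_power g s (map snd u2)) * (g (map snd w1) * conv_power g s (map snd w2))"
      by (simp add: ac_simps)
  qed
  also have "\<dots> = conv_power g (Suc s) (map snd u) * conv_power g (Suc s) (map snd w)"
    by (simp add: splits_map splits_mult)
  finally show ?case .
qed

text \<open>The value of the \<open>s\<close>-th convolution power of \<open>g\<close> on a word is a polynomial in \<open>s\<close> whose linear
  coefficient is the logarithm of \<open>g\<close> and which has no constant term unless the word is empty.
  For all natural \<open>s\<close> the power is a character.  So the polynomial of a nontrivial shuffle is a
  product of two polynomials without constant term, and its linear coefficient vanishes.\<close>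
lemma log_character_kills_shuffles:
  fixes g :: "'a list \<Rightarrow> 'k::field_char_0"
  assumes g1: "g [] = 1"
    and ne: "u \<noteq> []" "w \<noteq> []"
    and ev: "set u \<union> set w \<subseteq> {a. \<not> fst a}"
    and char: "\<And>u w. set u \<union> set w \<subseteq> {a. \<not> fst a} \<Longrightarrow>
      shuffle g u w = g (map snd u) * g (map snd w)"
  shows "shuffle (comorph g (\<lambda>ws. (-1) ^ (length ws + 1) / of_nat (length ws) * prod_list ws)) u w = 0"
proof -
  define N where "N = length u + length w"
  let ?a = "\<lambda>k. reduced_conv_power g k (map snd u)" and ?b = "\<lambda>k. reduced_conv_power g k (map snd w)"
  let ?c = "\<lambda>k. shuffle (reduced_conv_power g k) u w"
  have len: "length z = N" if "mset z = mset (map snd u) + mset (map snd w)" for z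
    using arg_cong[OF that, of size] by (simp add: N_def)
  \<comment> \<open>The polynomial in \<open>s\<close> whose value at a natural number is the \<open>s\<close>-th convolution power.\<close>
  let ?p = "\<lambda>c. \<Sum>k\<le>N. smult (c k) (binom_poly k)"
  have "poly (?p ?c) (of_nat s) = poly (?p ?a * ?p ?b) (of_nat s)" for s
  proof -
    have "poly (?p ?c) (of_nat s) = shuffle (\<lambda>z. \<Sum>k\<le>N. of_nat (s choose k) * reduced_conv_power g k z) u w"
      by (simp add: poly_sum poly_binom_poly shuffle_sum shuffle_additive[OF additive_times, symmetric] mult.commute)
    also have "\<dots> = shuffle (conv_power g s) u w"
      using len by (intro shuffle_cong) (simp add: conv_power_binomial[where g = g, OF g1, where N = N])
    also have "\<dots> = conv_power g s (map snd u) * conv_power g s (map snd w)"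
      using ev char by (intro conv_power_mult) auto
    also have "\<dots> = poly (?p ?a * ?p ?b) (of_nat s)"
      using conv_power_binomial[where g = g, OF g1, of "map snd u" N] conv_power_binomial[where g = g, OF g1, of "map snd w" N]
      by (simp add: N_def poly_sum poly_binom_poly mult.commute)
    finally show ?thesis .
  qed
  then have "range of_nat \<subseteq> {x. poly (?p ?c - ?p ?a * ?p ?b) x = 0}"
    by auto
  moreover have "infinite (range (of_nat :: nat \<Rightarrow> 'k))"
    by (simp add: range_inj_infinite inj_of_nat)
  ultimately have "?p ?c - ?p ?a * ?p ?b = 0"
    using poly_roots_finite finite_subset by blast
  then have eq: "?p ?c = ?p ?a * ?p ?b" by simp
  have coeffs: "coeff (?p c) 0 = 0"
    "coeff (?p c) (Suc 0) = (\<Sum>k\<le>N. (-1) ^ (k + 1) / of_nat k * c k)" if "c 0 = 0" for c :: "nat \<Rightarrow> 'k"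
  proof -
    have *: "c k * coeff (binom_poly k) 0 = 0"
      "c k * coeff (binom_poly k) (Suc 0) = (-1) ^ (k + 1) / of_nat k * c k" for k
      using that by (cases k; simp add: coeff_binom_poly)+
    show "coeff (?p c) 0 = 0" by (simp add: coeff_sum *)
    show "coeff (?p c) (Suc 0) = (\<Sum>k\<le>N. (-1) ^ (k + 1) / of_nat k * c k)"
      by (simp add: coeff_sum *)
  qed
  have a0: "?a 0 = 0" "?b 0 = 0" using ne by simp_all
  have c0: "?c 0 = 0"
  proof -
    have eq: "?c 0 = shuffle (\<lambda>z. 0) u w" using ne by (intro shuffle_cong) auto
    show ?thesis unfolding eq by simp
  qed
  have "(\<Sum>k\<le>N. (-1) ^ (k + 1) / of_nat k * ?c k) = coeff (?p ?a * ?p ?b) (Suc 0)"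
    using coeffs(2)[where c1 = ?c, OF c0] eq by simp
  also have "\<dots> = 0"
    by (simp only: coeff_mult atMost_Suc) (simp add: coeffs(1)[where c1 = ?a, OF a0(1)] coeffs(1)[where c1 = ?b, OF a0(2)])
  also have "(\<Sum>k\<le>N. (-1) ^ (k + 1) / of_nat k * ?c k) =
      shuffle (\<lambda>z. \<Sum>k\<le>N. (-1) ^ (k + 1) / of_nat k * reduced_conv_power g k z) u w"
    unfolding shuffle_sum shuffle_additive[OF additive_times, symmetric] ..
  also have "\<dots> = shuffle (comorph g (\<lambda>ws. (-1) ^ (length ws + 1) / of_nat (length ws) * prod_list ws)) u w"
    using len by (intro shuffle_cong comorph_eq_conv_power[symmetric]) simp
  finally show ?thesis .
qed

section \<open>Tensors as functionals\<close>

text \<open>Multilinearity of functions of words with values in a vector space; \<open>s\<close> and \<open>t\<close> are the two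
  scalar multiplications.\<close>
definition mlin :: "('k \<Rightarrow> 'v::plus \<Rightarrow> 'v) \<Rightarrow> ('k \<Rightarrow> 'w::plus \<Rightarrow> 'w) \<Rightarrow> ('v list \<Rightarrow> 'w) \<Rightarrow> bool" where
  "mlin s t f \<longleftrightarrow>
     (\<forall>us ws c x y. f (us @ (s c x + y) # ws) = t c (f (us @ x # ws)) + f (us @ y # ws))"

lemma multilin_iff_mlin: "multilin V M \<longleftrightarrow> mlin (scl V) (*) M"
  by (simp add: multilin_def mlin_def)

lemma mlinD: "mlin s t f \<Longrightarrow> f (us @ (s c x + y) # ws) = t c (f (us @ x # ws)) + f (us @ y # ws)"
  by (simp add: mlin_def)

lemma mlin_headD: "mlin s t f \<Longrightarrow> f ((s c x + y) # ws) = t c (f (x # ws)) + f (y # ws)"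
  using mlinD[of s t f "[]"] by simp

lemma mlin_Cons:
  assumes "mlin s t f"
  shows "mlin s t (\<lambda>ws. f (v # ws))"
  unfolding mlin_def using mlinD[OF assms, of "v # _"] by simp

lemma mlin_nonempty_cong:
  assumes "\<And>ws. ws \<noteq> [] \<Longrightarrow> f ws = g ws"
  shows "mlin s t f \<longleftrightarrow> mlin s t g"
  by (simp add: mlin_def assms)

lemma mlin_add:
  fixes f :: "'v::plus list \<Rightarrow> 'w::ab_group_add"
  assumes "\<And>c. Modules.additive (t c)" "mlin s t f" "mlin s t g"
  shows "mlin s t (\<lambda>ws. f ws + g ws)"
  using assms(2,3) by (simp add: mlin_def Modules.additive.add[OF assms(1)] algebra_simps)

lemma mlin_zero:
  fixes t :: "'k \<Rightarrow> 'w::ab_group_add \<Rightarrow> 'w"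
  assumes "\<And>c. Modules.additive (t c)"
  shows "mlin s t (\<lambda>ws. 0)"
  by (simp add: mlin_def Modules.additive.zero[OF assms])

lemma mlin_compose_linear:
  assumes "mlin s t f" "\<And>c x y. L (t c x + y) = r c (L x) + L y"
  shows "mlin s r (\<lambda>ws. L (f ws))"
  using assms by (simp add: mlin_def)

lemma mlin_map:
  assumes "mlin s t f" "\<And>c x y. g (s' c x + y) = s c (g x) + g y"
  shows "mlin s' t (\<lambda>ws. f (map g ws))"
  using assms by (simp add: mlin_def)

lemma mlin_splits:
  fixes B :: "'v::plus list \<Rightarrow> 'v list \<Rightarrow> 'w::ab_group_add"
  assumes t: "\<And>c. Modules.additive (t c)"
    and "\<And>y. mlin s t (\<lambda>x. B x y)" "\<And>x. mlin s t (B x)"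
  shows "mlin s t (splits B)"
  using assms(2,3)
  by (simp add: mlin_def splits_append_Cons splits_add splits_additive[OF t]
      Modules.additive.add[OF t] ac_simps)

lemma additive_mlin_scale:
  assumes "mlin s t f" "\<And>x. t 1 x = x" "\<And>x. s 1 x = x"
  shows "Modules.additive (\<lambda>v. f (us @ v # ws))"
  unfolding Modules.additive_def using mlinD[OF assms(1), of us 1] assms(2,3) by simp

lemma mlin_multiadd:
  assumes "mlin s t f" "\<And>x. t 1 x = x" "\<And>x. s 1 x = x"
  shows "multiadd f"
  unfolding multiadd_def using additive_mlin_scale[OF assms] by blast

text \<open>A letter of the word lies in exactly one block, so induction along the first block applies.\<close>
lemma mlin_comorph:
  fixes M :: "'w::ab_group_add list \<Rightarrow> 'x::ab_group_add"
  assumes r: "\<And>c. Modules.additive (r c)" and f: "mlin s t f" and M: "mlin t r M"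
  shows "mlin s r (comorph f M)"
proof -
  have "comorph f M (us @ (s c x + y) # ws) = r c (comorph f M (us @ x # ws)) + comorph f M (us @ y # ws)"
    for us ws c x y
    using M
  proof (induction "length us + length ws" arbitrary: us ws M rule: less_induct)
    case less
    let ?B = "\<lambda>p q. if p = [] then 0 else comorph f (\<lambda>ws. M (f p # ws)) q"
    have split: "comorph f M (us @ v # ws) =
        splits (\<lambda>p q. ?B p (q @ v # ws)) us + splits (\<lambda>p q. comorph f (\<lambda>ws. M (f (us @ v # p) # ws)) q) ws" for v
      by (simp add: comorph_rec splits_append_Cons)
    have 1: "splits (\<lambda>p q. ?B p (q @ (s c x + y) # ws)) us =
        splits (\<lambda>p q. r c (?B p (q @ x # ws)) + ?B p (q @ y # ws)) us"
    proof (intro splits_cong)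
      fix p q assume pq: "p @ q = us"
      show "?B p (q @ (s c x + y) # ws) = r c (?B p (q @ x # ws)) + ?B p (q @ y # ws)"
      proof (cases "p = []")
        case True then show ?thesis by (simp add: Modules.additive.zero[OF r])
      next
        case False
        with pq have "length q + length ws < length us + length ws" by auto
        from less.hyps[OF this mlin_Cons[OF less.prems]] False show ?thesis by simp
      qed
    qed
    have 2: "comorph f (\<lambda>z. M (f (us @ (s c x + y) # p) # z)) q =
        r c (comorph f (\<lambda>z. M (f (us @ x # p) # z)) q) + comorph f (\<lambda>z. M (f (us @ y # p) # z)) q" for p q
      by (simp add: mlinD[OF f] mlin_headD[OF less.prems] comorph_add comorph_additive[OF r])
    show ?case
      unfolding split 1 2
      by (simp add: splits_add splits_additive[OF r, symmetric] Modules.additive.add[OF r] ac_simps)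
  qed
  then show ?thesis by (simp add: mlin_def)
qed

lemma mlin_guard:
  fixes t :: "'k \<Rightarrow> 'w::ab_group_add \<Rightarrow> 'w"
  assumes "mlin s t f"
  shows "mlin s t (\<lambda>x. if x = [] then c else f x)"
  by (rule mlin_nonempty_cong[THEN iffD1, OF _ assms]) simp

lemma mlin_coder:
  fixes M :: "'v::ab_group_add list \<Rightarrow> 'x::ab_group_add"
  assumes r: "\<And>c. Modules.additive (r c)" and q: "mlin s s q"
    and g: "\<And>c x y. g (s c x + y) = s c (g x) + g y" and M: "mlin s r M"
  shows "mlin s r (coder g q M)"
proof -
  have "coder g q M (us @ (s c x + y) # ws) = r c (coder g q M (us @ x # ws)) + coder g q M (us @ y # ws)"
    for us ws c x y
    using M
  proof (induction us arbitrary: M)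
    case Nil
    have 1: "M (q ((s c x + y) # p) # p') = r c (M (q (x # p) # p')) + M (q (y # p) # p')" for p p'
      by (simp add: mlin_headD[OF q] mlin_headD[OF Nil])
    have 2: "M (g (s c x + y) # p) = r c (M (g x # p)) + M (g y # p)" for p
      by (simp add: g mlin_headD[OF Nil])
    show ?case
      unfolding append_Nil coder.simps splits.simps 1 2
      by (simp add: 1 splits_add splits_additive[OF r] coder_add coder_additive[OF r]
          Modules.additive.add[OF r] ac_simps)
  next
    case (Cons a us)
    have "mlin s r (splits (\<lambda>x y. if x = [] then 0 else M (q x # y)))"
    proof (rule mlin_splits[OF r])
      fix y
      show "mlin s r (\<lambda>x. if x = [] then 0 else M (q x # y))"
        using q Cons.prems
        by (intro mlin_guard mlin_compose_linear[of s s q "\<lambda>v. M (v # y)"] mlin_headD)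
    next
      fix x
      show "mlin s r (\<lambda>y. if x = [] then 0 else M (q x # y))"
        using mlin_Cons[OF Cons.prems, of "q x"] mlin_zero[of r s] r by (cases "x = []") simp_all
    qed
    from mlinD[OF this, of "a # us"] Cons.IH[OF mlin_Cons[OF Cons.prems]]
    show ?case
      by (simp add: Modules.additive.add[OF r] ac_simps del: splits.simps)
  qed
  then show ?thesis by (simp add: mlin_def)
qed


lemma additive_times': "Modules.additive ((*) (c::'k::ring))"
  by (rule additive_times)

lemma multilin_add: "multilin V M \<Longrightarrow> multilin V N \<Longrightarrow> multilin V (\<lambda>w. M w + N w)"
  unfolding multilin_iff_mlin by (rule mlin_add[OF additive_times'])

lemma multilin_scale: "multilin V M \<Longrightarrow> multilin V (\<lambda>w. c * M w)"
  by (simp add: multilin_def algebra_simps)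

lemma multilin_nonempty_cong:
  "(\<And>ws. ws \<noteq> [] \<Longrightarrow> M ws = N ws) \<Longrightarrow> multilin V M \<longleftrightarrow> multilin V N"
  unfolding multilin_iff_mlin by (rule mlin_nonempty_cong)

lemma module_tscale: "module tscale"
  by standard (auto simp: tscale_def fun_eq_iff algebra_simps)

lemma tscale_apply [simp]: "tscale c x M = c * x M"
  by (simp add: tscale_def)

lemma sum_fun_apply: "(\<Sum>i\<in>A. f i) x = (\<Sum>i\<in>A. f i x)"
  by (induction A rule: infinite_finite_induct) simp_all

lemma ten_apply: "multilin V M \<Longrightarrow> ten V vs M = M vs"
  by (simp add: ten_def)

lemma Tbar_induct [consumes 1, case_names zero step]:
  assumes "x \<in> Tbar V" and "P 0"
    and "\<And>c vs x. vs \<noteq> [] \<Longrightarrow> x \<in> Tbar V \<Longrightarrow> P x \<Longrightarrow> P (tscale c (ten V vs) + x)"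
  shows "P x"
proof -
  interpret module tscale by (rule module_tscale)
  have "x \<in> Tbar V \<and> P x"
    using assms(1) unfolding Tbar_def
  proof (induction rule: span_induct_alt)
    case base
    show ?case using assms(2) span_zero unfolding Tbar_def by blast
  next
    case (step c y z)
    then show ?case
      using assms(3) unfolding Tbar_def by (blast intro: span_add span_scale span_base)
  qed
  then show ?thesis ..
qed

lemma ten_in_Tbar: "vs \<noteq> [] \<Longrightarrow> ten V vs \<in> Tbar V"
  unfolding Tbar_def by (intro module.span_base[OF module_tscale]) auto

lemma Tbar_linear:
  assumes "x \<in> Tbar V" "multilin V M" "multilin V N"
  shows "x (\<lambda>w. c * M w + N w) = c * x M + x N"
proof -
  have "multilin V (\<lambda>w. c * M w + N w)"
    using assms by (intro multilin_add multilin_scale)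
  with assms show ?thesis
    by (induction rule: Tbar_induct) (simp_all add: ten_apply algebra_simps)
qed

lemma Tbar_add:
  assumes "x \<in> Tbar V" "multilin V M" "multilin V N"
  shows "x (\<lambda>w. M w + N w) = x M + x N"
  using Tbar_linear[OF assms, of 1] by simp

lemma multilin_zero: "multilin V (\<lambda>w. 0)"
  by (simp add: multilin_def)

lemma Tbar_zero: "x \<in> Tbar V \<Longrightarrow> x (\<lambda>w. 0) = 0"
  using Tbar_linear[of x V "\<lambda>w. 0" "\<lambda>w. 0" "-1"] multilin_zero[of V] by simp

text \<open>The map \<open>f\<close> of tensor coalgebras is precomposition with \<open>T\<close>.  The empty word is excluded where
  possible, since bimultilinearity says nothing about it.\<close>
definition dual_to :: "('k::field, 'v::ab_group_add) gvs \<Rightarrow> ('k, 'w::ab_group_add) gvs \<Rightarrow>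
    (('k, 'v) tens \<Rightarrow> ('k, 'w) tens) \<Rightarrow> (('w list \<Rightarrow> 'k) \<Rightarrow> 'v list \<Rightarrow> 'k) \<Rightarrow> bool" where
  "dual_to V W f T \<longleftrightarrow>
     (\<forall>us M. us \<noteq> [] \<longrightarrow> f (ten V us) M = (if multilin W M then T M us else 0)) \<and>
     (\<forall>M. multilin W M \<longrightarrow> multilin V (T M)) \<and>
     (\<forall>M N us. us \<noteq> [] \<longrightarrow> (\<forall>ws. ws \<noteq> [] \<longrightarrow> M ws = N ws) \<longrightarrow> T M us = T N us) \<and>
     (\<forall>M N c us. T (\<lambda>ws. c * M ws + N ws) us = c * T M us + T N us)"

lemma dual_toD:
  assumes "dual_to V W f T"
  shows "us \<noteq> [] \<Longrightarrow> f (ten V us) M = (if multilin W M then T M us else 0)"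
    and "multilin W M \<Longrightarrow> multilin V (T M)"
    and "us \<noteq> [] \<Longrightarrow> (\<And>ws. ws \<noteq> [] \<Longrightarrow> M ws = N ws) \<Longrightarrow> T M us = T N us"
    and "T (\<lambda>ws. c * M ws + N ws) us = c * T M us + T N us"
  using assms unfolding dual_to_def by blast+

text \<open>The reduced coproduct is the full one for forms that vanish when one of the words is empty.\<close>
definition reduced_form :: "('v list \<Rightarrow> 'v list \<Rightarrow> 'k::zero) \<Rightarrow> 'v list \<Rightarrow> 'v list \<Rightarrow> 'k" where
  "reduced_form B u w = (if u = [] \<or> w = [] then 0 else B u w)"

lemma reduced_form_Nil [simp]: "reduced_form B [] = (\<lambda>w. 0)" "reduced_form B u [] = 0"
  by (auto simp: reduced_form_def)

lemma multilin_reduced_form: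
  assumes "bimultilin V B"
  shows "multilin V (reduced_form B u)" "multilin V (\<lambda>u. reduced_form B u w)"
proof -
  show "multilin V (reduced_form B u)"
  proof (cases "u = []")
    case False
    then have "multilin V (B u)" using assms by (simp add: bimultilin_def)
    with False show ?thesis
      by (subst multilin_nonempty_cong[of _ "B u"]) (auto simp: reduced_form_def)
  qed (simp add: multilin_zero)
  show "multilin V (\<lambda>u. reduced_form B u w)"
  proof (cases "w = []")
    case False
    then have "multilin V (\<lambda>u. B u w)" using assms by (simp add: bimultilin_def)
    with False show ?thesis
      by (subst multilin_nonempty_cong[of _ "\<lambda>u. B u w"]) (auto simp: reduced_form_def)
  qed (simp add: multilin_zero)
qed

lemma multilin_splits:
  "(\<And>y. multilin V (\<lambda>x. B x y)) \<Longrightarrow> (\<And>x. multilin V (B x)) \<Longrightarrow> multilin V (splits B)"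
  unfolding multilin_iff_mlin by (rule mlin_splits[OF additive_times'])

lemma sum_eq_splits_reduced:
  "(\<Sum>i\<in>{0<..<length vs}. B (take i vs) (drop i vs)) = splits (reduced_form B) vs"
  unfolding splits_eq_sum
  by (rule sum.mono_neutral_cong_left) (auto simp: reduced_form_def)

lemma deconc_apply:
  "deconc V x B = (if bimultilin V B then x (splits (reduced_form B)) else 0)"
  by (simp add: deconc_def sum_eq_splits_reduced)

text \<open>Formulas for coderivations and coalgebra morphisms are identities between operators on functions
  of one word once both sides are brought into this form.\<close>
lemma tensor_map_deconc:
  assumes f: "dual_to V W f T" and g: "dual_to V W g S" and x: "x \<in> Tbar V" and B: "bimultilin W B"
  shows "tensor_map V W f g (deconc V x) B =
      x (splits (reduced_form (\<lambda>u w. T (\<lambda>u'. S (reduced_form B u') w) u)))"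
    and "bimultilin V (\<lambda>u w. T (\<lambda>u'. S (reduced_form B u') w) u)"
proof -
  let ?C = "\<lambda>u w. tensor2 W (f (ten V u)) (g (ten V w)) B"
  let ?D = "\<lambda>u w. T (\<lambda>u'. S (reduced_form B u') w) u"
  note red = multilin_reduced_form[OF B]
  have S_lin: "multilin W (\<lambda>u'. S (reduced_form B u') w)" for w
    unfolding multilin_def
  proof (intro allI)
    fix us ws c x y
    have "reduced_form B (us @ (scl W c x + y) # ws) =
        (\<lambda>v. c * reduced_form B (us @ x # ws) v + reduced_form B (us @ y # ws) v)"
      using red(2) by (simp add: multilin_def fun_eq_iff)
    then show "S (reduced_form B (us @ (scl W c x + y) # ws)) w =
        c * S (reduced_form B (us @ x # ws)) w + S (reduced_form B (us @ y # ws)) w"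
      by (simp add: dual_toD(4)[OF g])
  qed
  have D1: "multilin V (\<lambda>u. ?D u w)" for w
    using dual_toD(2)[OF f S_lin] by simp
  have S2: "multilin V (S (reduced_form B u'))" for u'
    using dual_toD(2)[OF g red(1)] .
  have D2: "multilin V (?D u)" for u
    using S2 by (simp add: multilin_def dual_toD(4)[OF f, symmetric])
  show "bimultilin V ?D"
    using D1 D2 by (simp add: bimultilin_def)
  have C: "?C u w = ?D u w" if uw: "u \<noteq> []" "w \<noteq> []" for u w
  proof -
    have gB: "g (ten V w) (B u') = S (reduced_form B u') w" if "u' \<noteq> []" for u'
    proof -
      have "multilin W (B u')" using B that by (simp add: bimultilin_def)
      then have "g (ten V w) (B u') = S (B u') w" using dual_toD(1)[OF g uw(2)] by simp
      also have "\<dots> = S (reduced_form B u') w"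
        using uw(2) that by (intro dual_toD(3)[OF g]) (auto simp: reduced_form_def)
      finally show ?thesis .
    qed
    have "?C u w = f (ten V u) (\<lambda>u'. g (ten V w) (B u'))"
      using B by (simp add: tensor2_def)
    also have "\<dots> = T (\<lambda>u'. g (ten V w) (B u')) u"
      using dual_toD(1)[OF f uw(1)] S_lin[of w]
      by (simp add: multilin_nonempty_cong[of "\<lambda>u'. g (ten V w) (B u')", OF gB])
    also have "\<dots> = ?D u w"
      by (intro dual_toD(3)[OF f] uw gB)
    finally show ?thesis .
  qed
  have redC: "reduced_form ?C = reduced_form ?D"
    by (auto simp: reduced_form_def fun_eq_iff C)
  have "bimultilin V ?C"
    unfolding bimultilin_def
  proof (intro conjI allI impI)
    fix w :: "'b list" assume "w \<noteq> []"
    with D1 C show "multilin V (\<lambda>u. ?C u w)"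
      by (subst multilin_nonempty_cong[of _ "\<lambda>u. ?D u w"]) auto
  next
    fix u :: "'b list" assume "u \<noteq> []"
    with D2 C show "multilin V (?C u)"
      by (subst multilin_nonempty_cong[of _ "?D u"]) auto
  qed
  then show "tensor_map V W f g (deconc V x) B = x (splits (reduced_form ?D))"
    using B by (simp add: tensor_map_def deconc_apply redC)
qed


lemma graded_susp: "graded_vs V \<Longrightarrow> graded_vs (susp V)"
  unfolding graded_vs_def susp_def
proof (simp, intro conjI allI)
  assume V: "vector_space (scl V) \<and> (\<forall>i. Vector_Spaces.linear (scl V) (scl V) (cmp V i)) \<and>
    (\<forall>i j v. cmp V i (cmp V j v) = (if i = j then cmp V j v else 0)) \<and>
    (\<forall>v. finite {i. cmp V i v \<noteq> 0} \<and> v = (\<Sum>i | cmp V i v \<noteq> 0. cmp V i v))"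
  fix v
  have eq: "{i. cmp V (i + 1) v \<noteq> 0} = (\<lambda>i. i - 1) ` {i. cmp V i v \<noteq> 0}"
    by (auto intro: image_eqI[of _ _ "_ + 1"])
  from V show "finite {i. cmp V (i + 1) v \<noteq> 0}" unfolding eq by auto
  have "v = (\<Sum>i | cmp V i v \<noteq> 0. cmp V i v)" using V by auto
  also have "\<dots> = (\<Sum>i | cmp V (i + 1) v \<noteq> 0. cmp V (i + 1) v)"
    unfolding eq by (subst sum.reindex) (auto simp: inj_on_def)
  finally show "v = (\<Sum>i | cmp V (i + 1) v \<noteq> 0. cmp V (i + 1) v)" .
qed

locale graded =
  fixes V :: "('k::field, 'v::ab_group_add) gvs"
  assumes graded: "graded_vs V"
begin

sublocale vector_space "scl V"
  using graded by (simp add: graded_vs_def)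

lemma cmp_linear: "cmp V i (scl V c x + y) = scl V c (cmp V i x) + cmp V i y"
proof -
  interpret Vector_Spaces.linear "scl V" "scl V" "cmp V i"
    using graded by (simp add: graded_vs_def)
  show ?thesis by (simp add: add scale)
qed

lemma cmp_0 [simp]: "cmp V i 0 = 0"
  using cmp_linear[of i 1 0 0] by simp

lemma finite_support: "finite {i. cmp V i v \<noteq> 0}"
  and cmp_sum: "v = (\<Sum>i | cmp V i v \<noteq> 0. cmp V i v)"
  and cmp_cmp: "cmp V i (cmp V j v) = (if i = j then cmp V j v else 0)"
  using graded by (auto simp: graded_vs_def)

text \<open>The parity part may be computed with any finite set of degrees that contains the support, which
  is what makes linearity visible.\<close>
lemma parity_part_eq:
  assumes "finite I" "{i. cmp V i v \<noteq> 0} \<subseteq> I"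
  shows "parity_part V b v = (\<Sum>i\<in>I. if odd i = b then cmp V i v else 0)"
  unfolding parity_part_def sum.inter_filter[OF assms(1), symmetric]
  using assms by (intro sum.mono_neutral_left) auto

lemma parity_part_linear:
  "parity_part V b (scl V c x + y) = scl V c (parity_part V b x) + parity_part V b y"
proof -
  let ?I = "{i. cmp V i x \<noteq> 0} \<union> {i. cmp V i y \<noteq> 0}"
  have I: "finite ?I" "{i. cmp V i (scl V c x + y) \<noteq> 0} \<subseteq> ?I"
    using finite_support by (auto simp: cmp_linear)
  have "parity_part V b (scl V c x + y) = (\<Sum>i\<in>?I. if odd i = b then cmp V i (scl V c x + y) else 0)"
    by (rule parity_part_eq[OF I])
  also have "\<dots> = (\<Sum>i\<in>?I. scl V c (if odd i = b then cmp V i x else 0) + (if odd i = b then cmp V i y else 0))"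
    by (intro sum.cong refl) (simp add: cmp_linear)
  also have "\<dots> = scl V c (parity_part V b x) + parity_part V b y"
    using I(1) by (simp add: sum.distrib parity_part_eq[of ?I] scale_sum_right)
  finally show ?thesis .
qed

lemma parity_part_0 [simp]: "parity_part V b 0 = 0"
  by (simp add: parity_part_def)

lemma parity_part_sum: "parity_part V False v + parity_part V True v = v"
proof -
  have "parity_part V False v + parity_part V True v = (\<Sum>i | cmp V i v \<noteq> 0. cmp V i v)"
    unfolding parity_part_eq[OF finite_support order.refl] sum.distrib[symmetric]
    by (intro sum.cong) auto
  then show ?thesis using cmp_sum by simp
qed

lemma parity_part_cmp: "parity_part V b (cmp V i v) = (if odd i = b then cmp V i v else 0)"
proof -
  have "parity_part V b (cmp V i v) = (\<Sum>j\<in>{i}. if odd j = b then cmp V j (cmp V i v) else 0)"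
    by (rule parity_part_eq) (auto simp: cmp_cmp)
  then show ?thesis by (simp add: cmp_cmp)
qed

lemma parity_part_homogeneous:
  "homogeneous V i v \<Longrightarrow> parity_part V b v = (if odd i = b then v else 0)"
  using parity_part_cmp[of b i v] by (simp add: homogeneous_def)

lemma parity_part_additive: "Modules.additive (parity_part V b)"
  using parity_part_linear[of b 1] by (simp add: Modules.additive_def)

lemma parity_part_idem:
  "parity_part V b (parity_part V b' v) = (if b = b' then parity_part V b' v else 0)"
  unfolding parity_part_eq[OF finite_support order.refl, of b' v]
  by (subst Modules.additive.sum[OF parity_part_additive]) (auto intro!: sum.cong sum.neutral simp: parity_part_cmp split: if_splits)

lemma sgn_map_linear: "sgn_map V (scl V c x + y) = scl V c (sgn_map V x) + sgn_map V y"
  by (simp add: sgn_map_def parity_part_linear scale_right_diff_distrib)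

definition pure :: "(bool \<times> 'v) set" where
  "pure = {a. parity_part V (fst a) (snd a) = snd a}"

lemma parity_part_pure: "a \<in> pure \<Longrightarrow> parity_part V b (snd a) = (if b = fst a then snd a else 0)"
  using parity_part_idem[of b "fst a" "snd a"] by (simp add: pure_def)

lemma sgn_map_pure: "a \<in> pure \<Longrightarrow> sgn_map V (snd a) = signed (fst a) (snd a)"
  by (cases "fst a") (simp_all add: sgn_map_def parity_part_pure signed_def)

lemma pure_parity_part: "(b, parity_part V b v) \<in> pure"
  by (simp add: pure_def parity_part_idem)

lemma homogeneous_scale: "homogeneous V i v \<Longrightarrow> homogeneous V i (scl V c v)"
  using cmp_linear[of i c v 0] by (simp add: homogeneous_def)

lemma homogeneous_sgn_map:
  assumes "homogeneous V i v"
  shows "homogeneous V i (sgn_map V v)"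
proof (cases "odd i")
  case True
  then have "sgn_map V v = scl V (-1) v"
    using assms by (simp add: sgn_map_def parity_part_homogeneous)
  then show ?thesis using homogeneous_scale[OF assms, of "-1"] by (simp only:)
next
  case False
  then show ?thesis
    using assms by (simp add: sgn_map_def parity_part_homogeneous)
qed

lemma multilin_multiadd: "multilin V M \<Longrightarrow> multiadd M"
  unfolding multilin_iff_mlin by (erule mlin_multiadd) auto

end

lemma lin_ext_linear: "lin_ext W L (tscale c x + y) = tscale c (lin_ext W L x) + lin_ext W L y"
  by (auto simp: lin_ext_def fun_eq_iff)

lemma lin_ext_ten:
  assumes "\<And>M. multilin W M \<Longrightarrow> multilin V (\<lambda>vs. L vs M)" "\<And>M. \<not> multilin W M \<Longrightarrow> L vs M = 0"
  shows "lin_ext W L (ten V vs) = L vs"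
  using assms by (auto simp: lin_ext_def fun_eq_iff ten_apply)

text \<open>Membership in a graded part of the tensor coalgebra need only be checked on generating words.\<close>
lemma lin_ext_span:
  assumes "\<And>x. x \<in> S \<Longrightarrow> lin_ext W L x \<in> module.span tscale T" "x \<in> module.span tscale S"
  shows "lin_ext W L x \<in> module.span tscale T"
proof -
  show ?thesis
    using assms(2)
  proof (induction rule: module.span_induct_alt[OF module_tscale, consumes 1])
    case 1
    have 0: "lin_ext W L 0 = 0" by (auto simp: lin_ext_def fun_eq_iff)
    show ?case unfolding 0 by (rule module.span_zero[OF module_tscale])
  next
    case (2 c x y)
    then show ?case
      unfolding lin_ext_linear
      by (intro module.span_add[OF module_tscale] module.span_scale[OF module_tscale]
          assms(1)[OF 2(1)] 2(2))
  qed
qed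

lemma tbar_linear_lin_ext:
  assumes "\<And>vs. vs \<noteq> [] \<Longrightarrow> lin_ext W L (ten V vs) \<in> Tbar W"
    and "\<And>vs ds. vs \<noteq> [] \<Longrightarrow> list_all2 (homogeneous V) ds vs \<Longrightarrow>
      lin_ext W L (ten V vs) \<in> Tbar_deg W (sum_list ds + k)"
  shows "tbar_linear V W k (lin_ext W L)"
  unfolding tbar_linear_def
proof (intro conjI ballI allI)
  show "lin_ext W L ` Tbar V \<subseteq> Tbar W"
  proof (rule image_subsetI)
    fix x assume "x \<in> Tbar V"
    then show "lin_ext W L x \<in> Tbar W"
      using assms(1) unfolding Tbar_def by (elim lin_ext_span[rotated]) auto
  qed
  show "lin_ext W L ` Tbar_deg V d \<subseteq> Tbar_deg W (d + k)" for d
  proof (rule image_subsetI)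
    fix x assume "x \<in> Tbar_deg V d"
    then show "lin_ext W L x \<in> Tbar_deg W (d + k)"
      using assms(2) unfolding Tbar_deg_def by (elim lin_ext_span[rotated]) auto
  qed
  show "lin_ext W L (x + y) = lin_ext W L x + lin_ext W L y" for x y
    using lin_ext_linear[of W L 1 x y] by (simp add: tscale_def)
  show "lin_ext W L (tscale c x) = tscale c (lin_ext W L x)" for c x
    by (auto simp: lin_ext_def fun_eq_iff)
qed

section \<open>Coderivations, coalgebra morphisms and shuffle permutations\<close>

text \<open>The recursion enumerates the intervals of the word by their first position, which is the first summation index.\<close>
lemma coder_eq_sum:
  "coder s q M vs = (\<Sum>(i, j) | 1 \<le> j \<and> i + j \<le> length vs.
     M (map s (take i vs) @ q (take j (drop i vs)) # drop (i + j) vs))"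
proof -
  have "coder s q M vs = (\<Sum>i\<le>length vs. \<Sum>j\<in>{1..length vs - i}.
     M (map s (take i vs) @ q (take j (drop i vs)) # drop (i + j) vs))"
  proof (induction vs arbitrary: M)
    case (Cons v vs)
    have "splits (\<lambda>x y. if x = [] then 0 else M (q x # y)) (v # vs) =
        (\<Sum>j\<le>length (v # vs). if j = 0 then 0 else M (q (take j (v # vs)) # drop j (v # vs)))"
      unfolding splits_eq_sum by (intro sum.cong) auto
    also have "\<dots> = (\<Sum>j\<in>{1..length (v # vs)}. M (q (take j (v # vs)) # drop j (v # vs)))"
      by (rule sum.mono_neutral_cong_right) auto
    finally have 1: "splits (\<lambda>x y. if x = [] then 0 else M (q x # y)) (v # vs) =
        (\<Sum>j\<in>{1..length (v # vs)}. M (q (take j (v # vs)) # drop j (v # vs)))" .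
    show ?case
      unfolding coder.simps 1 Cons by (simp add: sum.atMost_Suc_shift del: sum.atMost_Suc)
  qed simp
  also have "\<dots> = (\<Sum>(i, j)\<in>(SIGMA i:{..length vs}. {1..length vs - i}).
     M (map s (take i vs) @ q (take j (drop i vs)) # drop (i + j) vs))"
    by (rule sum.Sigma) auto
  also have "(SIGMA i:{..length vs}. {1..length vs - i}) = {(i, j). 1 \<le> j \<and> i + j \<le> length vs}"
    by auto
  finally show ?thesis .
qed

lemma coder_of_apply:
  "coder_of V q x M = (if multilin V M then x (coder (sgn_map V) q M) else 0)"
  unfolding coder_of_def lin_ext_def coder_eq_sum
  by (auto simp: sum_fun_apply split_def ten_apply)

lemma comorph_of_apply:
  "comorph_of W f x M = (if multilin W M then x (comorph f M) else 0)"
  unfolding comorph_of_def lin_ext_def comorph_def[abs_def] blocks_def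
  by (auto simp: sum_fun_apply ten_apply)

lemma tsgn_apply:
  "tsgn V x M = (if multilin V M then x (\<lambda>vs. M (map (sgn_map V) vs)) else 0)"
  by (auto simp: tsgn_def lin_ext_def ten_apply)

lemma multilin_comorph:
  assumes "mlin (scl V) (scl W) f" "multilin W M"
  shows "multilin V (comorph f M)"
  using assms unfolding multilin_iff_mlin by (intro mlin_comorph[OF additive_times'])

context graded begin

lemma multilin_coder:
  assumes "mlin (scl V) (scl V) q" "multilin V M"
  shows "multilin V (coder (sgn_map V) q M)"
  using assms sgn_map_linear unfolding multilin_iff_mlin by (intro mlin_coder[OF additive_times'])

lemma dual_to_coder_of:
  assumes "mlin (scl V) (scl V) q"
  shows "dual_to V V (coder_of V q) (coder (sgn_map V) q)"
  unfolding dual_to_def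
  using multilin_coder[OF assms]
  by (auto simp: coder_of_apply ten_apply coder_add coder_additive[OF additive_times', symmetric] intro!: coder_cong)

lemma dual_to_tsgn: "dual_to V V (tsgn V) (\<lambda>M vs. M (map (sgn_map V) vs))"
proof -
  have "multilin V (\<lambda>vs. M (map (sgn_map V) vs))" if "multilin V M" for M
    using that unfolding multilin_iff_mlin by (rule mlin_map) (rule sgn_map_linear)
  then show ?thesis unfolding dual_to_def by (auto simp: tsgn_apply ten_apply)
qed

lemma dual_to_id: "dual_to V V id (\<lambda>M. M)"
  by (auto simp: dual_to_def ten_def)

lemma deconc_coder_of:
  assumes q: "mlin (scl V) (scl V) q" and x: "x \<in> Tbar V"
  shows "deconc V (coder_of V q x) =
    tensor_map V V (coder_of V q) id (deconc V x) + tensor_map V V (tsgn V) (coder_of V q) (deconc V x)"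
proof
  fix B
  show "deconc V (coder_of V q x) B = (tensor_map V V (coder_of V q) id (deconc V x) +
      tensor_map V V (tsgn V) (coder_of V q) (deconc V x)) B"
  proof (cases "bimultilin V B")
    case True
    let ?s = "sgn_map V"
    let ?R = "reduced_form B"
    let ?D = "\<lambda>u w. coder ?s q (\<lambda>u'. ?R u' w) u" and ?E = "\<lambda>u w. coder ?s q (?R (map ?s u)) w"
    note D = tensor_map_deconc[OF dual_to_coder_of[OF q] dual_to_id x True]
    note E = tensor_map_deconc[OF dual_to_tsgn dual_to_coder_of[OF q] x True]
    have mult: "multilin V (splits (reduced_form C))" if "bimultilin V C" for C
      using multilin_reduced_form[OF that] by (intro multilin_splits)
    have "coder ?s q (splits ?R) = (\<lambda>vs. splits (reduced_form ?D) vs + splits (reduced_form ?E) vs)"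
      unfolding coder_splits[abs_def] splits_add[symmetric]
      by (intro ext splits_cong) (auto simp: reduced_form_def)
    then show ?thesis
      using mult[OF True] Tbar_add[OF x mult[OF D(2)] mult[OF E(2)]] True
      by (simp add: deconc_apply coder_of_apply D(1) E(1))
  qed (simp add: deconc_apply tensor_map_def)
qed

lemma coderivation_coder_of:
  assumes q: "mlin (scl V) (scl V) q"
    and deg: "\<And>ds vs. vs \<noteq> [] \<Longrightarrow> list_all2 (homogeneous V) ds vs \<Longrightarrow> homogeneous V (sum_list ds + 1) (q vs)"
  shows "coderivation V (coder_of V q)"
  unfolding coderivation_def
proof (intro conjI ballI deconc_coder_of q)
  let ?L = "\<lambda>vs. \<Sum>(i, j) | 1 \<le> j \<and> i + j \<le> length vs.
     ten V (map (sgn_map V) (take i vs) @ q (take j (drop i vs)) # drop (i + j) vs)"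
  have L: "lin_ext V ?L (ten V vs) = ?L vs" for vs
  proof (rule lin_ext_ten)
    fix M assume M: "multilin V M"
    have "(\<lambda>vs. ?L vs M) = coder (sgn_map V) q M"
      using M by (auto simp: coder_eq_sum sum_fun_apply split_def ten_apply)
    then show "multilin V (\<lambda>vs. ?L vs M)" using multilin_coder[OF q M] by simp
  qed (simp add: sum_fun_apply split_def ten_def)
  show "tbar_linear V V 1 (coder_of V q)"
    unfolding coder_of_def
  proof (rule tbar_linear_lin_ext)
    fix vs :: "'v list" assume "vs \<noteq> []"
    show "lin_ext V ?L (ten V vs) \<in> Tbar V"
      unfolding L unfolding Tbar_def
      by (intro module.span_sum[OF module_tscale]) (auto intro!: module.span_base[OF module_tscale])
  next
    fix vs :: "'v list" and ds assume vs: "vs \<noteq> []" "list_all2 (homogeneous V) ds vs"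
    have "ten V (map (sgn_map V) (take i vs) @ q (take j (drop i vs)) # drop (i + j) vs) \<in>
       {ten V vs |vs es. vs \<noteq> [] \<and> list_all2 (homogeneous V) es vs \<and> sum_list es = sum_list ds + 1}"
      if ij: "1 \<le> j" "i + j \<le> length vs" for i j
    proof -
      let ?es = "take i ds @ (sum_list (take j (drop i ds)) + 1) # drop (i + j) ds"
      have "list_all2 (homogeneous V) (take i ds) (map (sgn_map V) (take i vs))"
        using vs(2) by (auto simp: list_all2_conv_all_nth intro: homogeneous_sgn_map)
      moreover have "homogeneous V (sum_list (take j (drop i ds)) + 1) (q (take j (drop i vs)))"
        using vs ij by (intro deg list_all2_takeI list_all2_dropI) auto
      moreover have "list_all2 (homogeneous V) (drop (i + j) ds) (drop (i + j) vs)"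
        using vs by (intro list_all2_dropI)
      ultimately have "list_all2 (homogeneous V) ?es
          (map (sgn_map V) (take i vs) @ q (take j (drop i vs)) # drop (i + j) vs)"
        by (intro list_all2_appendI) auto
      moreover have "sum_list ?es = sum_list ds + 1"
      proof -
        have "ds = take i ds @ take j (drop i ds) @ drop (i + j) ds"
          by (metis append_take_drop_id drop_drop add.commute)
        then have "sum_list ds = sum_list (take i ds @ take j (drop i ds) @ drop (i + j) ds)" by simp
        then show ?thesis by simp
      qed
      ultimately show ?thesis by (blast intro: append_is_Nil_conv)
    qed
    then show "lin_ext V ?L (ten V vs) \<in> Tbar_deg V (sum_list ds + 1)"
      unfolding L unfolding Tbar_deg_def
      by (intro module.span_sum[OF module_tscale]) (auto intro!: module.span_base[OF module_tscale])
  qed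
qed

end

lemma dual_to_comorph_of:
  assumes "mlin (scl V) (scl W) f"
  shows "dual_to V W (comorph_of W f) (comorph f)"
  unfolding dual_to_def
  using multilin_comorph[OF assms]
  by (auto simp: comorph_of_apply ten_apply comorph_add comorph_additive[OF additive_times', symmetric] intro!: comorph_cong)

text \<open>Maps of degree 0 on the blocks preserve the total degree.\<close>
lemma blocks_homogeneous:
  assumes deg: "\<And>ds vs. vs \<noteq> [] \<Longrightarrow> list_all2 (homogeneous V) ds vs \<Longrightarrow> homogeneous W (sum_list ds) (f vs)"
    and "list_all2 (homogeneous V) ds vs" "bs \<in> blocks vs"
  shows "\<exists>es. list_all2 (homogeneous W) es (map f bs) \<and> sum_list es = sum_list ds"
  using assms(2,3)
proof (induction bs arbitrary: ds vs)
  case (Cons b bs)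
  then have vs: "vs = b @ concat bs" "b \<noteq> []" "bs \<in> blocks (concat bs)"
    by (auto simp: blocks_def)
  with Cons.prems obtain d e where de: "ds = d @ e" "list_all2 (homogeneous V) d b"
      "list_all2 (homogeneous V) e (concat bs)"
    by (auto simp: list_all2_append2)
  from Cons.IH[OF de(3) vs(3)] obtain es where
    "list_all2 (homogeneous W) es (map f bs)" "sum_list es = sum_list e" by blast
  with de deg[OF vs(2) de(2)] show ?case
    by (intro exI[of _ "sum_list d # es"]) simp
qed (auto simp: blocks_def)

lemma blocks_nonempty: "bs \<in> blocks vs \<Longrightarrow> vs \<noteq> [] \<Longrightarrow> bs \<noteq> []"
  by (auto simp: blocks_def)

lemma comorph_of_ten:
  assumes f: "mlin (scl V) (scl W) f"
  shows "comorph_of W f (ten V vs) = (\<Sum>bs\<in>blocks vs. ten W (map f bs))"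
proof
  fix M
  show "comorph_of W f (ten V vs) M = (\<Sum>bs\<in>blocks vs. ten W (map f bs)) M"
    using multilin_comorph[OF f, of M]
    by (auto simp: comorph_of_apply ten_apply sum_fun_apply comorph_def) (simp add: ten_def)
qed

lemma coalgebra_morphism_comorph_of:
  fixes V :: "('k::field, 'v::ab_group_add) gvs" and W :: "('k, 'w::ab_group_add) gvs"
  assumes f: "mlin (scl V) (scl W) f"
    and deg: "\<And>ds vs. vs \<noteq> [] \<Longrightarrow> list_all2 (homogeneous V) ds vs \<Longrightarrow> homogeneous W (sum_list ds) (f vs)"
  shows "coalgebra_morphism V W (comorph_of W f)"
  unfolding coalgebra_morphism_def
proof (intro conjI ballI)
  have L: "lin_ext W (\<lambda>vs. \<Sum>bs | concat bs = vs \<and> [] \<notin> set bs. ten W (map f bs)) (ten V vs) =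
      (\<Sum>bs\<in>blocks vs. ten W (map f bs))" for vs
    using comorph_of_ten[OF f, of vs] by (simp add: comorph_of_def)
  show "tbar_linear V W 0 (comorph_of W f)"
    unfolding comorph_of_def
  proof (rule tbar_linear_lin_ext, unfold L)
    fix vs :: "'v list" assume vs: "vs \<noteq> []"
    show "(\<Sum>bs\<in>blocks vs. ten W (map f bs)) \<in> Tbar W"
      unfolding Tbar_def using blocks_nonempty[OF _ vs]
      by (intro module.span_sum[OF module_tscale]) (auto intro!: module.span_base[OF module_tscale])
  next
    fix vs :: "'v list" and ds assume vs: "vs \<noteq> []" "list_all2 (homogeneous V) ds vs"
    show "(\<Sum>bs\<in>blocks vs. ten W (map f bs)) \<in> Tbar_deg W (sum_list ds + 0)"
      unfolding Tbar_deg_def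
    proof (intro module.span_sum[OF module_tscale] module.span_base[OF module_tscale])
      fix bs assume bs: "bs \<in> blocks vs"
      have "\<exists>es. list_all2 (homogeneous W) es (map f bs) \<and> sum_list es = sum_list ds"
        by (rule blocks_homogeneous[where f = f, OF _ vs(2) bs]) (rule deg)
      then obtain es where "list_all2 (homogeneous W) es (map f bs)" "sum_list es = sum_list ds + 0"
        by auto
      moreover have "map f bs \<noteq> []" using blocks_nonempty[OF bs vs(1)] by simp
      ultimately show "ten W (map f bs) \<in> {ten W vs |vs es. vs \<noteq> [] \<and> list_all2 (homogeneous W) es vs \<and>
          sum_list es = sum_list ds + 0}"
        by blast
    qed
  qed
  fix x assume x: "x \<in> Tbar V"
  show "deconc W (comorph_of W f x) = tensor_map V W (comorph_of W f) (comorph_of W f) (deconc V x)"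
  proof
    fix B
    show "deconc W (comorph_of W f x) B =
        tensor_map V W (comorph_of W f) (comorph_of W f) (deconc V x) B"
    proof (cases "bimultilin W B")
      case True
      let ?R = "reduced_form B"
      note D = tensor_map_deconc[OF dual_to_comorph_of[OF f] dual_to_comorph_of[OF f] x True]
      have mult: "multilin W (splits ?R)"
        using multilin_reduced_form[OF True] by (intro multilin_splits)
      have "comorph f (splits ?R) = splits (reduced_form (\<lambda>u w. comorph f (\<lambda>u'. comorph f (?R u') w) u))"
        unfolding comorph_splits[abs_def]
        by (intro ext splits_cong) (auto simp: reduced_form_def)
      then show ?thesis
        using mult True by (simp add: deconc_apply comorph_of_apply D(1))
    qed (simp add: deconc_apply tensor_map_def)
  qed
qed

text \<open>By duality, an identity of operators holds after evaluation at every functional.\<close>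
lemma comorph_of_coder_of:
  assumes V: "graded_vs V" and W: "graded_vs W"
    and f: "mlin (scl V) (scl W) f" and r: "mlin (scl W) (scl W) r"
    and taylor: "\<And>x. x \<noteq> [] \<Longrightarrow> coder (sgn_map V) q f x = comorph f r x"
    and s: "\<And>x. x \<noteq> [] \<Longrightarrow> f (map (sgn_map V) x) = sgn_map W (f x)"
  shows "comorph_of W f (coder_of V q x) = coder_of W r (comorph_of W f x)"
proof
  interpret V: graded V by standard (rule V)
  interpret W: graded W by standard (rule W)
  fix M
  show "comorph_of W f (coder_of V q x) M = coder_of W r (comorph_of W f x) M"
  proof (cases "multilin W M")
    case True
    then have "coder (sgn_map V) q (comorph f M) = comorph f (coder (sgn_map W) r M)"
      using comorph_intertwines[OF taylor s W.multilin_multiadd[OF True]] by blast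
    with True multilin_comorph[OF f True] W.multilin_coder[OF r True] show ?thesis
      by (simp add: comorph_of_apply coder_of_apply)
  qed (simp add: comorph_of_apply coder_of_apply)
qed

lemma comorph_of_comorph_of:
  assumes "graded_vs X" and g: "mlin (scl W) (scl X) g"
  shows "comorph_of X g (comorph_of W f x) = comorph_of X (comorph f g) x"
proof
  interpret graded X by standard fact
  fix M
  have "multilin X M \<Longrightarrow> comorph f (comorph g M) = comorph (comorph f g) M"
    using comorph_comp[OF multilin_multiadd] by blast
  then show "comorph_of X g (comorph_of W f x) M = comorph_of X (comorph f g) x M"
    using multilin_comorph[OF g, of M] by (auto simp: comorph_of_apply)
qed


text \<open>The order embedding of the naturals that omits \<open>q\<close>.\<close>
definition skip :: "nat \<Rightarrow> nat \<Rightarrow> nat" where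
  "skip q j = (if j < q then j else Suc j)"

text \<open>The permutation that moves \<open>q\<close> to position 0 and is \<open>\<sigma>\<close> on the other letters.\<close>
definition ext_perm :: "nat \<Rightarrow> (nat \<Rightarrow> nat) \<Rightarrow> nat \<Rightarrow> nat" where
  "ext_perm q \<sigma> i = (if i = q then 0 else Suc (\<sigma> (if i < q then i else i - 1)))"

lemma ext_perm_simps [simp]: "ext_perm q \<sigma> q = 0" "ext_perm q \<sigma> (skip q j) = Suc (\<sigma> j)"
  by (auto simp: ext_perm_def skip_def)

lemma skip_cases: obtains "i = q" | j where "i = skip q j"
proof (cases "i = q")
  case False
  then have "i = skip q (if i < q then i else i - 1)" by (auto simp: skip_def)
  with that show ?thesis by blast
qed

lemma skip_neq [simp]: "skip q j \<noteq> q" and skip_inject [simp]: "skip q i = skip q j \<longleftrightarrow> i = j"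
  and skip_less_iff: "skip q i < skip q j \<longleftrightarrow> i < j"
  and skip_bound: "q \<le> n \<Longrightarrow> skip q j < Suc n \<longleftrightarrow> j < n"
  by (auto simp: skip_def)

lemma ext_perm_permutes:
  assumes "\<sigma> permutes {..<n}" "q \<le> n"
  shows "ext_perm q \<sigma> permutes {..<Suc n}"
  unfolding permutes_def
proof (intro conjI allI impI)
  fix x assume "x \<notin> {..<Suc n}"
  with assms show "ext_perm q \<sigma> x = x"
    using permutes_not_in[OF assms(1), of "x - 1"] by (auto simp: ext_perm_def)
next
  fix y
  show "\<exists>!x. ext_perm q \<sigma> x = y"
  proof (cases y)
    case 0
    show ?thesis unfolding 0
    proof (rule ex1I[of _ q])
      fix x assume "ext_perm q \<sigma> x = 0"
      then show "x = q" by (cases rule: skip_cases[of x q]) auto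
    qed simp
  next
    case (Suc y')
    define j where "j = inv \<sigma> y'"
    have j: "\<sigma> j = y'" "\<And>j'. \<sigma> j' = y' \<Longrightarrow> j' = j"
      using permutes_inverses[OF assms(1)] by (auto simp: j_def)
    show ?thesis unfolding Suc
    proof (rule ex1I[of _ "skip q j"])
      fix x assume "ext_perm q \<sigma> x = Suc y'"
      then show "x = skip q j" using j(2) by (cases rule: skip_cases[of x q]) auto
    qed (simp add: j)
  qed
qed

lemma inv_ext_perm:
  assumes "\<sigma> permutes {..<n}" "q \<le> n"
  shows "inv (ext_perm q \<sigma>) 0 = q" "inv (ext_perm q \<sigma>) (Suc k) = skip q (inv \<sigma> k)"
  by (rule inv_f_eq[OF permutes_inj[OF ext_perm_permutes[OF assms]]], simp)
    (rule inv_f_eq[OF permutes_inj[OF ext_perm_permutes[OF assms]]],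
      simp add: permutes_inverses(1)[OF assms(1)])

lemma permutes_ext_permE:
  assumes \<tau>: "\<tau> permutes {..<Suc n}"
  obtains \<sigma> where "\<sigma> permutes {..<n}" "\<tau> = ext_perm (inv \<tau> 0) \<sigma>"
proof -
  define q where "q = inv \<tau> 0"
  define \<sigma> where "\<sigma> j = \<tau> (skip q j) - 1" for j
  have \<tau>q: "\<tau> q = 0" using permutes_inverses(1)[OF \<tau>] by (simp add: q_def)
  have q: "q \<le> n"
  proof (rule ccontr)
    assume "\<not> q \<le> n"
    then have "\<tau> q = q" using permutes_not_in[OF \<tau>, of q] by auto
    with \<tau>q \<open>\<not> q \<le> n\<close> show False by simp
  qed
  have pos: "\<tau> (skip q j) = Suc (\<sigma> j)" for j
    using injD[OF permutes_inj[OF \<tau>], of "skip q j" q] \<tau>q by (cases "\<tau> (skip q j)") (auto simp: \<sigma>_def)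
  have "\<tau> i = ext_perm q \<sigma> i" for i
    by (cases rule: skip_cases[of i q]) (auto simp: pos \<tau>q)
  moreover have "\<sigma> permutes {..<n}"
    unfolding permutes_def
  proof (intro conjI allI impI)
    fix x assume "x \<notin> {..<n}"
    then show "\<sigma> x = x" using q permutes_not_in[OF \<tau>, of "Suc x"] by (simp add: \<sigma>_def skip_def)
  next
    fix y
    define i where "i = inv \<tau> (Suc y)"
    have i: "\<tau> i = Suc y" by (simp add: i_def permutes_inverses(1)[OF \<tau>])
    have i2: "i' = i" if "\<tau> i' = Suc y" for i'
      using permutes_inverses(2)[OF \<tau>, of i'] that by (simp add: i_def)
    have "i \<noteq> q" using \<tau>q i by (intro notI) simp
    then obtain j where j: "i = skip q j" by (cases rule: skip_cases[of i q]) auto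
    show "\<exists>!x. \<sigma> x = y"
    proof (rule ex1I[of _ j])
      show "\<sigma> j = y" using i j pos[of j] by simp
      fix x assume "\<sigma> x = y"
      then have "skip q x = i" by (intro i2) (simp add: pos)
      then show "x = j" unfolding j by simp
    qed
  qed
  ultimately show thesis using that q_def by blast
qed

lemma shuffle_permsD:
  assumes "\<sigma> \<in> shuffle_perms p n"
  shows "\<sigma> permutes {..<n}" "Suc i < n \<Longrightarrow> Suc i \<noteq> p \<Longrightarrow> \<sigma> i < \<sigma> (Suc i)"
  using assms by (auto simp: shuffle_perms_def)

lemma shuffle_perms_trivial:
  assumes "p = 0 \<or> p = n"
  shows "shuffle_perms p n = {id}"
proof (intro equalityI subsetI)
  fix \<sigma> assume \<sigma>: "\<sigma> \<in> shuffle_perms p n"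
  have le: "i < n \<longrightarrow> i \<le> \<sigma> i" for i
  proof (induction i)
    case (Suc i)
    then show ?case using shuffle_permsD(2)[OF \<sigma>, of i] assms by fastforce
  qed simp
  then have "\<sigma> = id"
    using shuffle_permsD(1)[OF \<sigma>] by (intro permutes_natset_ge[of _ "{..<n}"]) auto
  then show "\<sigma> \<in> {id}" by simp
qed (auto simp: shuffle_perms_def permutes_id)

text \<open>The first letter of a shuffle is the first letter of one of the two words: a position \<open>q\<close> that is
  neither 0 nor \<open>p\<close> has a predecessor with a smaller image.\<close>
lemma shuffle_perms_Suc:
  assumes "p \<le> n" "0 < p"
  shows "shuffle_perms p (Suc n) =
    ext_perm 0 ` shuffle_perms (p - 1) n \<union> ext_perm p ` shuffle_perms p n"
proof (intro equalityI subsetI)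
  fix \<tau> assume \<tau>: "\<tau> \<in> shuffle_perms p (Suc n)"
  define q where "q = inv \<tau> 0"
  from permutes_ext_permE[OF shuffle_permsD(1)[OF \<tau>]] obtain \<sigma>
    where \<sigma>: "\<sigma> permutes {..<n}" "\<tau> = ext_perm q \<sigma>" unfolding q_def by blast
  have step: "Suc i < Suc n \<Longrightarrow> Suc i \<noteq> p \<Longrightarrow> ext_perm q \<sigma> i < ext_perm q \<sigma> (Suc i)" for i
    using shuffle_permsD(2)[OF \<tau>, of i] \<sigma>(2) by simp
  have "q \<le> n"
  proof (rule ccontr)
    assume "\<not> q \<le> n"
    then have "\<tau> q = q" using permutes_not_in[OF shuffle_permsD(1)[OF \<tau>], of q] by auto
    with \<sigma>(2) \<open>\<not> q \<le> n\<close> show False by simp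
  qed
  have "q = 0 \<or> q = p"
  proof (rule ccontr)
    assume "\<not> (q = 0 \<or> q = p)"
    then obtain i where "q = Suc i" "q \<noteq> p" by (cases q) auto
    with step[of i] \<open>q \<le> n\<close> show False by simp
  qed
  then show "\<tau> \<in> ext_perm 0 ` shuffle_perms (p - 1) n \<union> ext_perm p ` shuffle_perms p n"
  proof
    assume q: "q = 0"
    have "\<sigma> \<in> shuffle_perms (p - 1) n"
      using \<sigma>(1) step[of "Suc _"] assms by (auto simp: shuffle_perms_def q ext_perm_def)
    then show ?thesis using \<sigma>(2) q by blast
  next
    assume q: "q = p"
    have "\<sigma> i < \<sigma> (Suc i)" if "Suc i < n" "Suc i \<noteq> p" for i
    proof (cases "Suc i < p")
      case True
      then show ?thesis using that step[of i] by (auto simp: q ext_perm_def)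
    next
      case False
      with that have "p < Suc i" by simp
      then show ?thesis using that step[of "Suc i"] by (auto simp: q ext_perm_def)
    qed
    then have "\<sigma> \<in> shuffle_perms p n"
      using \<sigma>(1) by (auto simp: shuffle_perms_def)
    then show ?thesis using \<sigma>(2) q by blast
  qed
next
  fix \<tau> assume "\<tau> \<in> ext_perm 0 ` shuffle_perms (p - 1) n \<union> ext_perm p ` shuffle_perms p n"
  then show "\<tau> \<in> shuffle_perms p (Suc n)"
  proof
    assume "\<tau> \<in> ext_perm 0 ` shuffle_perms (p - 1) n"
    then obtain \<sigma> where \<sigma>: "\<sigma> \<in> shuffle_perms (p - 1) n" "\<tau> = ext_perm 0 \<sigma>" by blast
    have "\<tau> i < \<tau> (Suc i)" if "Suc i < Suc n" "Suc i \<noteq> p" for i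
      using shuffle_permsD(2)[OF \<sigma>(1), of "i - 1"] that by (cases i) (auto simp: \<sigma>(2) ext_perm_def)
    then show ?thesis
      using ext_perm_permutes[OF shuffle_permsD(1)[OF \<sigma>(1)], of 0] \<sigma>(2)
      by (auto simp: shuffle_perms_def)
  next
    assume "\<tau> \<in> ext_perm p ` shuffle_perms p n"
    then obtain \<sigma> where \<sigma>: "\<sigma> \<in> shuffle_perms p n" "\<tau> = ext_perm p \<sigma>" by blast
    have "\<tau> i < \<tau> (Suc i)" if "Suc i < Suc n" "Suc i \<noteq> p" for i
    proof -
      from that(2) consider "Suc i < p" | "i = p" | "p < i" by linarith
      then show ?thesis
      proof cases
        case 1
        then show ?thesis using shuffle_permsD(2)[OF \<sigma>(1), of i] that assms
          by (auto simp: \<sigma>(2) ext_perm_def)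
      next
        case 3
        then show ?thesis using shuffle_permsD(2)[OF \<sigma>(1), of "i - 1"] that assms
          by (auto simp: \<sigma>(2) ext_perm_def)
      qed (auto simp: \<sigma>(2) ext_perm_def)
    qed
    then show ?thesis
      using ext_perm_permutes[OF shuffle_permsD(1)[OF \<sigma>(1)] assms(1)] \<sigma>(2)
      by (auto simp: shuffle_perms_def)
  qed
qed

lemma inj_ext_perm: "inj (ext_perm q)"
proof (rule injI)
  fix \<sigma> \<tau> assume eq: "ext_perm q \<sigma> = ext_perm q \<tau>"
  show "\<sigma> = \<tau>"
  proof
    fix j
    from fun_cong[OF eq, of "skip q j"] show "\<sigma> j = \<tau> j" by simp
  qed
qed

lemma finite_shuffle_perms [simp]: "finite (shuffle_perms p n)"
  by (rule finite_subset[of _ "{\<sigma>. \<sigma> permutes {..<n}}"])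
    (auto simp: shuffle_perms_def finite_permutations)

lemma sum_shuffle_perms_Suc:
  assumes "p \<le> n" "0 < p"
  shows "(\<Sum>\<sigma>\<in>shuffle_perms p (Suc n). h \<sigma>) =
    (\<Sum>\<sigma>\<in>shuffle_perms (p - 1) n. h (ext_perm 0 \<sigma>)) + (\<Sum>\<sigma>\<in>shuffle_perms p n. h (ext_perm p \<sigma>))"
proof -
  have "ext_perm 0 \<sigma> 0 \<noteq> ext_perm p \<sigma>' 0" for \<sigma> \<sigma>'
    using assms(2) by (simp add: ext_perm_def)
  then have "ext_perm 0 \<sigma> \<noteq> ext_perm p \<sigma>'" for \<sigma> \<sigma>' by metis
  then have "ext_perm 0 ` shuffle_perms (p - 1) n \<inter> ext_perm p ` shuffle_perms p n = {}"
    by blast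
  then show ?thesis
    unfolding shuffle_perms_Suc[OF assms]
    by (simp add: sum.union_disjoint sum.reindex inj_on_subset[OF inj_ext_perm])
qed

text \<open>Moving the letter \<open>q\<close> to the front creates an inversion with each earlier letter; the other
  inversions are those of \<open>\<sigma>\<close>.\<close>
lemma koszul_sign_ext_perm:
  assumes q: "q \<le> n"
  shows "koszul_sign b (Suc n) (ext_perm q \<sigma>) =
    (- 1) ^ card {i. i < q \<and> b i \<and> b q} * (koszul_sign (\<lambda>i. b (skip q i)) n \<sigma> :: 'k::field)"
proof -
  let ?I = "{(i, j). i < j \<and> j < n \<and> \<sigma> j < \<sigma> i \<and> b (skip q i) \<and> b (skip q j)}"
  let ?A = "(\<lambda>i. (i, q)) ` {i. i < q \<and> b i \<and> b q}"
  let ?B = "(\<lambda>(i, j). (skip q i, skip q j)) ` ?I"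
  have "{(i, j). i < j \<and> j < Suc n \<and> ext_perm q \<sigma> j < ext_perm q \<sigma> i \<and> b i \<and> b j} = ?A \<union> ?B"
    (is "?L = _")
  proof (intro equalityI subsetI)
    fix p assume "p \<in> ?L"
    then obtain i j where p: "p = (i, j)" "i < j" "j < Suc n" "ext_perm q \<sigma> j < ext_perm q \<sigma> i" "b i" "b j"
      by auto
    from p(4) have "i \<noteq> q" by auto
    then obtain i' where i: "i = skip q i'" by (cases rule: skip_cases[of i q]) auto
    show "p \<in> ?A \<union> ?B"
    proof (cases rule: skip_cases[of j q])
      case 1 then show ?thesis using p by auto
    next
      case (2 j')
      then have "(i', j') \<in> ?I" using p i q by (auto simp: skip_less_iff skip_bound)
      then have "p \<in> ?B" using p(1) i 2 by (intro image_eqI[of _ _ "(i', j')"]) auto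
      then show ?thesis ..
    qed
  next
    fix p assume "p \<in> ?A \<union> ?B"
    then show "p \<in> ?L"
    proof
      assume "p \<in> ?A"
      then obtain i where i: "p = (i, q)" "i < q" "b i" "b q" by auto
      then show ?thesis using q by (auto simp: ext_perm_def)
    next
      assume "p \<in> ?B"
      then show ?thesis using q by (auto simp: skip_less_iff skip_bound)
    qed
  qed
  moreover have "?A \<inter> ?B = {}" using skip_neq[THEN not_sym] by auto
  moreover have fin: "finite ?I"
    by (rule finite_subset[of _ "{..<n} \<times> {..<n}"]) auto
  moreover have "card ?A = card {i. i < q \<and> b i \<and> b q}"
    by (rule card_image) (auto simp: inj_on_def)
  moreover have "card ?B = card ?I"
    by (rule card_image) (auto simp: inj_on_def)
  ultimately have "card {(i, j). i < j \<and> j < Suc n \<and> ext_perm q \<sigma> j < ext_perm q \<sigma> i \<and> b i \<and> b j} =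
      card {i. i < q \<and> b i \<and> b q} + card ?I"
    by (simp add: card_Un_disjoint)
  then show ?thesis by (simp add: koszul_sign_def power_add)
qed

lemma signed_eq_times: "signed b (x :: 'k::ring_1) = (if b then - 1 else 1) * x"
  by (simp add: signed_def)

lemma sign_par:
  "(- 1) ^ card {i. i < length u \<and> fst (u ! i)} = (if parity u then - 1 else 1 :: 'k::ring_1)"
  unfolding length_filter_conv_card[symmetric] by (induction u) auto

text \<open>The sum over shuffle permutations satisfies the recursion on the first letters.\<close>
lemma sum_shuffle_perms_eq_shuffle:
  fixes M :: "'v list \<Rightarrow> 'k::field"
  shows "(\<Sum>\<sigma>\<in>shuffle_perms (length u) (length (u @ w)).
      koszul_sign (\<lambda>i. fst ((u @ w) ! i)) (length (u @ w)) \<sigma> *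
      M (map (\<lambda>k. snd ((u @ w) ! inv \<sigma> k)) [0..<length (u @ w)])) = shuffle M u w"
proof -
  have trivial: "(\<Sum>\<sigma>\<in>{id}. koszul_sign (\<lambda>i. fst (v ! i)) (length v) \<sigma> *
      M (map (\<lambda>k. snd (v ! inv \<sigma> k)) [0..<length v])) = M (map snd v)" for v and M :: "'v list \<Rightarrow> 'k"
  proof -
    have "koszul_sign (\<lambda>i. fst (v ! i)) (length v) id = (1 :: 'k)"
    proof -
      have "{(i, j). i < j \<and> j < length v \<and> id j < id i \<and> fst (v ! i) \<and> fst (v ! j)} = {}" by auto
      then show ?thesis unfolding koszul_sign_def by (simp only: card.empty power_0)
    qed
    moreover have "map (\<lambda>k. snd (v ! k)) [0..<length v] = map snd v"
      by (rule nth_equalityI) auto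
    ultimately show ?thesis by simp
  qed
  show ?thesis
  proof (induction M u w rule: shuffle.induct)
    case (1 M w)
    show ?case
      unfolding list.size(3) append_Nil shuffle_perms_trivial[OF disjI1[OF refl]] shuffle.simps
      by (rule trivial)
  next
    case (2 M a u)
    show ?case
      unfolding append_Nil2 shuffle_perms_trivial[OF disjI2[OF refl]] shuffle.simps by (rule trivial)
  next
    case (3 M a u b w)
    let ?v = "a # u @ b # w"
    let ?p = "Suc (length u)" and ?n = "Suc (length u + length w)"
    let ?h = "\<lambda>\<sigma>. koszul_sign (\<lambda>i. fst (?v ! i)) (Suc ?n) \<sigma> * M (map (\<lambda>k. snd (?v ! inv \<sigma> k)) [0..<Suc ?n])"
    have split: "(\<Sum>\<sigma>\<in>shuffle_perms ?p (Suc ?n). ?h \<sigma>) =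
        (\<Sum>\<sigma>\<in>shuffle_perms (length u) ?n. ?h (ext_perm 0 \<sigma>)) +
        (\<Sum>\<sigma>\<in>shuffle_perms ?p ?n. ?h (ext_perm ?p \<sigma>))"
      using sum_shuffle_perms_Suc[of ?p ?n ?h] by simp
    have skip0: "?v ! skip 0 i = (u @ b # w) ! i" for i
      by (simp add: skip_def)
    have skipp: "?v ! skip ?p i = (a # u @ w) ! i" for i
      by (auto simp: skip_def nth_append nth_Cons' less_Suc_eq_le)
    have "?h (ext_perm 0 \<sigma>) = koszul_sign (\<lambda>i. fst ((u @ b # w) ! i)) ?n \<sigma> *
        M (snd a # map (\<lambda>k. snd ((u @ b # w) ! inv \<sigma> k)) [0..<?n])"
      if "\<sigma> \<in> shuffle_perms (length u) ?n" for \<sigma>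
      using shuffle_permsD(1)[OF that]
      by (subst koszul_sign_ext_perm)
        (simp_all add: skip0 inv_ext_perm[of _ ?n] map_upt_Suc del: upt_Suc nth_Cons_Suc)
    then have 1: "(\<Sum>\<sigma>\<in>shuffle_perms (length u) ?n. ?h (ext_perm 0 \<sigma>)) =
        shuffle (\<lambda>z. M (snd a # z)) u (b # w)"
      using 3(1) by (simp del: upt_Suc)
    have "{i. i < ?p \<and> fst (?v ! i) \<and> fst (?v ! ?p)} =
        (if fst b then {i. i < length (a # u) \<and> fst ((a # u) ! i)} else {})"
      by (auto simp: nth_append nth_Cons' split: if_splits)
    then have sign: "(- 1) ^ card {i. i < ?p \<and> fst (?v ! i) \<and> fst (?v ! ?p)} =
        (if fst b \<and> parity (a # u) then - 1 else 1 :: 'k)"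
      using sign_par[of "a # u", where ?'k = 'k] by (simp del: parity.simps)
    have "?h (ext_perm ?p \<sigma>) = (if fst b \<and> parity (a # u) then - 1 else 1) *
        (koszul_sign (\<lambda>i. fst ((a # u @ w) ! i)) ?n \<sigma> *
        M (snd b # map (\<lambda>k. snd ((a # u @ w) ! inv \<sigma> k)) [0..<?n]))"
      if "\<sigma> \<in> shuffle_perms ?p ?n" for \<sigma>
      using shuffle_permsD(1)[OF that]
      by (subst koszul_sign_ext_perm)
        (simp_all only: sign skipp inv_ext_perm[of _ ?n] map_upt_Suc, simp_all add: skipp inv_ext_perm[of _ ?n] nth_append del: upt_Suc nth_Cons_Suc parity.simps)
    then have 2: "(\<Sum>\<sigma>\<in>shuffle_perms ?p ?n. ?h (ext_perm ?p \<sigma>)) =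
        signed (fst b \<and> parity (a # u)) (shuffle (\<lambda>z. M (snd b # z)) (a # u) w)"
      using 3(2) by (simp add: signed_eq_times sum_distrib_left[symmetric] del: upt_Suc parity.simps)
    show ?case
      using split 1 2 by (simp del: upt_Suc parity.simps)
  qed
qed

section \<open>Shuffle products of tensors\<close>

context graded begin

lemma multilin_zero_letter:
  assumes "multilin V M" "0 \<in> set ws"
  shows "M ws = 0"
proof -
  from assms(2) obtain a b where ws: "ws = a @ 0 # b" by (meson split_list)
  from multilin_multiadd[OF assms(1)] have "Modules.additive (\<lambda>v. M (a @ v # b))"
    by (simp add: multiadd_def)
  from Modules.additive.zero[OF this] show ?thesis by (simp add: ws)
qed

lemma shuffle_words_apply:
  assumes "multilin V M"
  shows "shuffle_words V us ws M = (\<Sum>bs | length bs = length (us @ ws).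
    \<Sum>\<sigma>\<in>shuffle_perms (length us) (length (us @ ws)).
      koszul_sign ((!) bs) (length (us @ ws)) \<sigma> *
      M (map (\<lambda>k. parity_part V (bs ! inv \<sigma> k) ((us @ ws) ! inv \<sigma> k)) [0..<length (us @ ws)]))"
  using assms by (simp add: shuffle_words_def Let_def sum_fun_apply ten_apply)

text \<open>For letters of pure parity only the matching parities contribute to the sum over all splittings
  into even and odd parts, since every other term contains the letter 0.\<close>
lemma shuffle_words_eq_shuffle:
  assumes M: "multilin V M" and u: "set u \<subseteq> pure" and w: "set w \<subseteq> pure"
  shows "shuffle_words V (map snd u) (map snd w) M = shuffle M u w"
proof -
  let ?v = "u @ w" and ?n = "length (u @ w)"
  let ?t = "\<lambda>bs \<sigma>. koszul_sign ((!) bs) ?n \<sigma> *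
      M (map (\<lambda>k. parity_part V (bs ! inv \<sigma> k) (map snd ?v ! inv \<sigma> k)) [0..<?n])"
  have single: "(\<Sum>b\<in>{a}. g b) = g a" for a and g :: "bool list \<Rightarrow> 'k" by simp
  have pure: "?v ! i \<in> pure" if "i < ?n" for i
    using u w nth_mem[OF that] by auto
  have "shuffle_words V (map snd u) (map snd w) M =
      (\<Sum>bs | length bs = ?n. \<Sum>\<sigma>\<in>shuffle_perms (length u) ?n. ?t bs \<sigma>)"
    using shuffle_words_apply[OF M, of "map snd u" "map snd w"] by simp
  also have "\<dots> = (\<Sum>bs\<in>{map fst ?v}. \<Sum>\<sigma>\<in>shuffle_perms (length u) ?n. ?t bs \<sigma>)"
  proof (rule sum.mono_neutral_right)
    show "finite {bs :: bool list. length bs = ?n}"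
      using finite_lists_length_eq[of "UNIV :: bool set" ?n] by simp
    show "\<forall>bs\<in>{bs. length bs = ?n} - {map fst ?v}. (\<Sum>\<sigma>\<in>shuffle_perms (length u) ?n. ?t bs \<sigma>) = 0"
    proof (intro ballI sum.neutral)
      fix bs \<sigma> assume "bs \<in> {bs. length bs = ?n} - {map fst ?v}" and \<sigma>: "\<sigma> \<in> shuffle_perms (length u) ?n"
      then have "length bs = ?n" "bs \<noteq> map fst ?v" by auto
      then obtain i where i: "i < ?n" "bs ! i \<noteq> fst (?v ! i)"
        using nth_equalityI[of bs "map fst ?v"] by (metis length_map nth_map)
      note perm = shuffle_permsD(1)[OF \<sigma>]
      have "\<sigma> i < ?n" using permutes_in_image[OF perm, of i] i by simp
      moreover have "parity_part V (bs ! inv \<sigma> (\<sigma> i)) (map snd ?v ! inv \<sigma> (\<sigma> i)) = 0"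
        using i pure[OF i(1)]
        by (simp only: permutes_inverses(2)[OF perm] nth_map parity_part_pure if_False)
      ultimately have "0 \<in> set (map (\<lambda>k. parity_part V (bs ! inv \<sigma> k) (map snd ?v ! inv \<sigma> k)) [0..<?n])"
        by (auto simp del: map_append length_append intro!: image_eqI[of _ _ "\<sigma> i"])
      from multilin_zero_letter[OF M this] show "?t bs \<sigma> = 0" by simp
    qed
  qed auto
  also have "\<dots> = (\<Sum>\<sigma>\<in>shuffle_perms (length u) ?n.
      koszul_sign (\<lambda>i. fst (?v ! i)) ?n \<sigma> * M (map (\<lambda>k. snd (?v ! inv \<sigma> k)) [0..<?n]))"
    unfolding single
  proof (intro sum.cong refl arg_cong2[of _ _ _ _ "(*)"] arg_cong[of _ _ M] map_cong)
    fix \<sigma> assume \<sigma>: "\<sigma> \<in> shuffle_perms (length u) ?n"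
    have "{(i, j). i < j \<and> j < ?n \<and> \<sigma> j < \<sigma> i \<and> map fst ?v ! i \<and> map fst ?v ! j} =
        {(i, j). i < j \<and> j < ?n \<and> \<sigma> j < \<sigma> i \<and> fst (?v ! i) \<and> fst (?v ! j)}"
      by (auto simp del: map_append length_append)
    then show "koszul_sign ((!) (map fst ?v)) ?n \<sigma> = (koszul_sign (\<lambda>i. fst (?v ! i)) ?n \<sigma> :: 'k)"
      unfolding koszul_sign_def by (simp only:)
    fix k assume "k \<in> set [0..<?n]"
    then have "inv \<sigma> k < ?n"
      using permutes_in_image[OF permutes_inv[OF shuffle_permsD(1)[OF \<sigma>]], of k] by simp
    with pure[OF this] show "parity_part V (map fst ?v ! inv \<sigma> k) (map snd ?v ! inv \<sigma> k) = snd (?v ! inv \<sigma> k)"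
      by (simp only: nth_map parity_part_pure refl if_True simp_thms)
  qed
  also have "\<dots> = shuffle M u w" by (rule sum_shuffle_perms_eq_shuffle)
  finally show ?thesis .
qed

text \<open>A permuted word contains each letter exactly once.\<close>
lemma multilin_permuted_word:
  assumes M: "multilin V M" and \<sigma>: "\<sigma> permutes {..<n}" and n: "n = Suc (length A + length B)"
  shows "M (map (\<lambda>k. parity_part V (bs ! inv \<sigma> k) ((A @ (scl V c x + y) # B) ! inv \<sigma> k)) [0..<n]) =
    c * M (map (\<lambda>k. parity_part V (bs ! inv \<sigma> k) ((A @ x # B) ! inv \<sigma> k)) [0..<n]) +
    M (map (\<lambda>k. parity_part V (bs ! inv \<sigma> k) ((A @ y # B) ! inv \<sigma> k)) [0..<n])"
proof -
  let ?i = "length A"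
  let ?h = "\<lambda>k. parity_part V (bs ! inv \<sigma> k) ((A @ x # B) ! inv \<sigma> k)"
  have i: "\<sigma> ?i < n" using permutes_in_image[OF \<sigma>, of ?i] n by simp
  have other: "(A @ z # B) ! inv \<sigma> k = (A @ x # B) ! inv \<sigma> k" if "k \<noteq> \<sigma> ?i" for z k
  proof -
    have "inv \<sigma> k \<noteq> ?i" using that permutes_inverses(1)[OF \<sigma>, of k] by metis
    then show ?thesis by (simp add: nth_append nth_Cons')
  qed
  have word: "map (\<lambda>k. parity_part V (bs ! inv \<sigma> k) ((A @ z # B) ! inv \<sigma> k)) [0..<n] =
      map ?h [0..<\<sigma> ?i] @ parity_part V (bs ! ?i) z # map ?h [Suc (\<sigma> ?i)..<n]" for z
  proof -
    have "[0..<n] = [0..<\<sigma> ?i] @ \<sigma> ?i # [Suc (\<sigma> ?i)..<n]"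
      using i upt_add_eq_append[of 0 "\<sigma> ?i" "n - \<sigma> ?i"] by (simp add: upt_conv_Cons)
    then show ?thesis
      by (simp add: other[of _ z] permutes_inverses(2)[OF \<sigma>])
  qed
  show ?thesis
    unfolding word using M by (simp add: parity_part_linear multilin_def)
qed

lemma multilin_shuffle_words:
  assumes "multilin V M"
  shows "multilin V (\<lambda>us. shuffle_words V us ws M)" "multilin V (\<lambda>ws. shuffle_words V us ws M)"
proof -
  let ?S = "\<lambda>p v. \<Sum>bs | length bs = length v. \<Sum>\<sigma>\<in>shuffle_perms p (length v).
      koszul_sign ((!) bs) (length v) \<sigma> *
      M (map (\<lambda>k. parity_part V (bs ! inv \<sigma> k) (v ! inv \<sigma> k)) [0..<length v])"
  have S: "?S p (A @ (scl V c x + y) # B) = c * ?S p (A @ x # B) + ?S p (A @ y # B)" for p A B c x y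
  proof -
    let ?n = "Suc (length A + length B)"
    have "?S p (A @ (scl V c x + y) # B) = (\<Sum>bs | length bs = ?n. \<Sum>\<sigma>\<in>shuffle_perms p ?n.
      koszul_sign ((!) bs) ?n \<sigma> * (
      c * M (map (\<lambda>k. parity_part V (bs ! inv \<sigma> k) ((A @ x # B) ! inv \<sigma> k)) [0..<?n]) +
      M (map (\<lambda>k. parity_part V (bs ! inv \<sigma> k) ((A @ y # B) ! inv \<sigma> k)) [0..<?n])))"
      using multilin_permuted_word[OF assms shuffle_permsD(1) refl]
      by (intro sum.cong) (simp_all del: upt_Suc)
    then show ?thesis
      by (simp add: sum.distrib sum_distrib_left algebra_simps del: upt_Suc)
  qed
  show "multilin V (\<lambda>us. shuffle_words V us ws M)"
    unfolding multilin_def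
  proof (intro allI)
    fix A B c x y
    show "shuffle_words V (A @ (scl V c x + y) # B) ws M =
        c * shuffle_words V (A @ x # B) ws M + shuffle_words V (A @ y # B) ws M"
      using S[where A = A and B = "B @ ws" and p = "length (A @ x # B)"]
      by (simp add: shuffle_words_apply[OF assms] del: upt_Suc)
  qed
  show "multilin V (\<lambda>ws. shuffle_words V us ws M)"
    unfolding multilin_def
  proof (intro allI)
    fix A B c x y
    show "shuffle_words V us (A @ (scl V c x + y) # B) M =
        c * shuffle_words V us (A @ x # B) M + shuffle_words V us (A @ y # B) M"
      using S[where A = "us @ A" and B = B and p = "length us"]
      by (simp add: shuffle_words_apply[OF assms] del: upt_Suc)
  qed
qed

lemma multilin_Tbar_shuffle:
  assumes M: "multilin V M" and y: "y \<in> Tbar V"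
  shows "multilin V (\<lambda>us. y (\<lambda>ws. shuffle_words V us ws M))"
  unfolding multilin_def
proof (intro allI)
  fix us ws c a b
  have "(\<lambda>w. shuffle_words V (us @ (scl V c a + b) # ws) w M) =
      (\<lambda>w. c * shuffle_words V (us @ a # ws) w M + shuffle_words V (us @ b # ws) w M)"
    using multilin_shuffle_words(1)[OF M] by (simp add: multilin_def fun_eq_iff)
  then show "y (\<lambda>w. shuffle_words V (us @ (scl V c a + b) # ws) w M) =
     c * y (\<lambda>w. shuffle_words V (us @ a # ws) w M) + y (\<lambda>w. shuffle_words V (us @ b # ws) w M)"
    using Tbar_linear[OF y multilin_shuffle_words(2)[OF M] multilin_shuffle_words(2)[OF M]] by simp
qed

lemma shuffle_prod_left:
  "shuffle_prod V (tscale c x1 + x2) y = tscale c (shuffle_prod V x1 y) + shuffle_prod V x2 y"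
  by (auto simp: shuffle_prod_def fun_eq_iff)

lemma shuffle_prod_right:
  assumes "x \<in> Tbar V" "y1 \<in> Tbar V" "y2 \<in> Tbar V"
  shows "shuffle_prod V x (tscale c y1 + y2) = tscale c (shuffle_prod V x y1) + shuffle_prod V x y2"
  using Tbar_linear[OF assms(1) multilin_Tbar_shuffle[OF _ assms(2)] multilin_Tbar_shuffle[OF _ assms(3)]]
  by (auto simp: shuffle_prod_def fun_eq_iff)

lemma shuffle_prod_ten:
  assumes "us \<noteq> []" "ws \<noteq> []" "multilin V M"
  shows "shuffle_prod V (ten V us) (ten V ws) M = shuffle_words V us ws M"
  using assms multilin_shuffle_words[OF assms(3)] by (simp add: shuffle_prod_def ten_apply)

text \<open>Split the letters into even and odd parts one after the other; \<open>u\<close> is the part already split.\<close>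
lemma ten_in_pure_span:
  "ten V (map snd u @ vs) \<in> module.span tscale {ten V (map snd w) |w. w \<noteq> [] \<and> set w \<subseteq> pure}"
  if "set u \<subseteq> pure" "u \<noteq> [] \<or> vs \<noteq> []"
  using that
proof (induction vs arbitrary: u)
  case Nil
  then show ?case by (intro module.span_base[OF module_tscale]) auto
next
  case (Cons v vs)
  let ?u = "\<lambda>b. u @ [(b, parity_part V b v)]"
  have "ten V (map snd u @ v # vs) = ten V (map snd (?u False) @ vs) + ten V (map snd (?u True) @ vs)"
  proof
    fix M :: "'v list \<Rightarrow> 'k"
    have "M (map snd u @ v # vs) =
        M (map snd u @ (scl V 1 (parity_part V False v) + parity_part V True v) # vs)"
      by (simp add: parity_part_sum)
    also have "multilin V M \<Longrightarrow> \<dots> = M (map snd u @ parity_part V False v # vs) +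
        M (map snd u @ parity_part V True v # vs)"
      by (simp only: multilin_def mult_1_left)
    finally show "ten V (map snd u @ v # vs) M =
        (ten V (map snd (?u False) @ vs) + ten V (map snd (?u True) @ vs)) M"
      by (simp add: ten_def)
  qed
  moreover have "ten V (map snd (?u b) @ vs) \<in>
      module.span tscale {ten V (map snd w) |w. w \<noteq> [] \<and> set w \<subseteq> pure}" for b
    using Cons.prems by (intro Cons.IH) (auto simp: pure_parity_part)
  ultimately show ?case
    by (simp only: module.span_add[OF module_tscale])
qed

lemma Tbar_eq_pure_span:
  "Tbar V = module.span tscale {ten V (map snd w) |w. w \<noteq> [] \<and> set w \<subseteq> pure}"
proof
  show "Tbar V \<subseteq> module.span tscale {ten V (map snd w) |w. w \<noteq> [] \<and> set w \<subseteq> pure}"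
    unfolding Tbar_def
    using ten_in_pure_span[of "[]"]
    by (intro module.span_minimal[OF module_tscale] module.subspace_span[OF module_tscale]) auto
  show "module.span tscale {ten V (map snd w) |w. w \<noteq> [] \<and> set w \<subseteq> pure} \<subseteq> Tbar V"
    unfolding Tbar_def by (intro module.span_mono[OF module_tscale]) auto
qed

lemma Tbar_pure_induct [consumes 1, case_names zero step]:
  assumes "x \<in> Tbar V" and "P 0"
    and "\<And>c u x. u \<noteq> [] \<Longrightarrow> set u \<subseteq> pure \<Longrightarrow> x \<in> Tbar V \<Longrightarrow> P x \<Longrightarrow>
      P (tscale c (ten V (map snd u)) + x)"
  shows "P x"
proof -
  interpret T: module tscale by (rule module_tscale)
  have "x \<in> Tbar V \<and> P x"
    using assms(1) unfolding Tbar_eq_pure_span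
  proof (induction rule: T.span_induct_alt)
    case base
    show ?case using assms(2) T.span_zero by blast
  next
    case (step c y z)
    then obtain w where y: "y = ten V (map snd w)" "w \<noteq> []" "set w \<subseteq> pure" by blast
    show ?case
      using assms(3)[OF y(2,3), of z c] step unfolding Tbar_eq_pure_span y(1)
      by (blast intro: T.span_add T.span_scale T.span_base)
  qed
  then show ?thesis ..
qed

text \<open>Bilinear identities on the tensor coalgebra may be checked on words of pure letters.\<close>
lemma Tbar_bilinear_eqI:
  fixes D :: "('k, 'v) tens \<Rightarrow> ('k, 'v) tens \<Rightarrow> ('m \<Rightarrow> 'k)"
  assumes x: "x \<in> Tbar V" and y: "y \<in> Tbar V"
    and left: "\<And>c x1 x2 y. x1 \<in> Tbar V \<Longrightarrow> x2 \<in> Tbar V \<Longrightarrow> y \<in> Tbar V \<Longrightarrow>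
      D (tscale c x1 + x2) y = tscale c (D x1 y) + D x2 y"
    and right: "\<And>c x y1 y2. x \<in> Tbar V \<Longrightarrow> y1 \<in> Tbar V \<Longrightarrow> y2 \<in> Tbar V \<Longrightarrow>
      D x (tscale c y1 + y2) = tscale c (D x y1) + D x y2"
    and pure: "\<And>u w. u \<noteq> [] \<Longrightarrow> w \<noteq> [] \<Longrightarrow> set u \<subseteq> pure \<Longrightarrow> set w \<subseteq> pure \<Longrightarrow>
      D (ten V (map snd u)) (ten V (map snd w)) = 0"
  shows "D x y = 0"
proof -
  have zero: "0 \<in> Tbar V" unfolding Tbar_def by (rule module.span_zero[OF module_tscale])
  have scale0: "tscale c (0 :: 'y \<Rightarrow> 'k) = 0" for c by (auto simp: fun_eq_iff)
  have cancel: "d = 0" if "d = tscale (- 1) d + d" for d :: "'m \<Rightarrow> 'k"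
  proof
    fix m
    from fun_cong[OF that, of m] show "d m = 0 m" by simp
  qed
  have scale0': "tscale (- 1) (0 :: ('k, 'v) tens) + 0 = 0" "tscale c (0 :: 'm \<Rightarrow> 'k) + 0 = 0" for c
    by (auto simp: fun_eq_iff)
  have words: "D (ten V (map snd u)) y = 0" if u: "u \<noteq> []" "set u \<subseteq> pure" for u
  proof -
    have x: "ten V (map snd u) \<in> Tbar V" using u by (intro ten_in_Tbar) simp
    show ?thesis
      using y
    proof (induction rule: Tbar_pure_induct)
      case zero
      show ?case
        by (rule cancel) (use right[OF x \<open>0 \<in> Tbar V\<close> \<open>0 \<in> Tbar V\<close>, of "-1"] in \<open>simp only: scale0'\<close>)
    next
      case (step c w z)
      have "ten V (map snd w) \<in> Tbar V" using step by (intro ten_in_Tbar) simp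
      from right[OF x this step(3), of c] pure[OF u(1) step(1) u(2) step(2)] step(4)
      show ?case by (simp only: scale0')
    qed
  qed
  show ?thesis
    using x
  proof (induction rule: Tbar_pure_induct)
    case zero
    show ?case
      by (rule cancel) (use left[OF \<open>0 \<in> Tbar V\<close> \<open>0 \<in> Tbar V\<close> y, of "-1"] in \<open>simp only: scale0'\<close>)
  next
    case (step c u z)
    have "ten V (map snd u) \<in> Tbar V" using step by (intro ten_in_Tbar) simp
    from left[OF this step(3) y, of c] words[OF step(1,2)] step(4)
    show ?case by (simp only: scale0')
  qed
qed

lemma multilin_dual:
  assumes g: "dual_to V' V g S" and "\<And>us. multilin V (B us)" "\<And>ws. multilin U (\<lambda>us. B us ws)"
  shows "multilin U (\<lambda>us. S (B us) ws)"
  unfolding multilin_def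
proof (intro allI)
  fix us vs c a b
  have "B (us @ (scl U c a + b) # vs) = (\<lambda>w. c * B (us @ a # vs) w + B (us @ b # vs) w)"
    using assms(3) by (simp add: multilin_def fun_eq_iff)
  then show "S (B (us @ (scl U c a + b) # vs)) ws = c * S (B (us @ a # vs)) ws + S (B (us @ b # vs)) ws"
    by (simp add: dual_toD(4)[OF g])
qed

text \<open>The shuffle product of two images, evaluated through the dual operators.\<close>
lemma shuffle_prod_dual:
  assumes f: "dual_to U V f T" and g: "dual_to U' V g S" and M: "multilin V M"
    and ne: "us \<noteq> []" "ws \<noteq> []"
  shows "shuffle_prod V (f (ten U us)) (g (ten U' ws)) M = T (\<lambda>u. S (\<lambda>w. shuffle_words V u w M) ws) us"
proof -
  note SW = multilin_shuffle_words[OF M]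
  have "shuffle_prod V (f (ten U us)) (g (ten U' ws)) M =
      f (ten U us) (\<lambda>u. S (\<lambda>w. shuffle_words V u w M) ws)"
    using M SW dual_toD(1)[OF g ne(2)] by (simp add: shuffle_prod_def)
  also have "\<dots> = T (\<lambda>u. S (\<lambda>w. shuffle_words V u w M) ws) us"
    using dual_toD(1)[OF f ne(1)] multilin_dual[OF g SW(2) SW(1)] by simp
  finally show ?thesis .
qed

end

lemma comorph_cong_letters:
  assumes "\<And>ws. set ws \<subseteq> P \<Longrightarrow> M ws = N ws"
    and "\<And>x. x \<noteq> [] \<Longrightarrow> set x \<subseteq> set u \<Longrightarrow> f x \<in> P"
  shows "comorph f M u = comorph f N u"
  unfolding comorph_def
proof (intro sum.cong refl assms(1))
  fix bs assume "bs \<in> blocks u"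
  then have "concat bs = u" "[] \<notin> set bs" by (auto simp: blocks_def)
  then have "b \<noteq> [] \<and> set b \<subseteq> set u" if "b \<in> set bs" for b using that by auto
  then show "set (map f bs) \<subseteq> P" using assms(2) by auto
qed

lemma coder_cong_letters:
  assumes "\<And>ws. set ws \<subseteq> P \<Longrightarrow> M ws = N ws"
    and "\<And>x. x \<noteq> [] \<Longrightarrow> set x \<subseteq> P \<Longrightarrow> q x \<in> P" "\<And>a. a \<in> P \<Longrightarrow> s a \<in> P" "set u \<subseteq> P"
  shows "coder s q M u = coder s q N u"
  using assms(1,4)
proof (induction u arbitrary: M N)
  case (Cons a u)
  have "splits (\<lambda>x y. if x = [] then 0 else M (q x # y)) (a # u) =
      splits (\<lambda>x y. if x = [] then 0 else N (q x # y)) (a # u)"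
  proof (intro splits_cong if_cong refl Cons.prems(1))
    fix x y assume "x @ y = a # u" "x \<noteq> []"
    then have "set x \<subseteq> P" "set y \<subseteq> P" using Cons.prems(2) by (metis Un_subset_iff set_append)+
    with assms(2)[of x] \<open>x \<noteq> []\<close> show "set (q x # y) \<subseteq> P" by simp
  qed
  moreover have "coder s q (\<lambda>ws. M (s a # ws)) u = coder s q (\<lambda>ws. N (s a # ws)) u"
    using Cons.prems assms(3) by (intro Cons.IH) auto
  ultimately show ?case by simp
qed simp

lemma comorph_of_linear:
  "comorph_of W f (tscale c x + y) = tscale c (comorph_of W f x) + comorph_of W f y"
  by (auto simp: comorph_of_apply fun_eq_iff)

lemma coder_of_linear:
  "coder_of W f (tscale c x + y) = tscale c (coder_of W f x) + coder_of W f y"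
  by (auto simp: coder_of_apply fun_eq_iff)

lemma tsgn_linear:
  "tsgn W (tscale c x + y) = tscale c (tsgn W x) + tsgn W y"
  by (auto simp: tsgn_apply fun_eq_iff)

lemma (in graded) tsgn_ten: "tsgn V (ten V vs) = ten V (map (sgn_map V) vs)"
proof
  fix M
  show "tsgn V (ten V vs) M = ten V (map (sgn_map V) vs) M"
    using dual_toD(2)[OF dual_to_tsgn, of M] by (simp add: tsgn_apply ten_def)
qed

lemma (in graded) tsgn_Tbar:
  assumes "x \<in> Tbar V"
  shows "tsgn V x \<in> Tbar V"
  using assms
proof (induction rule: Tbar_induct)
  case zero
  have "tsgn V 0 = 0" by (auto simp: tsgn_apply fun_eq_iff)
  then show ?case unfolding Tbar_def by (simp only: module.span_zero[OF module_tscale])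
next
  case (step c vs x)
  then have "ten V (map (sgn_map V) vs) \<in> Tbar V" by (intro ten_in_Tbar) simp
  with step(3) show ?case
    unfolding tsgn_linear tsgn_ten Tbar_def
    by (intro module.span_add[OF module_tscale] module.span_scale[OF module_tscale])
qed

text \<open>Reduction to words of pure letters, where \<open>shuffle_comorph\<close> applies.\<close>
lemma comorph_of_shuffle_prod:
  assumes V: "graded_vs V" and W: "graded_vs W" and f: "mlin (scl V) (scl W) f"
    and F: "comorph_of W f ` Tbar V \<subseteq> Tbar W"
    and parity: "\<And>x. x \<noteq> [] \<Longrightarrow> set x \<subseteq> graded.pure V \<Longrightarrow> tag_comorph f x \<in> graded.pure W"
    and kill: "\<And>u w. u \<noteq> [] \<Longrightarrow> w \<noteq> [] \<Longrightarrow> set u \<subseteq> graded.pure V \<Longrightarrow> set w \<subseteq> graded.pure V \<Longrightarrow> shuffle f u w = 0"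
    and x: "x \<in> Tbar V" and y: "y \<in> Tbar V"
  shows "comorph_of W f (shuffle_prod V x y) = shuffle_prod W (comorph_of W f x) (comorph_of W f y)"
proof -
  interpret V: graded V by standard (rule V)
  interpret W: graded W by standard (rule W)
  let ?F = "comorph_of W f"
  let ?D = "\<lambda>x y. ?F (shuffle_prod V x y) - shuffle_prod W (?F x) (?F y)"
  have FT: "?F x \<in> Tbar W" if "x \<in> Tbar V" for x using F that by blast
  have "?D x y = 0"
  proof (rule V.Tbar_bilinear_eqI[OF x y])
    fix c x1 x2 y
    show "?D (tscale c x1 + x2) y = tscale c (?D x1 y) + ?D x2 y"
      unfolding V.shuffle_prod_left comorph_of_linear W.shuffle_prod_left
      by (auto simp: fun_eq_iff algebra_simps)
  next
    fix c x y1 y2 assume "x \<in> Tbar V" "y1 \<in> Tbar V" "y2 \<in> Tbar V"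
    then have eqs: "shuffle_prod V x (tscale c y1 + y2) = tscale c (shuffle_prod V x y1) + shuffle_prod V x y2"
      "shuffle_prod W (?F x) (tscale c (?F y1) + ?F y2) =
        tscale c (shuffle_prod W (?F x) (?F y1)) + shuffle_prod W (?F x) (?F y2)"
      using FT by (blast intro: V.shuffle_prod_right W.shuffle_prod_right)+
    show "?D x (tscale c y1 + y2) = tscale c (?D x y1) + ?D x y2"
      unfolding comorph_of_linear eqs by (auto simp: fun_eq_iff algebra_simps)
  next
    fix u w assume uw: "u \<noteq> []" "w \<noteq> []" "set u \<subseteq> V.pure" "set w \<subseteq> V.pure"
    let ?u = "map snd u" and ?w = "map snd w"
    show "?D (ten V ?u) (ten V ?w) = 0"
    proof
      fix M
      show "?D (ten V ?u) (ten V ?w) M = 0 M"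
      proof (cases "multilin W M")
        case True
        note MV = multilin_comorph[OF f True]
        let ?S = "\<lambda>a b. shuffle_words W a b M"
        have "?F (shuffle_prod V (ten V ?u) (ten V ?w)) M = shuffle (comorph f M) u w"
          using uw True MV by (simp add: comorph_of_apply V.shuffle_prod_ten V.shuffle_words_eq_shuffle)
        also have "\<dots> = comorph (tag_comorph f) (\<lambda>u'. comorph (tag_comorph f) (shuffle M u') w) u"
          by (rule shuffle_comorph[OF W.multilin_multiadd[OF True] kill uw(3,4)])
        also have "\<dots> = comorph (tag_comorph f) (\<lambda>u'. comorph (tag_comorph f) (\<lambda>w'. ?S (map snd u') (map snd w')) w) u"
        proof (rule comorph_cong_letters[where P = W.pure])
          fix u' assume u': "set u' \<subseteq> W.pure"
          show "comorph (tag_comorph f) (shuffle M u') w = comorph (tag_comorph f) (\<lambda>w'. ?S (map snd u') (map snd w')) w"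
            using uw parity u' W.shuffle_words_eq_shuffle[OF True]
            by (intro comorph_cong_letters[where P = W.pure]) auto
        qed (use uw parity in auto)
        also have "\<dots> = comorph f (\<lambda>a. comorph f (?S a) ?w) ?u"
          using comorph_map_out[of "tag_comorph f" "?S _" snd w]
            comorph_map_out[of "tag_comorph f" "\<lambda>a. comorph f (?S a) ?w" snd u]
          by (simp add: comorph_map)
        also have "\<dots> = shuffle_prod W (?F (ten V ?u)) (?F (ten V ?w)) M"
          using uw by (subst W.shuffle_prod_dual[OF dual_to_comorph_of[OF f] dual_to_comorph_of[OF f] True]) simp_all
        finally show ?thesis by simp
      qed (simp add: comorph_of_apply shuffle_prod_def)
    qed
  qed
  then show ?thesis by simp
qed

text \<open>Reduction to words of pure letters, where \<open>shuffle_coder\<close> applies.\<close>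
lemma coder_of_shuffle_prod:
  assumes V: "graded_vs V" and q: "mlin (scl V) (scl V) q"
    and Q: "coder_of V q ` Tbar V \<subseteq> Tbar V"
    and parity: "\<And>x. x \<noteq> [] \<Longrightarrow> set x \<subseteq> graded.pure V \<Longrightarrow> tag_coder q x \<in> graded.pure V"
    and kill: "\<And>u w. u \<noteq> [] \<Longrightarrow> w \<noteq> [] \<Longrightarrow> set u \<subseteq> graded.pure V \<Longrightarrow> set w \<subseteq> graded.pure V \<Longrightarrow> shuffle q u w = 0"
    and x: "x \<in> Tbar V" and y: "y \<in> Tbar V"
  shows "coder_of V q (shuffle_prod V x y) =
    shuffle_prod V (coder_of V q x) y + shuffle_prod V (tsgn V x) (coder_of V q y)"
proof -
  interpret V: graded V by standard (rule V)
  let ?Q = "coder_of V q"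
  let ?D = "\<lambda>x y. ?Q (shuffle_prod V x y) - (shuffle_prod V (?Q x) y + shuffle_prod V (tsgn V x) (?Q y))"
  have QT: "?Q x \<in> Tbar V" if "x \<in> Tbar V" for x using Q that by blast
  have ST: "tsgn V x \<in> Tbar V" if "x \<in> Tbar V" for x using that by (rule V.tsgn_Tbar)
  have "?D x y = 0"
  proof (rule V.Tbar_bilinear_eqI[OF x y])
    fix c x1 x2 y
    show "?D (tscale c x1 + x2) y = tscale c (?D x1 y) + ?D x2 y"
      unfolding V.shuffle_prod_left coder_of_linear tsgn_linear
      by (auto simp: fun_eq_iff algebra_simps)
  next
    fix c x y1 y2 assume "x \<in> Tbar V" "y1 \<in> Tbar V" "y2 \<in> Tbar V"
    then have eqs: "shuffle_prod V x (tscale c y1 + y2) = tscale c (shuffle_prod V x y1) + shuffle_prod V x y2"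
      "shuffle_prod V (?Q x) (tscale c y1 + y2) =
        tscale c (shuffle_prod V (?Q x) y1) + shuffle_prod V (?Q x) y2"
      "shuffle_prod V (tsgn V x) (tscale c (?Q y1) + ?Q y2) =
        tscale c (shuffle_prod V (tsgn V x) (?Q y1)) + shuffle_prod V (tsgn V x) (?Q y2)"
      using QT ST by (blast intro: V.shuffle_prod_right)+
    show "?D x (tscale c y1 + y2) = tscale c (?D x y1) + ?D x y2"
      unfolding coder_of_linear eqs by (auto simp: fun_eq_iff algebra_simps)
  next
    fix u w assume uw: "u \<noteq> []" "w \<noteq> []" "set u \<subseteq> V.pure" "set w \<subseteq> V.pure"
    let ?u = "map snd u" and ?w = "map snd w"
    let ?s = "sgn_map V"
    let ?C = "coder (tag_sgn ?s) (tag_coder q)"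
    show "?D (ten V ?u) (ten V ?w) = 0"
    proof
      fix M
      show "?D (ten V ?u) (ten V ?w) M = 0 M"
      proof (cases "multilin V M")
        case True
        note MV = V.multilin_coder[OF q True]
        let ?S = "\<lambda>a b. shuffle_words V a b M"
        have sgn_pure: "tag_sgn ?s a \<in> V.pure" if "a \<in> V.pure" for a
          using V.sgn_map_pure[OF that] that Modules.additive.minus[OF V.parity_part_additive]
          by (auto simp: V.pure_def signed_def)
        have coder_map_snd: "coder ?s q N (map snd v) = ?C (\<lambda>v'. N (map snd v')) v" for N :: "_ \<Rightarrow> 'a" and v
          by (rule coder_map) simp_all
        have "?Q (shuffle_prod V (ten V ?u) (ten V ?w)) M = shuffle (coder ?s q M) u w"
          using uw True MV by (simp add: coder_of_apply V.shuffle_prod_ten V.shuffle_words_eq_shuffle)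
        also have "\<dots> = ?C (\<lambda>u'. shuffle M u' w) u + ?C (shuffle M (map (tag_sgn ?s) u)) w"
          by (rule shuffle_coder[OF V.multilin_multiadd[OF True] kill V.sgn_map_pure uw(3,4)])
        also have "?C (\<lambda>u'. shuffle M u' w) u = ?C (\<lambda>u'. ?S (map snd u') ?w) u"
          using uw parity sgn_pure V.shuffle_words_eq_shuffle[OF True]
          by (intro coder_cong_letters[where P = V.pure]) auto
        also have "\<dots> = shuffle_prod V (?Q (ten V ?u)) (ten V ?w) M"
          using uw V.shuffle_prod_dual[OF V.dual_to_coder_of[OF q] V.dual_to_id True, of ?u ?w]
          by (simp add: coder_map_snd)
        also have "?C (shuffle M (map (tag_sgn ?s) u)) w = ?C (\<lambda>w'. ?S (map ?s ?u) (map snd w')) w"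
        proof (rule coder_cong_letters[where P = V.pure])
          fix w' assume "set w' \<subseteq> V.pure"
          moreover have "set (map (tag_sgn ?s) u) \<subseteq> V.pure" using uw sgn_pure by auto
          moreover have "map snd (map (tag_sgn ?s) u) = map ?s ?u" by simp
          ultimately show "shuffle M (map (tag_sgn ?s) u) w' = ?S (map ?s ?u) (map snd w')"
            using V.shuffle_words_eq_shuffle[OF True] by metis
        qed (use uw parity sgn_pure in auto)
        also have "\<dots> = shuffle_prod V (tsgn V (ten V ?u)) (?Q (ten V ?w)) M"
          using uw V.shuffle_prod_dual[OF V.dual_to_tsgn V.dual_to_coder_of[OF q] True, of ?u ?w]
          by (simp add: coder_map_snd)
        finally show ?thesis by simp
      qed (simp add: coder_of_apply shuffle_prod_def)
    qed
  qed
  then show ?thesis by simp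
qed

section \<open>Transfer along surjections; forms as a commutative algebra\<close>

text \<open>A decomposition with as many blocks as letters is the one into single letters.\<close>
lemma blocks_length_eq:
  assumes "bs \<in> blocks vs" "length bs = length vs"
  shows "bs = map (\<lambda>v. [v]) vs"
  using assms
proof (induction bs arbitrary: vs)
  case (Cons b bs)
  then have vs: "vs = b @ concat bs" "b \<noteq> []" "bs \<in> blocks (concat bs)"
    by (auto simp: blocks_def)
  with length_blocks[OF vs(3)] Cons.prems(2) have "length b = 1" "length bs = length (concat bs)"
    by (cases b; simp)+
  with vs Cons.IH[OF vs(3)] show ?case by (cases b) auto
qed (simp add: blocks_def)

lemma singles_in_blocks: "map (\<lambda>v. [v]) vs \<in> blocks vs"
  by (induction vs) (auto simp: blocks_def)

text \<open>By induction on the length: up to shorter words, a word \<open>f [v\<^sub>1], \<dots>, f [v\<^sub>n]\<close> is the image of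
  \<open>v\<^sub>1, \<dots>, v\<^sub>n\<close>, since every other decomposition has fewer blocks.\<close>
lemma comorph_of_surj:
  assumes f: "mlin (scl V) (scl W) f" and surj: "\<And>w. \<exists>v. f [v] = w" and x: "x \<in> Tbar W"
  shows "x \<in> comorph_of W f ` Tbar V"
proof -
  interpret T: module tscale by (rule module_tscale)
  let ?F = "comorph_of W f"
  have sub: "T.subspace (?F ` Tbar V)"
  proof (rule T.subspaceI)
    have "?F 0 = 0" by (auto simp: comorph_of_apply fun_eq_iff)
    then show "0 \<in> ?F ` Tbar V"
      unfolding Tbar_def by (metis T.span_zero imageI)
  next
    fix x y assume "x \<in> ?F ` Tbar V" "y \<in> ?F ` Tbar V"
    then obtain x' y' where xy: "x = ?F x'" "x' \<in> Tbar V" "y = ?F y'" "y' \<in> Tbar V" by blast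
    then have "x + y = ?F (x' + y')" by (auto simp: comorph_of_apply fun_eq_iff)
    moreover have "x' + y' \<in> Tbar V" using xy unfolding Tbar_def by (intro T.span_add)
    ultimately show "x + y \<in> ?F ` Tbar V" by blast
  next
    fix c x assume "x \<in> ?F ` Tbar V"
    then obtain x' where x: "x = ?F x'" "x' \<in> Tbar V" by blast
    then have "tscale c x = ?F (tscale c x')" by (auto simp: comorph_of_apply fun_eq_iff)
    moreover have "tscale c x' \<in> Tbar V" using x unfolding Tbar_def by (intro T.span_scale)
    ultimately show "tscale c x \<in> ?F ` Tbar V" by blast
  qed
  have words: "ten W ws \<in> ?F ` Tbar V" if "ws \<noteq> []" for ws
    using that
  proof (induction ws rule: length_induct)
    case (1 ws)
    obtain g where g: "\<And>w. f [g w] = w" using surj by metis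
    define vs where "vs = map g ws"
    have vs: "vs \<noteq> []" "length vs = length ws" "map (\<lambda>v. f [v]) vs = ws"
      using 1(2) by (simp_all add: vs_def g comp_def)
    let ?B = "blocks vs - {map (\<lambda>v. [v]) vs}"
    have rest: "(\<Sum>bs\<in>?B. ten W (map f bs)) \<in> ?F ` Tbar V"
    proof (rule T.subspace_sum[OF sub])
      fix bs assume bs: "bs \<in> ?B"
      then have "length bs \<le> length ws" "length bs \<noteq> length ws"
        using length_blocks[of bs vs] blocks_length_eq[of bs vs] vs(2) by auto
      then have "length bs < length ws" by simp
      moreover have "bs \<noteq> []" using blocks_nonempty[of bs vs] bs vs by blast
      ultimately show "ten W (map f bs) \<in> ?F ` Tbar V" using 1 by simp
    qed
    have "?F (ten V vs) = (\<Sum>bs\<in>blocks vs. ten W (map f bs))"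
      by (rule comorph_of_ten[OF f])
    also have "\<dots> = ten W (map f (map (\<lambda>v. [v]) vs)) + (\<Sum>bs\<in>?B. ten W (map f bs))"
      by (rule sum.remove) (auto simp: singles_in_blocks)
    also have "map f (map (\<lambda>v. [v]) vs) = ws" using vs(3) by (simp add: comp_def)
    finally have "ten W ws = ?F (ten V vs) - (\<Sum>bs\<in>?B. ten W (map f bs))"
      by (simp only: add_diff_cancel_right')
    moreover have "?F (ten V vs) \<in> ?F ` Tbar V" using vs(1) by (intro imageI ten_in_Tbar)
    ultimately show ?case using rest T.subspace_diff[OF sub] by metis
  qed
  have "Tbar W \<subseteq> ?F ` Tbar V"
    unfolding Tbar_def[of W] by (rule T.span_minimal[OF _ sub]) (use words in blast)
  with x show ?thesis by blast
qed

lemma comorph_of_tsgn: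
  assumes V: "graded_vs V" and W: "graded_vs W" and f: "mlin (scl V) (scl W) f"
    and s: "\<And>x. x \<noteq> [] \<Longrightarrow> f (map (sgn_map V) x) = sgn_map W (f x)"
  shows "comorph_of W f (tsgn V x) = tsgn W (comorph_of W f x)"
proof
  interpret W: graded W by standard (rule W)
  fix M
  show "comorph_of W f (tsgn V x) M = tsgn W (comorph_of W f x) M"
  proof (cases "multilin W M")
    case True
    have "comorph f M (map (sgn_map V) vs) = comorph f (\<lambda>ws. M (map (sgn_map W) ws)) vs" for vs
    proof -
      have "comorph (\<lambda>x. f (map (sgn_map V) x)) M vs = comorph (\<lambda>x. sgn_map W (f x)) M vs"
        unfolding comorph_def
      proof (intro sum.cong refl arg_cong[of _ _ M] map_cong)
        fix bs b assume "bs \<in> blocks vs" "b \<in> set bs"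
        then have "b \<noteq> []" by (auto simp: blocks_def)
        then show "f (map (sgn_map V) b) = sgn_map W (f b)" by (rule s)
      qed
      then show ?thesis by (simp add: comorph_map comorph_map_out)
    qed
    then have "(\<lambda>vs. comorph f M (map (sgn_map V) vs)) = comorph f (\<lambda>ws. M (map (sgn_map W) ws))"
      by (rule ext)
    with True multilin_comorph[OF f True] dual_toD(2)[OF W.dual_to_tsgn True] show ?thesis
      by (simp add: comorph_of_apply tsgn_apply)
  qed (simp add: comorph_of_apply tsgn_apply)
qed

text \<open>The axioms are identities between expressions in \<open>R\<close> and the shuffle product, so they pass to
  the target of a surjection that respects both structures.\<close>
lemma Cinf_algebra_image:
  assumes VQ: "Cinf_algebra V Q" and W: "graded_vs W" and R: "coderivation (susp W) R"
    and FV: "F ` Tbar (susp V) \<subseteq> Tbar (susp W)"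
    and surj: "Tbar (susp W) \<subseteq> F ` Tbar (susp V)"
    and F0: "F 0 = 0" and Fadd: "\<And>x y. F (x + y) = F x + F y"
    and FQ: "\<And>x. F (Q x) = R (F x)"
    and Fs: "\<And>x. F (tsgn (susp V) x) = tsgn (susp W) (F x)"
    and Fsh: "\<And>x y. x \<in> Tbar (susp V) \<Longrightarrow> y \<in> Tbar (susp V) \<Longrightarrow>
      F (shuffle_prod (susp V) x y) = shuffle_prod (susp W) (F x) (F y)"
    and sV: "\<And>x. x \<in> Tbar (susp V) \<Longrightarrow> tsgn (susp V) x \<in> Tbar (susp V)"
  shows "Cinf_algebra W R"
proof -
  have Q: "Q x \<in> Tbar (susp V)" if "x \<in> Tbar (susp V)" for x
    using VQ that unfolding Cinf_algebra_def Ainf_algebra_def coderivation_def tbar_linear_def by blast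
  have "R (R x) = 0" if x: "x \<in> Tbar (susp W)" for x
  proof -
    obtain x' where x': "x = F x'" "x' \<in> Tbar (susp V)" using surj x by blast
    then have "Q (Q x') = 0" using VQ by (simp add: Cinf_algebra_def Ainf_algebra_def)
    then show ?thesis using F0 by (simp only: x'(1) FQ[symmetric])
  qed
  moreover have "R (shuffle_prod (susp W) x y) =
      shuffle_prod (susp W) (R x) y + shuffle_prod (susp W) (tsgn (susp W) x) (R y)"
    if x: "x \<in> Tbar (susp W)" and y: "y \<in> Tbar (susp W)" for x y
  proof -
    obtain x' where x': "x = F x'" "x' \<in> Tbar (susp V)" using surj x by blast
    obtain y' where y': "y = F y'" "y' \<in> Tbar (susp V)" using surj y by blast
    have eq: "Q (shuffle_prod (susp V) x' y') =
        shuffle_prod (susp V) (Q x') y' + shuffle_prod (susp V) (tsgn (susp V) x') (Q y')"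
      using VQ x' y' by (simp add: Cinf_algebra_def)
    show ?thesis
      unfolding x'(1) y'(1) Fs[symmetric] FQ[symmetric]
        Fsh[OF x'(2) y'(2), symmetric] Fsh[OF Q[OF x'(2)] y'(2), symmetric]
        Fsh[OF sV[OF x'(2)] Q[OF y'(2)], symmetric] Fadd[symmetric] eq ..
  qed
  ultimately show ?thesis using W R by (simp add: Cinf_algebra_def Ainf_algebra_def)
qed


text \<open>The coefficients of the bar construction with the sign map as a parameter, so that \<open>Q\<^sup>2 = 0\<close>
  can be proved from the algebraic laws alone.\<close>
definition bar_taylor :: "('v \<Rightarrow> 'v) \<Rightarrow> ('v::ab_group_add \<Rightarrow> 'v) \<Rightarrow> ('v \<Rightarrow> 'v \<Rightarrow> 'v) \<Rightarrow> 'v list \<Rightarrow> 'v" where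
  "bar_taylor \<sigma> d m vs = (case vs of [a] \<Rightarrow> - d a | [a, b] \<Rightarrow> m (\<sigma> a) b | _ \<Rightarrow> 0)"

lemma dga_taylor_eq_bar: "dga_taylor V d m = bar_taylor (sgn_map V) d m"
  by (rule ext) (simp add: dga_taylor_def bar_taylor_def)

lemma bar_taylor_simps [simp]:
  "bar_taylor \<sigma> d m [a] = - d a"
  "bar_taylor \<sigma> d m [a, b] = m (\<sigma> a) b"
  "bar_taylor \<sigma> d m (a # b # c # vs) = 0"
  by (simp_all add: bar_taylor_def)

lemma coder_bar_taylor:
  assumes "multiadd M"
  shows "coder s (bar_taylor \<sigma> d m) M (v # u) = M (- d v # u) +
    (case u of [] \<Rightarrow> 0 | w # u' \<Rightarrow> M (m (\<sigma> v) w # u')) + coder s (bar_taylor \<sigma> d m) (\<lambda>ws. M (s v # ws)) u"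
proof -
  have "M (0 # y) = 0" for y using Modules.additive.zero[OF multiadd_head[OF assms]] .
  then have "splits (\<lambda>x y. M (bar_taylor \<sigma> d m (v # w # x) # y)) u' =
      splits (\<lambda>x y. if x = [] then M (m (\<sigma> v) w # y) else 0) u'" for w u'
    by (intro splits_cong) (auto simp: neq_Nil_conv)
  then show ?thesis by (cases u) (simp_all add: splits_left_Nil)
qed

lemma multiadd_Cons_case:
  assumes "\<And>ws. Modules.additive (\<lambda>v. h v ws)" "\<And>v. multiadd (h v)"
  shows "multiadd (\<lambda>ws. case ws of [] \<Rightarrow> 0 | w # ws' \<Rightarrow> h w ws')"
  unfolding multiadd_def
proof (intro allI)
  fix us ws
  show "Modules.additive (\<lambda>v. case us @ v # ws of [] \<Rightarrow> 0 | w # ws' \<Rightarrow> h w ws')"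
  proof (cases us)
    case Nil then show ?thesis using assms(1) by simp
  next
    case (Cons a us') then show ?thesis using assms(2) by (simp add: multiadd_def)
  qed
qed

lemma multiadd_coder:
  assumes q: "multiadd q" and s: "Modules.additive s" and M: "multiadd M"
  shows "multiadd (coder s q M)"
  unfolding multiadd_def
proof (intro allI)
  \<comment> \<open>Additivity is linearity over a trivial scalar action.\<close>
  let ?id = "\<lambda>(c::unit) x. x"
  have mlin: "mlin ?id ?id f" if "multiadd f" for f :: "'x::ab_group_add list \<Rightarrow> 'y::ab_group_add"
    using that by (simp add: mlin_def multiadd_def Modules.additive_def)
  have "mlin (\<lambda>(c::unit) x. x) (\<lambda>(c::unit) x. x) (coder s q M)"
    using mlin[OF q] mlin[OF M] s
    by (intro mlin_coder) (auto simp: Modules.additive_def mlin_def)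
  then show "Modules.additive (\<lambda>v. coder s q M (us @ v # ws))" for us ws
    by (simp add: mlin_def Modules.additive_def)
qed

text \<open>Applied to a word with first letter \<open>v\<close>, the square consists of terms that cancel in pairs: those
  with one operation away from \<open>v\<close>, by the sign \<open>s\<close>; those with both operations at \<open>v\<close>, by
  \<open>d\<^sup>2 = 0\<close>, the Leibniz rule and associativity; those away from \<open>v\<close> vanish by induction.\<close>
lemma coder_bar_taylor_square:
  fixes \<sigma> d :: "'v::ab_group_add \<Rightarrow> 'v" and M :: "'v list \<Rightarrow> 'b::ab_group_add"
  assumes M: "multiadd M"
    and q: "multiadd (bar_taylor \<sigma> d m)" and add: "Modules.additive \<sigma>" "Modules.additive d"
      "\<And>b. Modules.additive (\<lambda>a. m a b)" "\<And>a. Modules.additive (m a)"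
    and s: "\<And>v. s v = - \<sigma> v"
    and dd: "\<And>v. d (d v) = 0" and ss: "\<And>v. \<sigma> (\<sigma> v) = v" and sd: "\<And>v. \<sigma> (d v) = - d (\<sigma> v)"
    and sm: "\<And>v w. \<sigma> (m v w) = m (\<sigma> v) (\<sigma> w)"
    and assoc: "\<And>u v w. m (m u v) w = m u (m v w)"
    and leibniz: "\<And>v w. d (m v w) = m (d v) w + m (\<sigma> v) (d w)"
  shows "coder s (bar_taylor \<sigma> d m) (coder s (bar_taylor \<sigma> d m) M) vs = 0"
  using M
proof (induction vs arbitrary: M)
  case (Cons v u M)
  let ?D = "coder s (bar_taylor \<sigma> d m)"
  note minus = Modules.additive.minus[OF add(1)] Modules.additive.minus[OF add(2)]
    Modules.additive.minus[OF add(3)] Modules.additive.minus[OF add(4)]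
  have s_add: "Modules.additive s" using add(1) by (simp add: Modules.additive_def s)
  have D_add: "multiadd (?D M)" if "multiadd M" for M :: "'v list \<Rightarrow> 'b"
    using multiadd_coder[OF q s_add that] .
  have M0: "M (0 # y) = 0" and Mneg: "M (- x # y) = - M (x # y)" and Madd: "M (x # y) + M (x' # y) = M ((x + x') # y)" for x x' y
    using Modules.additive.zero[OF multiadd_head[OF Cons.prems]] Modules.additive.minus[OF multiadd_head[OF Cons.prems]]
      Modules.additive.add[OF multiadd_head[OF Cons.prems]] by auto
  show ?case
  proof (cases u)
    case Nil
    show ?thesis
      unfolding Nil coder_bar_taylor[OF D_add[OF Cons.prems]] coder_bar_taylor[OF Cons.prems]
      by (simp add: minus dd M0)
  next
    case (Cons w u')
    let ?N = "\<lambda>ws. case ws of [] \<Rightarrow> 0 | x # ws' \<Rightarrow> M (m (\<sigma> (s v)) x # ws')"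
    have N: "multiadd ?N"
      using Cons.prems add(4) multiadd_head[OF Cons.prems]
      by (intro multiadd_Cons_case multiadd_Cons) (auto simp: Modules.additive_def)
    have inner: "?D M (s v # ws) = M (- d (s v) # ws) + ?N ws + ?D (\<lambda>ws. M (v # ws)) ws" for ws
      unfolding coder_bar_taylor[OF Cons.prems] by (simp add: s ss minus)
    have neg: "?D (\<lambda>ws. M (- x # ws)) y = - ?D (\<lambda>ws. M (x # ws)) y" for x y
      unfolding Mneg by (rule coder_additive[of uminus, symmetric]) (simp add: Modules.additive_def)
    have T3: "?D (\<lambda>ws. ?D M (s v # ws)) u =
        ?D (\<lambda>ws. M (- d (s v) # ws)) u + ?D ?N u"
      unfolding inner coder_add using Cons.IH[OF multiadd_Cons[OF Cons.prems]] by simp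
    have T3': "?D ?N u = M (m (\<sigma> (s v)) (- d w) # u') +
        (case u' of [] \<Rightarrow> 0 | x # u'' \<Rightarrow> M (m (\<sigma> (s v)) (m (\<sigma> w) x) # u'')) +
        ?D (\<lambda>ws. M (m (\<sigma> (s v)) (s w) # ws)) u'"
      unfolding Cons coder_bar_taylor[OF N] by (simp split: list.splits)
    have T12: "?D (?D M) (v # u) = ?D M (- d v # u) + ?D M (m (\<sigma> v) w # u') + ?D (\<lambda>ws. ?D M (s v # ws)) u"
      unfolding coder_bar_taylor[OF D_add[OF Cons.prems]] Cons by simp
    have T1: "?D M (- d v # u) = M (m (\<sigma> (- d v)) w # u') + ?D (\<lambda>ws. M (s (- d v) # ws)) u"
      unfolding coder_bar_taylor[OF Cons.prems] Cons by (simp add: minus dd M0)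
    have T2: "?D M (m (\<sigma> v) w # u') = M (- d (m (\<sigma> v) w) # u') +
        (case u' of [] \<Rightarrow> 0 | x # u'' \<Rightarrow> M (m (\<sigma> (m (\<sigma> v) w)) x # u'')) + ?D (\<lambda>ws. M (s (m (\<sigma> v) w) # ws)) u'"
      unfolding coder_bar_taylor[OF Cons.prems] by simp
    have c1: "?D (\<lambda>ws. M (s (- d v) # ws)) u + ?D (\<lambda>ws. M (- d (s v) # ws)) u = 0"
      unfolding neg by (simp add: s minus sd neg)
    have c2: "?D (\<lambda>ws. M (s (m (\<sigma> v) w) # ws)) u' + ?D (\<lambda>ws. M (m (\<sigma> (s v)) (s w) # ws)) u' = 0"
      by (simp add: s minus sm ss neg)
    have c3: "M (m (\<sigma> (- d v)) w # u') + (M (- d (m (\<sigma> v) w) # u') + M (m (\<sigma> (s v)) (- d w) # u')) = 0"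
      unfolding Madd by (simp add: s minus sd ss leibniz M0)
    have c4: "(case u' of [] \<Rightarrow> 0 | x # u'' \<Rightarrow> M (m (\<sigma> (m (\<sigma> v) w)) x # u'')) +
        (case u' of [] \<Rightarrow> 0 | x # u'' \<Rightarrow> M (m (\<sigma> (s v)) (m (\<sigma> w) x) # u'')) = 0"
      by (cases u') (simp_all add: s minus sm ss assoc Mneg)
    have "?D (?D M) (v # u) =
        (?D (\<lambda>ws. M (s (- d v) # ws)) u + ?D (\<lambda>ws. M (- d (s v) # ws)) u) +
        (?D (\<lambda>ws. M (s (m (\<sigma> v) w) # ws)) u' + ?D (\<lambda>ws. M (m (\<sigma> (s v)) (s w) # ws)) u') +
        (M (m (\<sigma> (- d v)) w # u') + (M (- d (m (\<sigma> v) w) # u') + M (m (\<sigma> (s v)) (- d w) # u'))) +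
        ((case u' of [] \<Rightarrow> 0 | x # u'' \<Rightarrow> M (m (\<sigma> (m (\<sigma> v) w)) x # u'')) +
        (case u' of [] \<Rightarrow> 0 | x # u'' \<Rightarrow> M (m (\<sigma> (s v)) (m (\<sigma> w) x) # u'')))"
      unfolding T12 T1 T2 T3 T3' by (simp only: ac_simps)
    then show ?thesis unfolding c1 c2 c3 c4 by simp
  qed
qed simp


text \<open>The data that determine the dg algebra of forms \<open>f + a dt\<close>.\<close>
locale diff_alg = vector_space s
  for s :: "'k::field_char_0 \<Rightarrow> 'a::comm_ring \<Rightarrow> 'a" +
  fixes D :: "'a \<Rightarrow> 'a"
  assumes s_mult: "s c f * g = s c (f * g)"
    and D_linear: "D (s c f + g) = s c (D f) + D g"
    and D_mult: "D (f * g) = D f * g + f * D g"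
begin

lemma D_add: "D (f + g) = D f + D g" using D_linear[of 1] by simp
lemma D_0 [simp]: "D 0 = 0" using D_add[of 0 0] by simp
lemma D_minus: "D (- f) = - D f" using D_add[of f "- f"] by (simp add: eq_neg_iff_add_eq_0 add.commute)
lemma mult_s: "g * s c f = s c (g * f)" using s_mult[of c f g] by (simp add: mult.commute)

lemma scl_forms [simp]: "scl (forms_gvs s) c (f, a) = (s c f, s c a)"
  "scl (susp (forms_gvs s)) c (f, a) = (s c f, s c a)"
  by (simp_all add: forms_gvs_def susp_def)

lemma graded_forms: "graded_vs (forms_gvs s)"
  unfolding graded_vs_def
proof (intro conjI allI)
  show "vector_space (scl (forms_gvs s))"
    by standard (auto simp: forms_gvs_def scale_right_distrib scale_left_distrib)
  then interpret F: vector_space "scl (forms_gvs s)" .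
  fix i :: int
  show "Vector_Spaces.linear (scl (forms_gvs s)) (scl (forms_gvs s)) (cmp (forms_gvs s) i)"
    by standard (auto simp: forms_gvs_def zero_prod_def)
  show "cmp (forms_gvs s) i (cmp (forms_gvs s) j v) = (if i = j then cmp (forms_gvs s) j v else 0)" for j v
    by (auto simp: forms_gvs_def zero_prod_def split_def)
  fix v :: "'a form"
  have sub: "{i. cmp (forms_gvs s) i v \<noteq> 0} \<subseteq> {0, 1}"
    by (auto simp: forms_gvs_def split_def split: if_splits)
  then show "finite {i. cmp (forms_gvs s) i v \<noteq> 0}" by (rule finite_subset) simp
  have "(\<Sum>i | cmp (forms_gvs s) i v \<noteq> 0. cmp (forms_gvs s) i v) = (\<Sum>i\<in>{0, 1}. cmp (forms_gvs s) i v)"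
    using sub by (intro sum.mono_neutral_left) auto
  then show "v = (\<Sum>i | cmp (forms_gvs s) i v \<noteq> 0. cmp (forms_gvs s) i v)"
    by (cases v) (simp add: forms_gvs_def)
qed

lemma graded_susp_forms: "graded_vs (susp (forms_gvs s))"
  by (rule graded_susp[OF graded_forms])

lemma parity_part_forms:
  "parity_part (forms_gvs s) b (f, a) = (if b then (0, a) else (f, 0))"
  "parity_part (susp (forms_gvs s)) b (f, a) = (if b then (f, 0) else (0, a))"
proof -
  interpret V: graded "forms_gvs s" by standard (rule graded_forms)
  interpret W: graded "susp (forms_gvs s)" by standard (rule graded_susp_forms)
  have "parity_part (forms_gvs s) b (f, a) = (\<Sum>i\<in>{0, 1}. if odd i = b then cmp (forms_gvs s) i (f, a) else 0)"
    by (rule V.parity_part_eq) (auto simp: forms_gvs_def split: if_splits)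
  then show "parity_part (forms_gvs s) b (f, a) = (if b then (0, a) else (f, 0))"
    by (cases b) (simp_all add: forms_gvs_def)
  have "parity_part (susp (forms_gvs s)) b (f, a) =
      (\<Sum>i\<in>{-1, 0}. if odd i = b then cmp (susp (forms_gvs s)) i (f, a) else 0)"
    by (rule W.parity_part_eq) (auto simp: forms_gvs_def susp_def split: if_splits)
  then show "parity_part (susp (forms_gvs s)) b (f, a) = (if b then (f, 0) else (0, a))"
    by (cases b) (simp_all add: forms_gvs_def susp_def)
qed

lemma sgn_map_forms:
  "sgn_map (forms_gvs s) (f, a) = (f, - a)" "sgn_map (susp (forms_gvs s)) (f, a) = (- f, a)"
  by (simp_all add: sgn_map_def parity_part_forms)

lemma homogeneous_susp_forms:
  "homogeneous (susp (forms_gvs s)) i (f, a) \<longleftrightarrow> (i \<noteq> - 1 \<longrightarrow> f = 0) \<and> (i \<noteq> 0 \<longrightarrow> a = 0)"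
  by (auto simp: homogeneous_def susp_def forms_gvs_def zero_prod_def)

lemma pure_susp_forms: "graded.pure (susp (forms_gvs s)) = {(b, (f, a)). if b then a = 0 else f = 0}"
proof -
  interpret W: graded "susp (forms_gvs s)" by standard (rule graded_susp_forms)
  show ?thesis by (auto simp: W.pure_def parity_part_forms split: if_splits)
qed

abbreviation forms_taylor :: "'a form list \<Rightarrow> 'a form" where
  "forms_taylor \<equiv> dga_taylor (forms_gvs s) (form_d D) form_mult"

lemma forms_taylor_simps [simp]:
  "forms_taylor [(f, a)] = (0, - D f)"
  "forms_taylor [(f, a), (g, b)] = (f * g, f * b - a * g)"
  "forms_taylor (v # w # x # vs) = 0"
  by (simp_all add: dga_taylor_def form_d_def form_mult_def sgn_map_forms)

lemma mlin_forms_taylor: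
  "mlin (scl (susp (forms_gvs s))) (scl (susp (forms_gvs s))) forms_taylor"
  unfolding mlin_def
proof (intro allI)
  fix us ws :: "'a form list" and c x y
  consider "us = []" "ws = []" | w where "us = []" "ws = [w]" | w w' ws' where "us = []" "ws = w # w' # ws'"
    | u where "us = [u]" "ws = []" | u w ws' where "us = [u]" "ws = w # ws'" | u u' us' where "us = u # u' # us'"
    by (metis neq_Nil_conv)
  then show "forms_taylor (us @ (scl (susp (forms_gvs s)) c x + y) # ws) =
    scl (susp (forms_gvs s)) c (forms_taylor (us @ x # ws)) + forms_taylor (us @ y # ws)"
  proof cases
    case 1
    then show ?thesis by (cases x; cases y) (simp add: D_linear)
  next
    case (2 w)
    then show ?thesis by (cases x; cases y; cases w) (simp add: s_mult mult_s algebra_simps)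
  next
    case (4 u)
    then show ?thesis by (cases x; cases y; cases u) (simp add: s_mult mult_s algebra_simps)
  next
    case (6 u u' us')
    then show ?thesis by (cases us') (simp_all add: zero_prod_def)
  qed (simp_all add: zero_prod_def)
qed

lemma forms_taylor_degree:
  assumes "vs \<noteq> []" "list_all2 (homogeneous (susp (forms_gvs s))) ds vs"
  shows "homogeneous (susp (forms_gvs s)) (sum_list ds + 1) (forms_taylor vs)"
proof -
  consider f a where "vs = [(f, a)]" | f a g b where "vs = [(f, a), (g, b)]" | u v w vs' where "vs = u # v # w # vs'"
    using assms(1) by (metis neq_Nil_conv surj_pair)
  then show ?thesis
  proof cases
    case (2 f a g b)
    then obtain d e where "ds = [d, e]" "homogeneous (susp (forms_gvs s)) d (f, a)"
        "homogeneous (susp (forms_gvs s)) e (g, b)"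
      using assms(2) by (auto simp: list_all2_Cons2)
    with 2 show ?thesis
      by (cases "d = -1"; cases "d = 0"; cases "e = -1"; cases "e = 0") (auto simp: homogeneous_susp_forms)
  qed (use assms(2) in \<open>auto simp: list_all2_Cons2 homogeneous_susp_forms zero_prod_def\<close>)
qed

lemma forms_taylor_parity:
  assumes "x \<noteq> []" "set x \<subseteq> graded.pure (susp (forms_gvs s))"
  shows "tag_coder forms_taylor x \<in> graded.pure (susp (forms_gvs s))"
proof -
  consider b f a where "x = [(b, (f, a))]" | b f a b' g a' where "x = [(b, (f, a)), (b', (g, a'))]"
    | u v w x' where "x = u # v # w # x'"
    using assms(1) by (metis neq_Nil_conv surj_pair)
  then show ?thesis
    using assms(2) by cases (auto simp: tag_coder_def pure_susp_forms zero_prod_def split: if_splits)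
qed

text \<open>Only the shuffle of two letters meets a nonzero coefficient; there it is graded commutativity.\<close>
lemma forms_taylor_kills_shuffles:
  assumes "u \<noteq> []" "w \<noteq> []" "set u \<subseteq> graded.pure (susp (forms_gvs s))"
    "set w \<subseteq> graded.pure (susp (forms_gvs s))"
  shows "shuffle forms_taylor u w = 0"
proof (cases "length u = 1 \<and> length w = 1")
  case True
  then obtain b f a b' g a' where "u = [(b, (f, a))]" "w = [(b', (g, a'))]"
    by (auto simp: length_Suc_conv)
  with assms(3,4) show ?thesis
    by (auto simp: pure_susp_forms signed_def zero_prod_def algebra_simps split: if_splits)
next
  case False
  have "shuffle forms_taylor u w = shuffle (\<lambda>z. 0) u w"
  proof (rule shuffle_cong)
    fix z assume z: "mset z = mset (map snd u) + mset (map snd w)"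
    have "length z = length u + length w" using arg_cong[OF z, of size] by simp
    moreover have "length u + length w \<ge> 3" using assms(1,2) False by (cases u; cases w) (auto simp: Suc_le_eq)
    ultimately obtain x y v z' where "z = x # y # v # z'"
      by (metis Suc_le_length_iff numeral_3_eq_3)
    then show "forms_taylor z = 0" by simp
  qed
  then show ?thesis by simp
qed

definition forms_Q :: "('k, 'a form) tens \<Rightarrow> ('k, 'a form) tens" where
  "forms_Q = coder_of (susp (forms_gvs s)) forms_taylor"

lemma coderivation_forms_Q: "coderivation (susp (forms_gvs s)) forms_Q"
proof -
  interpret W: graded "susp (forms_gvs s)" by standard (rule graded_susp_forms)
  show ?thesis
    unfolding forms_Q_def by (rule W.coderivation_coder_of[OF mlin_forms_taylor forms_taylor_degree])
qed

lemma forms_Q_square: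
  assumes "x \<in> Tbar (susp (forms_gvs s))"
  shows "forms_Q (forms_Q x) = 0"
proof
  interpret W: graded "susp (forms_gvs s)" by standard (rule graded_susp_forms)
  fix M
  show "forms_Q (forms_Q x) M = 0 M"
  proof (cases "multilin (susp (forms_gvs s)) M")
    case True
    let ?D = "coder (sgn_map (susp (forms_gvs s))) forms_taylor"
    have "?D (?D M) vs = 0" for vs
      unfolding dga_taylor_eq_bar
    proof (rule coder_bar_taylor_square[OF W.multilin_multiadd[OF True]])
      show "multiadd (bar_taylor (sgn_map (forms_gvs s)) (form_d D) form_mult)"
        using mlin_multiadd[OF mlin_forms_taylor] unfolding dga_taylor_eq_bar by simp
    qed (auto simp: Modules.additive_def sgn_map_forms form_d_def form_mult_def D_add D_minus D_mult
        zero_prod_def algebra_simps)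
    then have "?D (?D M) = (\<lambda>vs. 0)" by (rule ext)
    with Tbar_zero[OF assms] True W.multilin_coder[OF mlin_forms_taylor True] show ?thesis
      by (simp add: forms_Q_def coder_of_apply)
  qed (simp add: forms_Q_def coder_of_apply)
qed

lemma Cinf_algebra_forms: "Cinf_algebra (forms_gvs s) forms_Q"
  unfolding Cinf_algebra_def Ainf_algebra_def
proof (intro conjI ballI graded_forms coderivation_forms_Q forms_Q_square)
  fix x y assume "x \<in> Tbar (susp (forms_gvs s))" "y \<in> Tbar (susp (forms_gvs s))"
  then show "forms_Q (shuffle_prod (susp (forms_gvs s)) x y) =
      shuffle_prod (susp (forms_gvs s)) (forms_Q x) y +
      shuffle_prod (susp (forms_gvs s)) (tsgn (susp (forms_gvs s)) x) (forms_Q y)"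
    using coderivation_forms_Q unfolding forms_Q_def
    by (intro coder_of_shuffle_prod graded_susp_forms mlin_forms_taylor forms_taylor_parity forms_taylor_kills_shuffles)
      (auto simp: coderivation_def tbar_linear_def)
qed

end

section \<open>Whitney forms and iterated integrals\<close>

lemma scl_whitney [simp]:
  "scl whitney_gvs x (a, b, c) = (x * a, x * b, x * c)"
  "scl (susp whitney_gvs) x (a, b, c) = (x * a, x * b, x * c)"
  by (simp_all add: whitney_gvs_def susp_def)

lemma graded_whitney: "graded_vs (whitney_gvs :: ('k::field_char_0, 'k whitney) gvs)"
  unfolding graded_vs_def
proof (intro conjI allI)
  let ?W = "whitney_gvs :: ('k, 'k whitney) gvs"
  show "vector_space (scl ?W)"
    by standard (auto simp: whitney_gvs_def algebra_simps)
  then interpret F: vector_space "scl ?W" .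
  fix i :: int
  show "Vector_Spaces.linear (scl ?W) (scl ?W) (cmp ?W i)"
    by standard (auto simp: whitney_gvs_def zero_prod_def)
  show "cmp ?W i (cmp ?W j v) = (if i = j then cmp ?W j v else 0)" for j v
    by (auto simp: whitney_gvs_def zero_prod_def split_def)
  fix v :: "'k whitney"
  have sub: "{i. cmp ?W i v \<noteq> 0} \<subseteq> {0, 1}"
    by (auto simp: whitney_gvs_def split_def split: if_splits)
  then show "finite {i. cmp ?W i v \<noteq> 0}" by (rule finite_subset) simp
  have "(\<Sum>i | cmp ?W i v \<noteq> 0. cmp ?W i v) = (\<Sum>i\<in>{0, 1}. cmp ?W i v)"
    using sub by (intro sum.mono_neutral_left) auto
  then show "v = (\<Sum>i | cmp ?W i v \<noteq> 0. cmp ?W i v)"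
    by (cases v) (simp add: whitney_gvs_def)
qed

lemma graded_susp_whitney: "graded_vs (susp whitney_gvs)"
  by (rule graded_susp[OF graded_whitney])

lemma parity_part_whitney:
  "parity_part whitney_gvs p (a, b, c) = (if p then (0, 0, c) else (a, b, 0))"
  "parity_part (susp whitney_gvs) p (a, b, c) = (if p then (a, b, 0) else (0, 0, c))"
proof -
  let ?W = "whitney_gvs :: ('a, 'a whitney) gvs"
  interpret V: graded ?W by standard (rule graded_whitney)
  interpret W: graded "susp ?W" by standard (rule graded_susp_whitney)
  have "parity_part ?W p (a, b, c) = (\<Sum>i\<in>{0, 1}. if odd i = p then cmp ?W i (a, b, c) else 0)"
    by (rule V.parity_part_eq) (auto simp: whitney_gvs_def split: if_splits)
  then show "parity_part ?W p (a, b, c) = (if p then (0, 0, c) else (a, b, 0))"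
    by (cases p) (simp_all add: whitney_gvs_def)
  have "parity_part (susp ?W) p (a, b, c) =
      (\<Sum>i\<in>{-1, 0}. if odd i = p then cmp (susp ?W) i (a, b, c) else 0)"
    by (rule W.parity_part_eq) (auto simp: whitney_gvs_def susp_def split: if_splits)
  then show "parity_part (susp ?W) p (a, b, c) = (if p then (a, b, 0) else (0, 0, c))"
    by (cases p) (simp_all add: whitney_gvs_def susp_def)
qed

lemma sgn_map_whitney:
  "sgn_map whitney_gvs (a, b, c) = (a, b, - c)" "sgn_map (susp whitney_gvs) (a, b, c) = (- a, - b, c)"
  by (simp_all add: sgn_map_def parity_part_whitney)

lemma homogeneous_susp_whitney:
  "homogeneous (susp whitney_gvs) i (a, b, c) \<longleftrightarrow> (i \<noteq> - 1 \<longrightarrow> a = 0 \<and> b = 0) \<and> (i \<noteq> 0 \<longrightarrow> c = 0)"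
  by (auto simp: homogeneous_def susp_def whitney_gvs_def zero_prod_def)

lemma pure_susp_whitney:
  "graded.pure (susp whitney_gvs) = {(p, (a, b, c)). if p then c = 0 else a = 0 \<and> b = 0}"
proof -
  interpret W: graded "susp whitney_gvs" by standard (rule graded_susp_whitney)
  show ?thesis by (auto simp: W.pure_def parity_part_whitney split: if_splits)
qed

abbreviation cup_taylor :: "'k::field_char_0 whitney list \<Rightarrow> 'k whitney" where
  "cup_taylor \<equiv> dga_taylor whitney_gvs whitney_d cup"

lemma cup_taylor_simps [simp]:
  "cup_taylor [(a, b, c)] = (0, 0, b - a)"
  "cup_taylor [(a, b, c), (a', b', c')] = (a * a', b * b', b * c' - c * a')"
  "cup_taylor (v # w # x # vs) = 0"
  by (simp_all add: dga_taylor_def whitney_d_def cup_def sgn_map_whitney)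

lemma mlin_short_cases:
  fixes us ws :: "'a list"
  obtains "us = []" "ws = []" | w where "us = []" "ws = [w]" | w w' ws' where "us = []" "ws = w # w' # ws'"
    | u where "us = [u]" "ws = []" | u w ws' where "us = [u]" "ws = w # ws'" | u u' us' where "us = u # u' # us'"
  by (metis neq_Nil_conv)

lemma mlin_cup_taylor: "mlin (scl (susp whitney_gvs)) (scl (susp whitney_gvs)) cup_taylor"
  unfolding mlin_def
proof (intro allI)
  fix us ws :: "'a whitney list" and c x y
  show "cup_taylor (us @ (scl (susp whitney_gvs) c x + y) # ws) =
    scl (susp whitney_gvs) c (cup_taylor (us @ x # ws)) + cup_taylor (us @ y # ws)"
  proof (cases rule: mlin_short_cases[of us ws])
    case 1 then show ?thesis by (cases x; cases y) (simp add: algebra_simps)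
  next
    case (2 w) then show ?thesis by (cases x; cases y; cases w) (simp add: algebra_simps)
  next
    case (4 u) then show ?thesis by (cases x; cases y; cases u) (simp add: algebra_simps)
  next
    case (6 u u' us') then show ?thesis by (cases us') (simp_all add: zero_prod_def)
  qed (simp_all add: zero_prod_def)
qed

lemma mlin_zero_letter:
  assumes "mlin s (*) (M :: 'a::ab_group_add list \<Rightarrow> 'k::field)" "0 \<in> set ws" "\<And>x. s 1 x = x"
  shows "M ws = 0"
proof -
  from assms(2) obtain a b where ws: "ws = a @ 0 # b" by (meson split_list)
  have "Modules.additive (\<lambda>v. M (a @ v # b))"
    by (rule additive_mlin_scale[OF assms(1)]) (simp_all add: assms(3))
  from Modules.additive.zero[OF this] show ?thesis by (simp add: ws)
qed

lemma splits_right_Nil: "splits (\<lambda>x y. if y = [] then B x else 0) u = B u"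
  by (induction u arbitrary: B) simp_all

lemma splits_left_single: "splits (\<lambda>x y. case x of [v] \<Rightarrow> B v y | _ \<Rightarrow> 0) (v # u) = B v u"
proof -
  have "splits (\<lambda>x y. case v # x of [v] \<Rightarrow> B v y | _ \<Rightarrow> 0) u = splits (\<lambda>x y. if x = [] then B v y else 0) u"
    by (intro splits_cong) (auto split: list.splits)
  then show ?thesis by (simp add: splits_left_Nil)
qed

lemma splits_right_single: "splits (\<lambda>x y. case y of [v] \<Rightarrow> B x v | _ \<Rightarrow> 0) (u @ [v]) = B u v"
proof -
  have "splits (\<lambda>x y. case y @ [v] of [v] \<Rightarrow> B x v | _ \<Rightarrow> 0) u = splits (\<lambda>x y. if y = [] then B x v else 0) u"
    by (intro splits_cong) (auto split: list.splits)
  then show ?thesis by (simp add: splits_append_Cons splits_right_Nil)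
qed

text \<open>A coderivation with linear and quadratic coefficients only sees decompositions into at most two
  blocks.\<close>
lemma comorph_quadratic:
  assumes r: "\<And>a b c vs. r (a # b # c # vs) = 0" and u: "u \<noteq> []"
  shows "comorph f r u = r [f u] + splits (\<lambda>x y. if x = [] \<or> y = [] then 0 else r [f x, f y]) u"
proof -
  have 2: "comorph f (\<lambda>ws. r (f x # ws)) y = r [f x, f y]" if "y \<noteq> []" for x y
  proof -
    have "comorph f (\<lambda>ws. r (f x # ws)) y = splits (\<lambda>p q. if q = [] then r [f x, f p] else 0) y"
      unfolding comorph_rec[OF that]
    proof (intro splits_cong)
      fix p q assume pq: "p @ q = y"
      show "(if p = [] then 0 else comorph f (\<lambda>ws. r (f x # f p # ws)) q) = (if q = [] then r [f x, f p] else 0)"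
      proof (cases "q = []")
        case True then show ?thesis using that pq by simp
      next
        case False
        then have "comorph f (\<lambda>ws. r (f x # f p # ws)) q = comorph f (\<lambda>ws. 0) q"
          by (intro comorph_cong) (auto simp: neq_Nil_conv r)
        with False show ?thesis by simp
      qed
    qed
    then show ?thesis by (simp add: splits_right_Nil)
  qed
  have "comorph f r u = splits (\<lambda>x y. (if y = [] then r [f x] else 0) +
      (if x = [] \<or> y = [] then 0 else r [f x, f y])) u"
    unfolding comorph_rec[OF u] by (intro splits_cong) (use u 2 in auto)
  then show ?thesis by (simp only: splits_add splits_right_Nil)
qed

lemma additive_fst_whitney: "Modules.additive (\<lambda>w :: 'k::field_char_0 whitney. fst w)"
  and additive_fst_snd_whitney: "Modules.additive (\<lambda>w :: 'k whitney. fst (snd w))"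
  and additive_snd_snd_whitney: "Modules.additive (\<lambda>w :: 'k whitney. snd (snd w))"
  by (simp_all add: Modules.additive_def)

lemma splits_two_singles:
  "splits (\<lambda>x y. (case x of [v] \<Rightarrow> g v | _ \<Rightarrow> 0) * (case y of [w] \<Rightarrow> g w | _ \<Rightarrow> 0)) u =
    (case u of [v, w] \<Rightarrow> g v * g w | _ \<Rightarrow> (0 :: 'k::ring))"
proof (cases u)
  case (Cons v u')
  have "splits (\<lambda>x y. (case x of [v] \<Rightarrow> g v | _ \<Rightarrow> 0) * (case y of [w] \<Rightarrow> g w | _ \<Rightarrow> 0)) u =
    splits (\<lambda>x y. case x of [v] \<Rightarrow> g v * (case y of [w] \<Rightarrow> g w | _ \<Rightarrow> 0) | _ \<Rightarrow> 0) u"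
    by (intro splits_cong) (auto split: list.splits)
  then show ?thesis unfolding Cons splits_left_single by (auto split: list.splits)
qed simp


lemma lambda_taylor_single [simp]: "lambda_taylor ev1 ev0 I [(f, a)] = (ev1 f, ev0 f, I [a])"
  and lambda_taylor_long [simp]: "lambda_taylor ev1 ev0 I (v # w # vs) = (0, 0, I (map snd (v # w # vs)))"
  by (simp_all add: lambda_taylor_def)

lemma lambda_taylor_components:
  assumes "u \<noteq> []"
  shows "fst (lambda_taylor ev1 ev0 I u) = (case u of [v] \<Rightarrow> ev1 (fst v) | _ \<Rightarrow> 0)"
    "fst (snd (lambda_taylor ev1 ev0 I u)) = (case u of [v] \<Rightarrow> ev0 (fst v) | _ \<Rightarrow> 0)"
    "snd (snd (lambda_taylor ev1 ev0 I u)) = I (map snd u)"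
proof -
  consider f a where "u = [(f, a)]" | v w vs where "u = v # w # vs"
    using assms by (metis neq_Nil_conv surj_pair)
  then show "fst (lambda_taylor ev1 ev0 I u) = (case u of [v] \<Rightarrow> ev1 (fst v) | _ \<Rightarrow> 0)"
    "fst (snd (lambda_taylor ev1 ev0 I u)) = (case u of [v] \<Rightarrow> ev0 (fst v) | _ \<Rightarrow> 0)"
    "snd (snd (lambda_taylor ev1 ev0 I u)) = I (map snd u)"
    by (cases; simp)+
qed

context diff_alg begin

abbreviation "Vs \<equiv> susp (forms_gvs s)"
abbreviation "Ws \<equiv> susp (whitney_gvs :: ('k, 'k whitney) gvs)"

text \<open>The coefficients are of degree 0 whatever the functional \<open>I\<close> is.  This and the next lemmas will be
  used both for iterated integrals and for their logarithm.\<close>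
lemma lambda_taylor_sgn:
  assumes "\<And>f. ev1 (- f) = - ev1 f" "\<And>f. ev0 (- f) = - ev0 f" "x \<noteq> []"
  shows "lambda_taylor ev1 ev0 I (map (sgn_map Vs) x) = sgn_map Ws (lambda_taylor ev1 ev0 I x)"
proof -
  have snd: "snd (sgn_map Vs v) = snd v" for v by (cases v) (simp add: sgn_map_forms)
  consider f a where "x = [(f, a)]" | v w vs where "x = v # w # vs"
    using assms(3) by (metis neq_Nil_conv surj_pair)
  then show ?thesis by cases (simp_all add: sgn_map_forms sgn_map_whitney assms snd comp_def)
qed

lemma mlin_lambda_taylor:
  assumes ev: "\<And>c f g. ev1 (s c f + g) = c * ev1 f + ev1 g" "\<And>c f g. ev0 (s c f + g) = c * ev0 f + ev0 g"
    and I: "mlin s (*) I"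
  shows "mlin (scl Vs) (scl Ws) (lambda_taylor ev1 ev0 I)"
  unfolding mlin_def
proof (intro allI)
  fix us ws :: "'a form list" and c x y
  have I': "I (map snd us @ (s c a + b) # map snd ws) =
      c * I (map snd us @ a # map snd ws) + I (map snd us @ b # map snd ws)" for a b
    by (rule mlinD[OF I])
  show "lambda_taylor ev1 ev0 I (us @ (scl Vs c x + y) # ws) =
    scl Ws c (lambda_taylor ev1 ev0 I (us @ x # ws)) + lambda_taylor ev1 ev0 I (us @ y # ws)"
  proof (cases "us = [] \<and> ws = []")
    case True
    then show ?thesis using I' by (cases x; cases y) (simp add: ev)
  next
    case False
    have long: "lambda_taylor ev1 ev0 I (us @ v # ws) = (0, 0, I (map snd us @ snd v # map snd ws))" for v
      using False by (cases us; cases ws; cases "tl us") auto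
    show ?thesis
      unfolding long using I'[of "snd x" "snd y"] by (cases x; cases y) simp
  qed
qed

lemma lambda_taylor_degree:
  assumes ev: "ev1 0 = 0" "ev0 0 = 0" and I: "mlin s (*) I"
    and "vs \<noteq> []" "list_all2 (homogeneous Vs) ds vs"
  shows "homogeneous Ws (sum_list ds) (lambda_taylor ev1 ev0 I vs)"
proof -
  consider f a where "vs = [(f, a)]" | v w vs' where "vs = v # w # vs'"
    using assms(4) by (metis neq_Nil_conv surj_pair)
  then show ?thesis
  proof cases
    case (1 f a)
    have "I [0] = 0" by (rule mlin_zero_letter[OF I]) auto
    with 1 assms(5) ev show ?thesis
      by (auto simp: list_all2_Cons2 homogeneous_susp_forms homogeneous_susp_whitney)
  next
    case (2 v w vs')
    have "sum_list ds = 0 \<or> 0 \<in> set (map snd vs)"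
      using assms(5)
    proof (induction rule: list_all2_induct)
      case (Cons d ds v vs)
      then show ?case by (cases v) (auto simp: homogeneous_susp_forms)
    qed simp
    then have "sum_list ds = 0 \<or> I (map snd vs) = 0"
      using mlin_zero_letter[OF I _ scale_one] by blast
    with 2 show ?thesis by (auto simp: homogeneous_susp_whitney)
  qed
qed

lemma lambda_taylor_parity:
  assumes ev: "ev1 0 = 0" "ev0 0 = 0" and I: "mlin s (*) I"
    and x: "x \<noteq> []" "set x \<subseteq> graded.pure Vs"
  shows "tag_comorph (lambda_taylor ev1 ev0 I) x \<in> graded.pure Ws"
proof -
  consider p f a where "x = [(p, (f, a))]" | v w vs where "x = v # w # vs"
    using x(1) by (metis neq_Nil_conv surj_pair)
  then show ?thesis
  proof cases
    case (1 p f a)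
    have "I [0] = 0" by (rule mlin_zero_letter[OF I]) auto
    with 1 x(2) ev show ?thesis
      by (auto simp: tag_comorph_def pure_susp_forms pure_susp_whitney split: if_splits)
  next
    case (2 v w vs)
    have "parity x \<longrightarrow> 0 \<in> set (map snd (map snd x))"
      using x(2)
    proof (induction x)
      case (Cons a x)
      then show ?case by (cases a) (auto simp: pure_susp_forms split: if_splits)
    qed simp
    then have "parity x \<longrightarrow> I (map snd (map snd x)) = 0"
      using mlin_zero_letter[OF I _ scale_one] by blast
    with 2 show ?thesis by (auto simp: tag_comorph_def pure_susp_whitney)
  qed
qed

end


text \<open>Integration on the unit interval: \<open>D\<close> is the derivative, \<open>J\<close> the antiderivative that vanishes at 0,
  and \<open>ev0\<close>, \<open>ev1\<close> are the values at the end points.  The unit \<open>e\<close> is explicit data because functions on the interval are represented by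
  functions that vanish outside of it, so that the unit is an indicator function.  The last
  assumption says that a function with derivative 0 is constant.\<close>
locale iter_int = diff_alg s D
  for s :: "'k::field_char_0 \<Rightarrow> 'a::comm_ring \<Rightarrow> 'a" and D +
  fixes e :: 'a and J :: "'a \<Rightarrow> 'a" and ev0 ev1 :: "'a \<Rightarrow> 'k"
  assumes e_mult: "e * f = f"
    and D_J: "D (J f) = f" and ev0_J: "ev0 (J f) = 0"
    and ev0_linear: "ev0 (s c f + g) = c * ev0 f + ev0 g" and ev0_mult: "ev0 (f * g) = ev0 f * ev0 g"
    and ev1_linear: "ev1 (s c f + g) = c * ev1 f + ev1 g" and ev1_mult: "ev1 (f * g) = ev1 f * ev1 g"
    and ev_e: "ev0 e = 1" "ev1 e = 1" and ev1_J_e: "ev1 (J e) = 1"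
    and D_eq_0: "D f = 0 \<Longrightarrow> ev0 f = 0 \<Longrightarrow> f = 0"
begin

lemma ev_additive: "Modules.additive ev0" "Modules.additive ev1"
  using ev0_linear[of 1] ev1_linear[of 1] by (simp_all add: Modules.additive_def)

lemmas ev_simps = Modules.additive.add[OF ev_additive(1)] Modules.additive.add[OF ev_additive(2)]
  Modules.additive.minus[OF ev_additive(1)] Modules.additive.minus[OF ev_additive(2)]
  Modules.additive.diff[OF ev_additive(1)] Modules.additive.diff[OF ev_additive(2)]
  Modules.additive.zero[OF ev_additive(1)] Modules.additive.zero[OF ev_additive(2)]

lemma ev_scale: "ev0 (s c f) = c * ev0 f" "ev1 (s c f) = c * ev1 f"
  using ev0_linear[of c f 0] ev1_linear[of c f 0] by (simp_all add: ev_simps)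

lemma D_scale: "D (s c f) = s c (D f)" using D_linear[of c f 0] by simp
lemma D_diff: "D (f - g) = D f - D g" using D_add[of f "- g"] by (simp add: D_minus)

lemma D_e: "D e = 0"
  using D_mult[of e e] by (simp add: e_mult mult.commute[of "D e" e])

lemma eqI: "D f = D g \<Longrightarrow> ev0 f = ev0 g \<Longrightarrow> f = g"
  using D_eq_0[of "f - g"] by (simp add: D_diff ev_simps)

text \<open>Functions are also determined by their derivative and their value at the other end point, which is
  used for antiderivatives that vanish at 1.\<close>
lemma eqI1:
  assumes "D f = D g" "ev1 f = ev1 g"
  shows "f = g"
proof -
  have "f - g = s (ev0 (f - g)) e"
    by (rule eqI) (simp_all add: D_diff assms D_scale D_e ev_scale ev_e)
  moreover from arg_cong[OF this, of ev1] have "ev0 (f - g) = 0"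
    by (simp add: ev_scale ev_e ev_simps assms)
  ultimately show ?thesis by simp
qed

lemma J_linear: "J (s c f + g) = s c (J f) + J g"
  by (rule eqI) (simp_all add: D_J D_linear ev0_J ev0_linear)

lemma J_additive: "Modules.additive J"
  using J_linear[of 1] by (simp add: Modules.additive_def)

lemmas J_simps = Modules.additive.add[OF J_additive] Modules.additive.minus[OF J_additive]
  Modules.additive.diff[OF J_additive] Modules.additive.zero[OF J_additive]

lemma J_scale: "J (s c f) = s c (J f)"
  using J_linear[of c f 0] by (simp add: J_simps)

lemma J_by_parts: "J (X * D f) = X * f - J (D X * f) - s (ev0 X * ev0 f) e"
  by (rule eqI) (simp_all add: D_J D_diff D_mult D_scale D_e ev0_J ev_simps ev0_mult ev_scale ev_e)

text \<open>Integration by parts: the square is the union of two triangles.\<close>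
lemma Rota_Baxter: "J f * J g = J (f * J g) + J (J f * g)"
  by (rule eqI) (simp_all add: D_J D_mult D_add ev0_J ev_simps ev0_mult)

text \<open>Iterated integrals with variable upper limit and initial integrand \<open>X\<close>; the first letter is the
  innermost.\<close>
definition K :: "'a \<Rightarrow> 'a list \<Rightarrow> 'a" where
  "K X as = fold (\<lambda>a X. J (X * a)) as X"

lemma K_simps [simp]: "K X [] = X" "K X (a # as) = K (J (X * a)) as"
  by (simp_all add: K_def)

lemma K_append: "K X (as @ bs) = K (K X as) bs"
  by (simp add: K_def)

lemma K_linear: "K (s c X + Y) as = s c (K X as) + K Y as"
  by (induction as arbitrary: X Y) (simp_all add: distrib_right s_mult J_linear)

lemma K_additive: "Modules.additive (\<lambda>X. K X as)"
  using K_linear[of 1] by (simp add: Modules.additive_def)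

lemmas K_add_simps = Modules.additive.add[OF K_additive] Modules.additive.minus[OF K_additive]
  Modules.additive.diff[OF K_additive] Modules.additive.zero[OF K_additive]

lemma mlin_K: "mlin s s (K X)"
  by (simp add: mlin_def K_append distrib_left mult_s J_linear K_linear)

definition I :: "'a list \<Rightarrow> 'k" where
  "I as = ev1 (K e as)"

lemma mlin_I: "mlin s (*) I"
  unfolding I_def by (rule mlin_compose_linear[OF mlin_K]) (rule ev1_linear)

lemma I_Nil: "I [] = 1" by (simp add: I_def ev_e)

lemma multiadd_K: "multiadd (\<lambda>u :: 'a form list. K X (map snd u))"
proof -
  have "mlin (scl Vs) s (\<lambda>u. K X (map snd u))"
    by (rule mlin_map[OF mlin_K]) (auto simp: split_def)
  then show ?thesis by (rule mlin_multiadd[where s = "scl Vs" and t = s]) auto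
qed

text \<open>Each term with \<open>D f\<close> is integrated by parts; what remains cancels against the terms with the product
  of \<open>f\<close> and a neighbouring one-form.  The terms at the two ends survive.  An arbitrary initial
  integrand \<open>X\<close> is what makes the induction on the word work, as passing the first letter turns \<open>X\<close> into
  \<open>J (X a)\<close>.\<close>
lemma coder_K:
  assumes "u \<noteq> []"
  shows "coder (sgn_map Vs) forms_taylor (\<lambda>u. K X (map snd u)) u =
     K (J (D X * fst (hd u)) + s (ev0 X * ev0 (fst (hd u))) e) (map snd (tl u)) -
     K X (map snd (butlast u)) * fst (last u)"
  using assms
proof (induction u arbitrary: X)
  case (Cons v u)
  obtain f a where v: "v = (f, a)" by (cases v)
  let ?us = "map snd u"
  have rec: "coder (sgn_map Vs) forms_taylor (\<lambda>u. K X (map snd u)) (v # u) =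
      K (J (X * (- D f))) ?us +
      (case u of [] \<Rightarrow> 0 | w # u' \<Rightarrow> K (J (X * (f * snd w - a * fst w))) (map snd u')) +
      coder (sgn_map Vs) forms_taylor (\<lambda>u. K (J (X * a)) (map snd u)) u"
    using coder_bar_taylor[OF multiadd_K, of "sgn_map Vs" "sgn_map (forms_gvs s)" "form_d D" form_mult X v u]
    unfolding dga_taylor_eq_bar
    by (simp add: v sgn_map_forms form_d_def form_mult_def split_def split: list.splits)
  have first: "K (J (X * (- D f))) ?us =
      K (J (D X * f) + s (ev0 X * ev0 f) e) ?us - K (X * f) ?us"
    by (simp add: J_simps J_by_parts K_add_simps)
  show ?case
  proof (cases u)
    case Nil
    then show ?thesis unfolding rec first by (simp add: v)
  next
    case (Cons w u')
    have "K (J (X * (f * snd w - a * fst w))) (map snd u') =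
        K (X * f) ?us - K (J (X * a * fst w)) (map snd u')"
      by (simp add: Cons right_diff_distrib J_simps K_add_simps mult.assoc)
    moreover have "coder (sgn_map Vs) forms_taylor (\<lambda>u. K (J (X * a)) (map snd u)) u =
        K (J (X * a * fst w)) (map snd u') - K (J (X * a)) (map snd (butlast u)) * fst (last u)"
      using Cons.IH[of "J (X * a)"] Cons by (simp add: D_J ev0_J)
    ultimately show ?thesis
      unfolding rec first by (simp add: v Cons)
  qed
qed simp

lemma coder_I:
  assumes "u \<noteq> []"
  shows "coder (sgn_map Vs) forms_taylor (\<lambda>u. I (map snd u)) u =
     ev0 (fst (hd u)) * I (map snd (tl u)) - I (map snd (butlast u)) * ev1 (fst (last u))"
proof -
  have "coder (sgn_map Vs) forms_taylor (\<lambda>u. I (map snd u)) u =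
      ev1 (coder (sgn_map Vs) forms_taylor (\<lambda>u. K e (map snd u)) u)"
    unfolding I_def by (rule coder_additive[OF ev_additive(2), symmetric])
  moreover have "K (s c e) as = s c (K e as)" for c as
    using K_linear[of c e 0] by (simp add: K_add_simps)
  ultimately show ?thesis
    unfolding coder_K[OF assms] by (simp add: D_e J_simps ev_e ev_simps ev_scale ev1_mult I_def)
qed

abbreviation lam :: "'a form list \<Rightarrow> 'k whitney" where
  "lam \<equiv> lambda_taylor ev1 ev0 I"

lemma coder_singleton_part:
  assumes ev: "Modules.additive ev" and u: "u \<noteq> []"
  shows "coder (sgn_map Vs) forms_taylor (\<lambda>u. case u of [v] \<Rightarrow> ev (fst v) | _ \<Rightarrow> 0) u =
    (case u of [v, w] \<Rightarrow> ev (fst v * fst w) | _ \<Rightarrow> (0 :: 'k))"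
proof -
  let ?E = "\<lambda>u :: 'a form list. case u of [v] \<Rightarrow> ev (fst v) | _ \<Rightarrow> (0 :: 'k)"
  have E: "multiadd ?E"
    unfolding multiadd_def
  proof (intro allI)
    fix us ws :: "'a form list"
    show "Modules.additive (\<lambda>v. ?E (us @ v # ws))"
      using Modules.additive.add[OF ev]
      by (cases rule: mlin_short_cases[of us ws]) (auto simp: Modules.additive_def)
  qed
  obtain v u' where u: "u = v # u'" using u by (cases u) auto
  have "coder (sgn_map Vs) forms_taylor (\<lambda>ws. ?E (sgn_map Vs v # ws)) u' =
      coder (sgn_map Vs) forms_taylor (\<lambda>ws. 0) u'"
    by (intro coder_cong) (auto simp: neq_Nil_conv)
  then have "coder (sgn_map Vs) forms_taylor ?E u = ?E (- form_d D v # u') +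
      (case u' of [] \<Rightarrow> 0 | w # u'' \<Rightarrow> ?E (form_mult (sgn_map (forms_gvs s) v) w # u''))"
    unfolding u dga_taylor_eq_bar coder_bar_taylor[OF E] by simp
  also have "\<dots> = (case u of [v, w] \<Rightarrow> ev (fst v * fst w) | _ \<Rightarrow> 0)"
    unfolding u using Modules.additive.zero[OF ev]
    by (cases v) (auto simp: form_d_def form_mult_def sgn_map_forms split_def split: list.splits)
  finally show ?thesis .
qed

text \<open>The surviving terms of \<open>coder_K\<close> are the cup products of an end point value with an integral.  In
  decompositions into two blocks a function value requires a block of one letter.\<close>
lemma lambda_intertwines:
  assumes u: "u \<noteq> []"
  shows "coder (sgn_map Vs) forms_taylor lam u = comorph lam cup_taylor u"
proof -
  let ?C = "coder (sgn_map Vs) forms_taylor"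
  let ?E1 = "\<lambda>u. case u of [v] \<Rightarrow> ev1 (fst v) | _ \<Rightarrow> 0" and ?E0 = "\<lambda>u. case u of [v] \<Rightarrow> ev0 (fst v) | _ \<Rightarrow> 0"
  have L1: "fst (?C lam u) = (case u of [v, w] \<Rightarrow> ev1 (fst v * fst w) | _ \<Rightarrow> 0)"
    unfolding coder_additive[OF additive_fst_whitney] coder_singleton_part[OF ev_additive(2) u, symmetric]
    by (intro coder_cong) (simp add: lambda_taylor_components)
  have L2: "fst (snd (?C lam u)) = (case u of [v, w] \<Rightarrow> ev0 (fst v * fst w) | _ \<Rightarrow> 0)"
    unfolding coder_additive[OF additive_fst_snd_whitney] coder_singleton_part[OF ev_additive(1) u, symmetric]
    by (intro coder_cong) (simp add: lambda_taylor_components)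
  have L3: "snd (snd (?C lam u)) =
      ev0 (fst (hd u)) * I (map snd (tl u)) - I (map snd (butlast u)) * ev1 (fst (last u))"
    unfolding coder_additive[OF additive_snd_snd_whitney] coder_I[OF u, symmetric]
    by (intro coder_cong) (simp add: lambda_taylor_components)
  have cup1: "cup_taylor [w] = (0, 0, fst (snd w) - fst w)" for w :: "'k whitney"
    by (cases w) simp
  have cup2: "cup_taylor [w, w'] = (fst w * fst w', fst (snd w) * fst (snd w'),
      fst (snd w) * snd (snd w') - snd (snd w) * fst w')" for w w' :: "'k whitney"
    by (cases w; cases w') simp
  have R: "comorph lam cup_taylor u = cup_taylor [lam u] +
      splits (\<lambda>x y. if x = [] \<or> y = [] then 0 else cup_taylor [lam x, lam y]) u"
    by (rule comorph_quadratic) (simp_all add: u)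
  have R1: "fst (comorph lam cup_taylor u) = (case u of [v, w] \<Rightarrow> ev1 (fst v * fst w) | _ \<Rightarrow> 0)"
  proof -
    have "fst (comorph lam cup_taylor u) = splits (\<lambda>x y. ?E1 x * ?E1 y) u"
      unfolding R fst_add splits_additive[OF additive_fst_whitney] cup1
      by (simp, intro splits_cong) (auto simp: cup2 lambda_taylor_components)
    then show ?thesis by (simp add: splits_two_singles ev1_mult split: list.splits)
  qed
  have R2: "fst (snd (comorph lam cup_taylor u)) = (case u of [v, w] \<Rightarrow> ev0 (fst v * fst w) | _ \<Rightarrow> 0)"
  proof -
    have "fst (snd (comorph lam cup_taylor u)) = splits (\<lambda>x y. ?E0 x * ?E0 y) u"
      unfolding R fst_add snd_add splits_additive[OF additive_fst_snd_whitney] cup1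
      by (simp, intro splits_cong) (auto simp: cup2 lambda_taylor_components)
    then show ?thesis by (simp add: splits_two_singles ev0_mult split: list.splits)
  qed
  have R3: "snd (snd (comorph lam cup_taylor u)) =
      ev0 (fst (hd u)) * I (map snd (tl u)) - I (map snd (butlast u)) * ev1 (fst (last u))"
  proof (cases "length u = 1")
    case True
    then obtain v where "u = [v]" by (auto simp: length_Suc_conv)
    then show ?thesis unfolding R by (cases v) (simp add: I_Nil)
  next
    case False
    have "snd (snd (comorph lam cup_taylor u)) = splits (\<lambda>x y. (case x of [v] \<Rightarrow> ev0 (fst v) * I (map snd y) | _ \<Rightarrow> 0) +
        (case y of [v] \<Rightarrow> - I (map snd x) * ev1 (fst v) | _ \<Rightarrow> 0)) u"
      unfolding R snd_add splits_additive[OF additive_snd_snd_whitney] cup1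
    proof -
      have "fst (snd (lam u)) - fst (lam u) = 0"
        using False u by (auto simp: lambda_taylor_components split: list.splits)
      moreover have "splits (\<lambda>x y. snd (snd (if x = [] \<or> y = [] then 0 else cup_taylor [lam x, lam y]))) u =
        splits (\<lambda>x y. (case x of [v] \<Rightarrow> ev0 (fst v) * I (map snd y) | _ \<Rightarrow> 0) +
        (case y of [v] \<Rightarrow> - I (map snd x) * ev1 (fst v) | _ \<Rightarrow> 0)) u"
      proof (intro splits_cong)
        fix x y assume "x @ y = u"
        then have "x = [] \<Longrightarrow> length y \<noteq> 1" "y = [] \<Longrightarrow> length x \<noteq> 1" using False by auto
        then show "snd (snd (if x = [] \<or> y = [] then 0 else cup_taylor [lam x, lam y])) =
          (case x of [v] \<Rightarrow> ev0 (fst v) * I (map snd y) | _ \<Rightarrow> 0) +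
          (case y of [v] \<Rightarrow> - I (map snd x) * ev1 (fst v) | _ \<Rightarrow> 0)"
          by (cases "x = [] \<or> y = []")
            (auto simp: cup2 lambda_taylor_components split: list.splits)
      qed
      ultimately show "snd (snd (0, 0, fst (snd (lam u)) - fst (lam u))) +
          splits (\<lambda>x y. snd (snd (if x = [] \<or> y = [] then 0 else cup_taylor [lam x, lam y]))) u =
        splits (\<lambda>x y. (case x of [v] \<Rightarrow> ev0 (fst v) * I (map snd y) | _ \<Rightarrow> 0) +
        (case y of [v] \<Rightarrow> - I (map snd x) * ev1 (fst v) | _ \<Rightarrow> 0)) u" by simp
    qed
    also have "\<dots> = ev0 (fst (hd u)) * I (map snd (tl u)) + (- I (map snd (butlast u)) * ev1 (fst (last u)))"
      unfolding splits_add
      using splits_left_single[of "\<lambda>v y. ev0 (fst v) * I (map snd y)" "hd u" "tl u"]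
        splits_right_single[of "\<lambda>x v. - I (map snd x) * ev1 (fst v)" "butlast u" "last u"] u
      by simp
    finally show ?thesis by simp
  qed
  show ?thesis
    using L1 L2 L3 R1 R2 R3 by (intro prod_eqI) simp_all
qed


text \<open>The antiderivative that vanishes at 1, up to sign: \<open>\<integral>\<close> from \<open>t\<close> to 1.\<close>
definition J1 :: "'a \<Rightarrow> 'a" where
  "J1 f = s (ev1 (J f)) e - J f"

lemma D_J1: "D (J1 f) = - f" and ev1_J1: "ev1 (J1 f) = 0" and ev0_J1: "ev0 (J1 f) = ev1 (J f)"
  by (simp_all add: J1_def D_diff D_scale D_e D_J ev_simps ev_scale ev_e ev0_J)

lemma J1_additive: "Modules.additive J1"
  unfolding Modules.additive_def
  by (rule allI, rule allI, rule eqI1) (simp_all add: D_J1 D_add ev1_J1 ev_simps)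

lemma Rota_Baxter1: "J1 f * J1 g = J1 (f * J1 g) + J1 (g * J1 f)"
  by (rule eqI1) (simp_all add: D_J1 D_mult D_add ev1_J1 ev_simps ev1_mult algebra_simps)

text \<open>Iterated integrals with variable lower limit, the first letter being the outermost.  They match the
  recursion of the shuffle product on first letters.\<close>
primrec K1 :: "'a list \<Rightarrow> 'a" where
  "K1 [] = e"
| "K1 (a # as) = J1 (a * K1 as)"

text \<open>Rota--Baxter for the outermost integrals of the two factors.\<close>
lemma K1_shuffle:
  assumes "set u \<union> set w \<subseteq> {a. \<not> fst a}"
  shows "shuffle K1 u w = K1 (map snd u) * K1 (map snd w)"
  using assms
proof (induction "length u + length w" arbitrary: u w rule: less_induct)
  case less
  show ?case
  proof (cases "u = [] \<or> w = []")
    case True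
    then show ?thesis by (auto simp: e_mult mult.commute[of _ e])
  next
    case False
    then obtain a u' b w' where uw: "u = a # u'" "w = b # w'" by (meson neq_Nil_conv)
    have L: "Modules.additive (\<lambda>f. J1 (c * f))" for c
      using Modules.additive.add[OF J1_additive] by (simp add: Modules.additive_def distrib_left)
    have "shuffle K1 u w = J1 (snd a * shuffle K1 u' w) + J1 (snd b * shuffle K1 u w')"
      using less.prems unfolding uw shuffle_additive[OF L] by simp
    also have "shuffle K1 u' w = K1 (map snd u') * K1 (map snd w)"
      using less.prems by (intro less.hyps) (auto simp: uw)
    also have "shuffle K1 u w' = K1 (map snd u) * K1 (map snd w')"
      using less.prems by (intro less.hyps) (auto simp: uw)
    also have "J1 (snd a * (K1 (map snd u') * K1 (map snd w))) + J1 (snd b * (K1 (map snd u) * K1 (map snd w'))) =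
        K1 (map snd u) * K1 (map snd w)"
      using Rota_Baxter1[of "snd a * K1 (map snd u')" "snd b * K1 (map snd w')"]
      by (simp add: uw ac_simps)
    finally show ?thesis .
  qed
qed

text \<open>Integrating from the inside or from the outside gives the same result.\<close>
lemma ev1_K_J: "ev1 (K (J Y) as) = ev1 (J (Y * K1 as))"
proof (induction as arbitrary: Y)
  case Nil
  show ?case by (simp add: mult.commute[of Y e] e_mult)
next
  case (Cons b bs)
  let ?Z = "b * K1 bs"
  have "Y * J1 ?Z = s (ev1 (J ?Z)) Y - Y * J ?Z"
    by (simp add: J1_def right_diff_distrib mult_s mult.commute[of Y e] e_mult)
  then have "ev1 (J (Y * J1 ?Z)) = ev1 (J Y * J ?Z) - ev1 (J (Y * J ?Z))"
    by (simp add: J_simps J_scale ev_simps ev_scale ev1_mult)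
  also have "\<dots> = ev1 (J (J Y * ?Z))"
    unfolding Rota_Baxter by (simp add: ev_simps)
  finally show ?case by (simp add: Cons.IH mult.assoc)
qed

lemma I_eq_K1: "I as = ev0 (K1 as)"
  by (cases as) (simp_all add: I_def ev_e e_mult ev1_K_J ev0_J1)

lemma I_shuffle:
  assumes "set u \<union> set w \<subseteq> {a. \<not> fst a}"
  shows "shuffle I u w = I (map snd u) * I (map snd w)"
proof -
  have "shuffle I u w = shuffle (\<lambda>z. ev0 (K1 z)) u w" by (intro shuffle_cong) (simp add: I_eq_K1)
  also have "\<dots> = ev0 (shuffle K1 u w)" by (rule shuffle_additive[OF ev_additive(1), symmetric])
  finally show ?thesis by (simp add: K1_shuffle[OF assms] ev0_mult I_eq_K1)
qed

end

section \<open>Bernoulli numbers and the logarithm\<close>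

unbundle fps_syntax and no vec_syntax

definition log_coeff :: "nat \<Rightarrow> 'k::field_char_0" where
  "log_coeff n = (- 1) ^ (n + 1) / of_nat n"

lemma log_coeff_0 [simp]: "log_coeff 0 = 0" by (simp add: log_coeff_def)

definition log_series :: "'k::field_char_0 fps" where
  "log_series = Abs_fps log_coeff"

definition bernoulli_series :: "'k::field_char_0 fps" where
  "bernoulli_series = fps_X / (fps_exp 1 - 1)"

lemma bernoulli_series_mult: "bernoulli_series * (fps_exp 1 - 1) = (fps_X :: 'k::field_char_0 fps)"
proof -
  let ?E = "fps_exp 1 - 1 :: 'k fps"
  have nz: "?E $ 1 \<noteq> 0" by simp
  then have "?E \<noteq> 0" by (metis fps_zero_nth)
  moreover have "subdegree ?E = 1" using nz by (intro subdegreeI) auto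
  ultimately have "?E dvd fps_X" by (simp add: fps_dvd_iff)
  then show ?thesis unfolding bernoulli_series_def by (rule dvd_div_mult_self)
qed

lemma bernoulli_series_nth: "bernoulli_series $ n = bernoulli n / fact n"
  by (simp add: bernoulli_series_def bernoulli_def)

lemma bernoulli_series_0_1: "bernoulli_series $ 0 = (1 :: 'k::field_char_0)"
  "bernoulli_series $ 1 = (- 1 / 2 :: 'k)"
proof -
  have eq: "(bernoulli_series * (fps_exp 1 - 1)) $ n = (fps_X :: 'k fps) $ n" for n
    by (simp only: bernoulli_series_mult)
  show 0: "bernoulli_series $ 0 = (1 :: 'k)" using eq[of 1] by (simp add: fps_mult_nth)
  show "bernoulli_series $ 1 = (- 1 / 2 :: 'k)"
    using eq[of 2] 0 by (simp add: fps_mult_nth numeral_2_eq_2 eq_neg_iff_add_eq_0 add.commute)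
qed

lemma scaled_power_nth:
  "(Abs_fps (\<lambda>n. x ^ n * F $ n) ^ k) $ i = x ^ i * ((F ^ k) $ i :: 'k::comm_ring_1)"
proof (induction k arbitrary: i)
  case (Suc k)
  have "x ^ j * F $ j * (x ^ (i - j) * (F ^ k) $ (i - j)) = x ^ i * (F $ j * (F ^ k) $ (i - j))"
    if "j \<in> {0..i}" for j
  proof -
    have "x ^ i = x ^ j * x ^ (i - j)" using that by (simp flip: power_add)
    then show ?thesis by (simp add: ac_simps)
  qed
  then show ?case
    by (simp add: fps_mult_nth Suc sum_distrib_left)
qed (simp add: fps_one_nth)

lemma power_nth_eq_0: "F $ 0 = 0 \<Longrightarrow> i < k \<Longrightarrow> ((F ^ k) $ i :: 'k::comm_ring_1) = 0"
  by (rule startsby_zero_power_prefix[rule_format])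

text \<open>With \<open>z = ln (1 + s) - ln (1 + x s)\<close> one has \<open>exp z = (1 + s) / (1 + x s)\<close>, hence
  \<open>\<beta> z (1 - x) s = z (1 + x s)\<close>; this is the coefficient of \<open>s\<^sup>n\<^sup>+\<^sup>1\<close>.  Keeping \<open>x\<close> a scalar replaces
  power series in two variables by power series in \<open>s\<close>.\<close>
lemma bernoulli_compose_log:
  fixes x :: "'k::field_char_0"
  defines "z \<equiv> log_series - Abs_fps (\<lambda>n. x ^ n * log_series $ n)"
  shows "(1 - x) * ((bernoulli_series oo z) $ n) =
    log_coeff (Suc n) * (1 - x ^ Suc n) + x * (log_coeff n * (1 - x ^ n))"
proof -
  let ?L = "log_series :: 'k fps" and ?Lx = "Abs_fps (\<lambda>n. x ^ n * log_series $ n)"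
  let ?u = "1 + fps_X :: 'k fps" and ?v = "1 + fps_const x * fps_X"
  have z0: "z $ 0 = 0" by (simp add: z_def log_series_def)
  have dL: "?u * fps_deriv ?L = 1"
  proof (rule fps_ext)
    fix n show "(?u * fps_deriv ?L) $ n = 1 $ n"
      by (cases n) (simp_all add: distrib_right log_series_def log_coeff_def del: of_nat_Suc)
  qed
  have dLx: "?v * fps_deriv ?Lx = fps_const x"
  proof (rule fps_ext)
    fix n show "(?v * fps_deriv ?Lx) $ n = fps_const x $ n"
      by (cases n) (simp_all add: distrib_right mult.assoc log_series_def log_coeff_def del: of_nat_Suc)
  qed
  let ?Ez = "fps_exp 1 oo z"
  \<comment> \<open>\<open>H\<close> solves \<open>(1 + s) H' = H\<close> with \<open>H 0 = 1\<close>, so it is \<open>1 + s\<close>.\<close>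
  define H where "H = ?Ez * ?v"
  have dEz: "fps_deriv ?Ez = ?Ez * fps_deriv z"
    by (simp add: fps_compose_deriv[OF z0])
  have "fps_deriv H = ?Ez * fps_deriv z * ?v + ?Ez * fps_const x"
    unfolding H_def fps_deriv_mult dEz by (simp add: add.commute)
  moreover have "fps_deriv z = fps_deriv ?L - fps_deriv ?Lx" by (simp only: z_def fps_deriv_sub)
  moreover have "u * (E * (a - b) * v + E * c) = E * (v * (u * a) - u * (v * b) + u * c)"
    for u v E a b c :: "'k fps" by (simp add: algebra_simps)
  ultimately have "?u * fps_deriv H =
      ?Ez * (?v * (?u * fps_deriv ?L) - ?u * (?v * fps_deriv ?Lx) + ?u * fps_const x)"
    by (simp only:)
  then have ode: "?u * fps_deriv H = H"
    unfolding dL dLx H_def by simp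
  have H0: "H $ 0 = 1" by (simp add: H_def)
  have rec: "of_nat (Suc n) * H $ Suc n = (1 - of_nat n) * H $ n" for n
  proof -
    have "of_nat (Suc n) * H $ Suc n + of_nat n * H $ n = H $ n"
      using arg_cong[OF ode, of "\<lambda>F. F $ n"] by (cases n) (simp_all add: distrib_right del: of_nat_Suc)
    then have "of_nat (Suc n) * H $ Suc n = H $ n - of_nat n * H $ n" by (simp only: eq_diff_eq)
    then show ?thesis by (simp add: left_diff_distrib)
  qed
  have H1: "H $ 1 = 1" using rec[of 0] H0 by simp
  have H2: "H $ (n + 2) = 0" for n
  proof (induction n)
    case 0
    show ?case using rec[of 1] by (simp add: numeral_2_eq_2)
  next
    case (Suc n)
    then show ?case using rec[of "n + 2"] by (simp del: of_nat_Suc)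
  qed
  have H: "H = ?u"
  proof (rule fps_ext)
    fix n
    show "H $ n = ?u $ n"
    proof (cases "n \<le> 1")
      case True
      then have "n = 0 \<or> n = 1" by auto
      then show ?thesis using H0 H1 by auto
    next
      case False
      then show ?thesis using H2[of "n - 2"] by (simp add: Suc_diff_Suc numeral_2_eq_2)
    qed
  qed
  have "(bernoulli_series * (fps_exp 1 - 1)) oo z = z"
    unfolding bernoulli_series_mult by (rule fps_X_fps_compose_startby0) (rule z0)
  then have "(bernoulli_series oo z) * (?Ez - 1) = z"
    by (simp add: fps_compose_mult_distrib[OF z0] fps_compose_sub_distrib)
  then have "(bernoulli_series oo z) * (H - ?v) = z * ?v"
    unfolding H_def by (metis mult.assoc mult_1_left left_diff_distrib)
  moreover have "H - ?v = fps_const (1 - x) * fps_X"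
    unfolding H by (simp add: algebra_simps flip: fps_const_sub)
  ultimately have eq: "fps_const (1 - x) * (fps_X * (bernoulli_series oo z)) = z + fps_const x * (fps_X * z)"
    by (simp add: algebra_simps)
  have zn: "z $ m = log_coeff m * (1 - x ^ m)" for m
    by (simp add: z_def log_series_def algebra_simps)
  show ?thesis
    using fps_eq_iff[THEN iffD1, OF eq, rule_format, of "Suc n"] by (simp add: zn)
qed

text \<open>The coefficient of \<open>m\<^sub>n\<^sub>+\<^sub>1\<close> with \<open>k\<close> letters \<open>dt\<close> before and \<open>l\<close> letters \<open>dt\<close> after the function.\<close>
definition mn_coeff :: "nat \<Rightarrow> nat \<Rightarrow> 'k::field_char_0" where
  "mn_coeff k l = (- 1) ^ (k + 1) * of_nat ((k + l) choose k) * bernoulli (k + l) / fact (k + l)"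

lemma sum_triangle_rectangle:
  fixes h :: "nat \<Rightarrow> nat \<Rightarrow> 'k::comm_monoid_add"
  assumes "\<And>k l. k \<le> N \<Longrightarrow> l \<le> N \<Longrightarrow> N < k + l \<Longrightarrow> h k l = 0"
  shows "(\<Sum>m\<le>N. \<Sum>k\<le>m. h k (m - k)) = (\<Sum>k\<le>N. \<Sum>l\<le>N. h k l)"
proof -
  have "(\<Sum>m\<le>N. \<Sum>k\<le>m. h k (m - k)) = (\<Sum>(k, l)\<in>{(k, l). k + l \<le> N}. h k l)"
    by (rule sum.triangle_reindex_eq[symmetric])
  also have "\<dots> = (\<Sum>(k, l)\<in>{..N} \<times> {..N}. h k l)"
  proof (rule sum.mono_neutral_left)
    show "\<forall>p\<in>{..N} \<times> {..N} - {(k, l). k + l \<le> N}. (case p of (k, l) \<Rightarrow> h k l) = 0"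
    proof
      fix p assume p: "p \<in> {..N} \<times> {..N} - {(k, l). k + l \<le> N}"
      obtain k l where kl: "p = (k, l)" by (cases p)
      with p have "h k l = 0" by (intro assms) auto
      then show "(case p of (k, l) \<Rightarrow> h k l) = 0" by (simp add: kl)
    qed
  qed auto
  finally show ?thesis by (simp add: sum.cartesian_product)
qed

text \<open>Both sides are coefficients at \<open>x\<^sup>i\<close> of polynomials in \<open>x\<close> that agree for all scalars other than 1, by
  \<open>bernoulli_compose_log\<close> and the binomial theorem.\<close>
lemma bernoulli_log_identity:
  assumes "i + j = n"
  shows "(\<Sum>k\<le>n. \<Sum>l\<le>n. mn_coeff k l * (log_series ^ k) $ i * (log_series ^ l) $ j) =
    - (log_coeff (Suc n) + (if i = 0 then 0 else log_coeff n) :: 'k::field_char_0)"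
proof -
  let ?L = "log_series :: 'k fps"
  have L0: "?L $ 0 = 0" by (simp add: log_series_def)
  define g where "g i = (\<Sum>k\<le>n. \<Sum>l\<le>n. mn_coeff k l * (?L ^ k) $ i * (?L ^ l) $ (n - i))" for i
  have compose: "(bernoulli_series oo (?L - Abs_fps (\<lambda>n. x ^ n * ?L $ n))) $ n = - (\<Sum>i\<le>n. g i * x ^ i)" for x
  proof -
    let ?Lx = "Abs_fps (\<lambda>n. x ^ n * ?L $ n)"
    have "((?L - ?Lx) ^ m) $ n = (\<Sum>k\<le>m. of_nat (m choose k) * (- 1) ^ k *
        (\<Sum>i\<le>n. x ^ i * (?L ^ k) $ i * (?L ^ (m - k)) $ (n - i)))" for m
    proof -
      have "(?L - ?Lx) ^ m = (- ?Lx + ?L) ^ m" by simp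
      also have "\<dots> = (\<Sum>k\<le>m. of_nat (m choose k) * (- ?Lx) ^ k * ?L ^ (m - k))"
        by (rule binomial_ring)
      also have "\<dots> = (\<Sum>k\<le>m. fps_const (of_nat (m choose k) * (- 1) ^ k) * (?Lx ^ k * ?L ^ (m - k)))"
        by (intro sum.cong refl)
          (simp add: power_minus[of ?Lx] fps_of_nat[symmetric] mult.assoc flip: fps_const_mult fps_const_neg fps_const_power)
      finally show ?thesis
        by (simp add: fps_sum_nth fps_mult_nth[of "_ ^ _"] scaled_power_nth atLeast0AtMost)
    qed
    then have "(bernoulli_series oo (?L - ?Lx)) $ n = (\<Sum>m\<le>n. bernoulli m / fact m *
        (\<Sum>k\<le>m. of_nat (m choose k) * (- 1) ^ k *
        (\<Sum>i\<le>n. x ^ i * (?L ^ k) $ i * (?L ^ (m - k)) $ (n - i))))"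
      by (simp add: fps_compose_nth bernoulli_series_nth atLeast0AtMost)
    also have "\<dots> = (\<Sum>m\<le>n. \<Sum>k\<le>m. \<Sum>i\<le>n.
        - (mn_coeff k (m - k) * (?L ^ k) $ i * (?L ^ (m - k)) $ (n - i) * x ^ i))"
      unfolding sum_distrib_left
      by (intro sum.cong refl) (simp add: mn_coeff_def)
    also have "\<dots> = (\<Sum>k\<le>n. \<Sum>l\<le>n. \<Sum>i\<le>n.
        - (mn_coeff k l * (?L ^ k) $ i * (?L ^ l) $ (n - i) * x ^ i))"
    proof (rule sum_triangle_rectangle)
      fix k l assume "n < k + l"
      then have "i < k \<or> n - i < l" if "i \<le> n" for i using that by linarith
      then have "(?L ^ k) $ i = 0 \<or> (?L ^ l) $ (n - i) = 0" if "i \<le> n" for i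
        using power_nth_eq_0[OF L0] that by blast
      then show "(\<Sum>i\<le>n. - (mn_coeff k l * (?L ^ k) $ i * (?L ^ l) $ (n - i) * x ^ i)) = 0"
        by (intro sum.neutral) auto
    qed
    also have "\<dots> = (\<Sum>k\<le>n. \<Sum>i\<le>n. \<Sum>l\<le>n. - (mn_coeff k l * (?L ^ k) $ i * (?L ^ l) $ (n - i) * x ^ i))"
      by (intro sum.cong refl sum.swap)
    also have "\<dots> = (\<Sum>i\<le>n. \<Sum>k\<le>n. \<Sum>l\<le>n. - (mn_coeff k l * (?L ^ k) $ i * (?L ^ l) $ (n - i) * x ^ i))"
      by (rule sum.swap)
    also have "\<dots> = - (\<Sum>i\<le>n. g i * x ^ i)"
      by (simp add: g_def sum_negf sum_distrib_right)
    finally show ?thesis .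
  qed
  \<comment> \<open>The difference of the two sides, as the coefficients of a polynomial.\<close>
  let ?c = "\<lambda>i. g i + (log_coeff (Suc n) + (if i = 0 then 0 else log_coeff n))"
  let ?P = "\<Sum>i\<le>n. monom (?c i) i"
  have "poly ?P x = 0" if "x \<noteq> 1" for x
  proof -
    have geo: "(1 - x) * (\<Sum>i\<le>n. x ^ i) = 1 - x ^ Suc n" by (rule sum_gp_basic)
    have "(\<Sum>i\<le>n. (if i = 0 then 0 else log_coeff n) * x ^ i) = log_coeff n * ((\<Sum>i\<le>n. x ^ i) - 1)"
      by (simp add: sum.atMost_shift sum_distrib_left)
    then have "(1 - x) * poly ?P x = (1 - x) * (\<Sum>i\<le>n. g i * x ^ i) +
        log_coeff (Suc n) * ((1 - x) * (\<Sum>i\<le>n. x ^ i)) +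
        log_coeff n * ((1 - x) * (\<Sum>i\<le>n. x ^ i) - (1 - x))"
      by (simp add: poly_sum poly_monom distrib_right sum.distrib flip: sum_distrib_left) (simp add: algebra_simps)
    also have "\<dots> = 0"
      unfolding geo using bernoulli_compose_log[of x n] unfolding compose by (simp add: algebra_simps)
    finally show ?thesis using that by simp
  qed
  then have "UNIV - {1} \<subseteq> {x. poly ?P x = 0}" by auto
  moreover have "infinite (UNIV - {1 :: 'k})" by (simp add: infinite_UNIV_char_0)
  ultimately have "?P = 0" using poly_roots_finite finite_subset by blast
  then have "coeff ?P i = 0" by simp
  moreover have "coeff ?P i = ?c i" using assms by (simp add: coeff_sum sum.delta)
  moreover have "j = n - i" using assms by simp
  ultimately show ?thesis by (simp add: g_def add_eq_0_iff)
qed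

section \<open>The logarithm of iterated integrals\<close>

definition dt_prod :: "'k::field_char_0 whitney list \<Rightarrow> 'k" where
  "dt_prod ws = prod_list (map (\<lambda>w. snd (snd w)) ws)"

definition t_coeff :: "'k::field_char_0 whitney \<Rightarrow> 'k" where
  "t_coeff w = fst w - fst (snd w)"

lemma dt_prod_simps [simp]: "dt_prod [] = 1" "dt_prod (w # ws) = snd (snd w) * dt_prod ws"
  by (simp_all add: dt_prod_def)

lemma dt_prod_append: "dt_prod (us @ ws) = dt_prod us * dt_prod ws"
  by (simp add: dt_prod_def)

lemma scl_whitney_eq: "scl (susp whitney_gvs) c v = (c * fst v, c * fst (snd v), c * snd (snd v))"
  by (cases v) simp

lemma log_taylor_components:
  assumes "ws \<noteq> []"
  shows "fst (log_taylor ws) = (case ws of [w] \<Rightarrow> fst w | _ \<Rightarrow> 0)"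
    "fst (snd (log_taylor ws)) = (case ws of [w] \<Rightarrow> fst (snd w) | _ \<Rightarrow> 0)"
    "snd (snd (log_taylor ws)) = log_coeff (length ws) * dt_prod ws"
  using assms by (auto simp: log_taylor_def Let_def log_coeff_def dt_prod_def split: list.splits)

lemma mlin_whitneyI:
  fixes f :: "'v::plus list \<Rightarrow> 'k::field_char_0 whitney"
  assumes "mlin t (*) (\<lambda>ws. fst (f ws))" "mlin t (*) (\<lambda>ws. fst (snd (f ws)))" "mlin t (*) (\<lambda>ws. snd (snd (f ws)))"
  shows "mlin t (scl (susp whitney_gvs)) f"
  using assms unfolding mlin_def by (intro allI prod_eqI) (simp_all add: scl_whitney_eq)

lemma mlin_dt_prod: "mlin (scl (susp whitney_gvs)) (*) (\<lambda>ws. h (length ws) * dt_prod ws)"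
  by (simp add: mlin_def dt_prod_append scl_whitney_eq algebra_simps)

lemma mlin_single:
  fixes L :: "'v::ab_group_add \<Rightarrow> 'k::field"
  assumes "\<And>c x y. L (t c x + y) = c * L x + L y"
  shows "mlin t (*) (\<lambda>ws. case ws of [w] \<Rightarrow> L w | _ \<Rightarrow> 0)"
  unfolding mlin_def
proof (intro allI)
  fix us ws c x y
  show "(case us @ (t c x + y) # ws of [w] \<Rightarrow> L w | _ \<Rightarrow> 0) =
    c * (case us @ x # ws of [w] \<Rightarrow> L w | _ \<Rightarrow> 0) + (case us @ y # ws of [w] \<Rightarrow> L w | _ \<Rightarrow> 0)"
    by (cases rule: mlin_short_cases[of us ws]) (auto simp: assms)
qed

lemma mlin_pair:
  fixes L L' :: "'v::ab_group_add \<Rightarrow> 'k::field"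
  assumes "\<And>c x y. L (t c x + y) = c * L x + L y" "\<And>c x y. L' (t c x + y) = c * L' x + L' y"
  shows "mlin t (*) (\<lambda>ws. case ws of [v, w] \<Rightarrow> L v * L' w | _ \<Rightarrow> 0)"
  unfolding mlin_def
proof (intro allI)
  fix us ws c x y
  show "(case us @ (t c x + y) # ws of [v, w] \<Rightarrow> L v * L' w | _ \<Rightarrow> 0) =
    c * (case us @ x # ws of [v, w] \<Rightarrow> L v * L' w | _ \<Rightarrow> 0) +
    (case us @ y # ws of [v, w] \<Rightarrow> L v * L' w | _ \<Rightarrow> 0)"
    by (cases rule: mlin_short_cases[of us ws])
      (auto simp: assms distrib_left distrib_right mult_ac split: list.splits)
qed

lemma mlin_log_taylor: "mlin (scl (susp whitney_gvs)) (scl (susp whitney_gvs)) log_taylor"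
proof (rule mlin_whitneyI)
  let ?s = "scl (susp whitney_gvs) :: 'a \<Rightarrow> _"
  show "mlin ?s (*) (\<lambda>ws. fst (log_taylor ws))"
    by (rule mlin_nonempty_cong[THEN iffD1, OF _ mlin_single[where L = fst]])
      (simp_all add: log_taylor_components scl_whitney_eq)
  show "mlin ?s (*) (\<lambda>ws. fst (snd (log_taylor ws)))"
    by (rule mlin_nonempty_cong[THEN iffD1, OF _ mlin_single[where L = "\<lambda>w. fst (snd w)"]])
      (simp_all add: log_taylor_components scl_whitney_eq)
  show "mlin ?s (*) (\<lambda>ws. snd (snd (log_taylor ws)))"
    by (rule mlin_nonempty_cong[THEN iffD1, OF _ mlin_dt_prod[where h = log_coeff]])
      (simp_all add: log_taylor_components)
qed

lemma sgn_map_susp_whitney_eq: "sgn_map (susp whitney_gvs) v = (- fst v, - fst (snd v), snd (snd v))"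
  by (cases v) (simp add: sgn_map_whitney)

lemma log_taylor_sgn:
  assumes "x \<noteq> []"
  shows "log_taylor (map (sgn_map (susp whitney_gvs)) x) = sgn_map (susp whitney_gvs) (log_taylor x)"
proof -
  have p: "dt_prod (map (sgn_map (susp whitney_gvs)) x) = dt_prod x"
    by (simp add: dt_prod_def comp_def sgn_map_susp_whitney_eq)
  show ?thesis
    using assms unfolding sgn_map_susp_whitney_eq[of "log_taylor x"]
    by (intro prod_eqI) (auto simp: log_taylor_components p sgn_map_susp_whitney_eq split: list.splits)
qed

text \<open>The coefficient of \<open>dt\<close> in \<open>m\<^sub>n\<close>, as a sum over the splits of the word in front of the function.  In
  this form \<open>comorph_splits\<close> applies to it.\<close>
definition dt_part_summand :: "'k::field_char_0 whitney list \<Rightarrow> 'k whitney list \<Rightarrow> 'k" where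
  "dt_part_summand x y = (case y of [] \<Rightarrow> 0 | w # y' \<Rightarrow>
     mn_coeff (length x) (length y') * t_coeff w * dt_prod x * dt_prod y')"

lemma dt_part_summand_simps [simp]:
  "dt_part_summand x [] = 0"
  "dt_part_summand x (w # y') = mn_coeff (length x) (length y') * t_coeff w * dt_prod x * dt_prod y'"
  by (simp_all add: dt_part_summand_def)

lemma bernoulli_0_1: "bernoulli 0 = (1 :: 'k::field_char_0)" "bernoulli (Suc 0) = (- 1 / 2 :: 'k)"
  using bernoulli_series_nth[of 0, where ?'a = 'k] bernoulli_series_nth[of 1, where ?'a = 'k]
    bernoulli_series_0_1[where ?'k = 'k] by simp_all

text \<open>The splits give the operations on \<open>t\<close> and \<open>dt\<close>; the last two terms are the products with the unit.\<close>
lemma whitney_Cinf_taylor_components: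
  "fst (whitney_Cinf_taylor ws) = (case ws of [v, w] \<Rightarrow> fst v * fst w | _ \<Rightarrow> 0)"
  "fst (snd (whitney_Cinf_taylor ws)) = (case ws of [v, w] \<Rightarrow> fst (snd v) * fst (snd w) | _ \<Rightarrow> 0)"
  "snd (snd (whitney_Cinf_taylor ws)) = splits dt_part_summand ws +
     ((case ws of [v, w] \<Rightarrow> fst (snd v) * snd (snd w) | _ \<Rightarrow> 0) -
      (case ws of [v, w] \<Rightarrow> snd (snd v) * fst (snd w) | _ \<Rightarrow> 0))"
proof -
  consider "ws = []" | v where "ws = [v]" | v w where "ws = [v, w]" | v w x ws' where "ws = v # w # x # ws'"
    by (metis neq_Nil_conv)
  note cs = this
  show "fst (whitney_Cinf_taylor ws) = (case ws of [v, w] \<Rightarrow> fst v * fst w | _ \<Rightarrow> 0)"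
    "fst (snd (whitney_Cinf_taylor ws)) = (case ws of [v, w] \<Rightarrow> fst (snd v) * fst (snd w) | _ \<Rightarrow> 0)"
    using cs by (cases; simp add: whitney_Cinf_taylor_def whitney_d_def split_def Let_def)+
  show "snd (snd (whitney_Cinf_taylor ws)) = splits dt_part_summand ws +
     ((case ws of [v, w] \<Rightarrow> fst (snd v) * snd (snd w) | _ \<Rightarrow> 0) -
      (case ws of [v, w] \<Rightarrow> snd (snd v) * fst (snd w) | _ \<Rightarrow> 0))"
    using cs
  proof cases
    case 1 then show ?thesis by (simp add: whitney_Cinf_taylor_def)
  next
    case (2 v)
    then show ?thesis
      by (simp add: whitney_Cinf_taylor_def whitney_d_def split_def mn_coeff_def bernoulli_0_1 t_coeff_def)
  next
    case (3 v w)
    then show ?thesis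
      by (simp add: whitney_Cinf_taylor_def split_def mn_coeff_def bernoulli_0_1 t_coeff_def field_simps)
  next
    case (4 v w x ws')
    define n where "n = length ws - 1"
    have len: "length ws = Suc n" using 4 by (simp add: n_def)
    let ?c = "\<lambda>w :: 'a whitney. snd (snd w)"
    have prod: "(\<Prod>j\<in>{..n} - {i}. ?c (ws ! j)) = dt_prod (take i ws) * dt_prod (drop (Suc i) ws)" if i: "i \<le> n" for i
    proof -
      \<comment> \<open>Omitting a factor is replacing it by 1.\<close>
      have "dt_prod (take i ws) * dt_prod (drop (Suc i) ws) = prod_list ((map ?c ws)[i := 1])"
        using i len by (simp add: dt_prod_def upd_conv_take_nth_drop take_map drop_map)
      also have "\<dots> = (\<Prod>j = 0..<Suc n. (map ?c ws)[i := 1] ! j)"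
        by (simp only: prod.list_conv_set_nth length_list_update length_map len)
      also have "{0..<Suc n} = {..n}" by auto
      also have "(\<Prod>j\<in>{..n}. (map ?c ws)[i := 1] ! j) =
          (map ?c ws)[i := 1] ! i * (\<Prod>j\<in>{..n} - {i}. (map ?c ws)[i := 1] ! j)"
        using i by (intro prod.remove) auto
      also have "\<dots> = (\<Prod>j\<in>{..n} - {i}. ?c (ws ! j))"
        using i len by (simp add: nth_list_update)
      finally show ?thesis ..
    qed
    have "splits dt_part_summand ws = (\<Sum>i\<le>n. dt_part_summand (take i ws) (drop i ws))"
      by (simp add: splits_eq_sum len)
    also have "\<dots> = (\<Sum>i\<le>n. (- 1) ^ (i + 1) * of_nat (n choose i) * bernoulli n / fact n *
        t_coeff (ws ! i) * (\<Prod>j\<in>{..n} - {i}. ?c (ws ! j)))"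
    proof (intro sum.cong refl)
      fix i assume "i \<in> {..n}"
      then have i: "i \<le> n" by simp
      then have "drop i ws = ws ! i # drop (Suc i) ws" using len by (simp add: Cons_nth_drop_Suc)
      then show "dt_part_summand (take i ws) (drop i ws) = (- 1) ^ (i + 1) * of_nat (n choose i) * bernoulli n / fact n *
        t_coeff (ws ! i) * (\<Prod>j\<in>{..n} - {i}. ?c (ws ! j))"
        using i len by (simp add: prod mn_coeff_def)
    qed
    finally show ?thesis
      by (simp add: 4 whitney_Cinf_taylor_def Let_def n_def t_coeff_def)
  qed
qed

lemma t_coeff_linear: "t_coeff (scl (susp whitney_gvs) c x + y) = c * t_coeff x + t_coeff y"
  by (simp add: t_coeff_def scl_whitney_eq algebra_simps)

lemma mlin_whitney_Cinf_taylor: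
  "mlin (scl (susp whitney_gvs)) (scl (susp whitney_gvs)) whitney_Cinf_taylor"
proof (rule mlin_whitneyI, unfold whitney_Cinf_taylor_components)
  let ?s = "scl (susp whitney_gvs) :: 'a \<Rightarrow> _"
  show "mlin ?s (*) (\<lambda>ws. case ws of [v, w] \<Rightarrow> fst v * fst w | _ \<Rightarrow> 0)"
    by (rule mlin_pair) (simp_all add: scl_whitney_eq)
  show "mlin ?s (*) (\<lambda>ws. case ws of [v, w] \<Rightarrow> fst (snd v) * fst (snd w) | _ \<Rightarrow> 0)"
    by (rule mlin_pair) (simp_all add: scl_whitney_eq)
  have 1: "mlin ?s (*) (\<lambda>ws. case ws of [v, w] \<Rightarrow> fst (snd v) * snd (snd w) | _ \<Rightarrow> 0)"
    by (rule mlin_pair) (simp_all add: scl_whitney_eq)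
  have 2: "mlin ?s (*) (\<lambda>ws. case ws of [v, w] \<Rightarrow> snd (snd v) * fst (snd w) | _ \<Rightarrow> 0)"
    by (rule mlin_pair) (simp_all add: scl_whitney_eq)
  have 3: "mlin ?s (*) (splits dt_part_summand)"
  proof (rule mlin_splits[OF additive_times'])
    fix y
    show "mlin ?s (*) (\<lambda>x. dt_part_summand x y)"
      using mlin_dt_prod[where h = "\<lambda>k. case y of [] \<Rightarrow> 0 | w # y' \<Rightarrow> mn_coeff k (length y') * t_coeff w * dt_prod y'"]
      by (cases y) (simp_all add: mult.assoc mult.left_commute mult.commute)
  next
    fix x
    show "mlin ?s (*) (dt_part_summand x)"
      unfolding mlin_def
    proof (intro allI)
      fix us ws :: "'a whitney list" and c v v'
      show "dt_part_summand x (us @ (?s c v + v') # ws) =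
          c * dt_part_summand x (us @ v # ws) + dt_part_summand x (us @ v' # ws)"
        by (cases us) (simp_all add: t_coeff_linear dt_prod_append, simp_all add: scl_whitney_eq algebra_simps)
    qed
  qed
  have "mlin ?s (*) (\<lambda>ws. splits dt_part_summand ws + (1 * (case ws of [v, w] \<Rightarrow> fst (snd v) * snd (snd w) | _ \<Rightarrow> 0) +
      (- 1) * (case ws of [v, w] \<Rightarrow> snd (snd v) * fst (snd w) | _ \<Rightarrow> 0)))"
    using 1 2 3 unfolding multilin_iff_mlin[symmetric] by (intro multilin_add multilin_scale)
  then show "mlin ?s (*) (\<lambda>ws. splits dt_part_summand ws + ((case ws of [v, w] \<Rightarrow> fst (snd v) * snd (snd w) | _ \<Rightarrow> 0) -
      (case ws of [v, w] \<Rightarrow> snd (snd v) * fst (snd w) | _ \<Rightarrow> 0)))" by simp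
qed

lemma splits_nonzero: "splits B u \<noteq> 0 \<Longrightarrow> \<exists>x y. x @ y = u \<and> B x y \<noteq> 0"
  by (metis splits_cong splits_zero)

lemma dt_prod_nonzero_degree:
  assumes "list_all2 (homogeneous (susp whitney_gvs)) ds vs" "dt_prod vs \<noteq> 0"
  shows "sum_list ds = 0"
  using assms
proof (induction rule: list_all2_induct)
  case (Cons d ds v vs)
  then show ?case by (cases v) (auto simp: homogeneous_susp_whitney)
qed simp

lemma whitney_Cinf_taylor_degree:
  assumes vs: "vs \<noteq> []" "list_all2 (homogeneous (susp whitney_gvs)) ds vs"
  shows "homogeneous (susp whitney_gvs) (sum_list ds + 1) (whitney_Cinf_taylor vs)"
proof -
  have dt: "splits dt_part_summand vs = 0" if "sum_list ds + 1 \<noteq> 0"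
  proof (rule ccontr)
    assume "splits dt_part_summand vs \<noteq> 0"
    then obtain x y where xy: "x @ y = vs" "dt_part_summand x y \<noteq> 0" using splits_nonzero by blast
    then obtain w y' where y: "y = w # y'" by (cases y) auto
    with xy(2) have nz: "dt_prod x \<noteq> 0" "dt_prod y' \<noteq> 0" "t_coeff w \<noteq> 0" by auto
    from vs(2) xy(1) y obtain d1 d d2 where ds: "ds = d1 @ d # d2"
      "list_all2 (homogeneous (susp whitney_gvs)) d1 x" "homogeneous (susp whitney_gvs) d w"
      "list_all2 (homogeneous (susp whitney_gvs)) d2 y'"
      by (auto simp: list_all2_append2 list_all2_Cons2)
    have "d = - 1" using ds(3) nz(3) by (cases w) (auto simp: homogeneous_susp_whitney t_coeff_def)
    with dt_prod_nonzero_degree[OF ds(2) nz(1)] dt_prod_nonzero_degree[OF ds(4) nz(2)] that show False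
      by (simp add: ds(1))
  qed
  obtain a b c where abc: "whitney_Cinf_taylor vs = (a, b, c)" by (cases "whitney_Cinf_taylor vs")
  show ?thesis
  proof (cases "\<exists>v w. vs = [v, w]")
    case True
    then obtain v w d d' where vw: "vs = [v, w]" "ds = [d, d']" "homogeneous (susp whitney_gvs) d v"
        "homogeneous (susp whitney_gvs) d' w"
      using vs(2) by (auto simp: list_all2_Cons2)
    with whitney_Cinf_taylor_components[of vs] dt show ?thesis
      unfolding abc by (cases v; cases w) (auto simp: homogeneous_susp_whitney)
  next
    case False
    have "(case vs of [v, w] \<Rightarrow> h v w | _ \<Rightarrow> 0) = 0" for h :: "'a whitney \<Rightarrow> 'a whitney \<Rightarrow> 'a"
      using False by (auto split: list.splits)
    with whitney_Cinf_taylor_components[of vs] dt show ?thesis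
      unfolding abc by (auto simp: homogeneous_susp_whitney)
  qed
qed

lemma coder_cup_taylor:
  assumes "multiadd M"
  shows "coder (sgn_map (susp whitney_gvs)) cup_taylor M (v # u) = M ((0, 0, - t_coeff v) # u) +
    (case u of [] \<Rightarrow> 0 | w # u' \<Rightarrow> M ((fst v * fst w, fst (snd v) * fst (snd w),
        fst (snd v) * snd (snd w) - snd (snd v) * fst w) # u')) +
    coder (sgn_map (susp whitney_gvs)) cup_taylor (\<lambda>ws. M ((- fst v, - fst (snd v), snd (snd v)) # ws)) u"
  using coder_bar_taylor[OF assms, of "sgn_map (susp whitney_gvs)" "sgn_map whitney_gvs" whitney_d cup v u]
  unfolding dga_taylor_eq_bar
  by (cases v) (simp add: sgn_map_whitney whitney_d_def t_coeff_def cup_def split_def split: list.splits)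

lemma multiadd_dt_prod: "multiadd (\<lambda>ws. h (length ws) * dt_prod ws)"
  by (rule mlin_multiadd[OF mlin_dt_prod]) (simp_all add: scl_whitney_eq)

text \<open>An arbitrary weight \<open>h\<close> of the length is used because removing the first letter shifts the
  length by one.\<close>
lemma coder_cup_dt_prod:
  fixes h :: "nat \<Rightarrow> 'k::field_char_0"
  shows "coder (sgn_map (susp whitney_gvs)) cup_taylor (\<lambda>ws. h (length ws) * dt_prod ws) u =
    splits (\<lambda>x y. case y of [] \<Rightarrow> 0 | v # y' \<Rightarrow> (- h (length u) * t_coeff v + h (length u - 1) *
       ((if y' = [] then 0 else fst (snd v)) - (if x = [] then 0 else fst v))) * dt_prod x * dt_prod y') u"
proof (induction u arbitrary: h)
  case (Cons v u)
  let ?C = "coder (sgn_map (susp whitney_gvs)) cup_taylor"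
  let ?m = "length u"
  let ?c = "snd (snd v)"
  let ?A = "\<lambda>x y. case y of [] \<Rightarrow> 0 | w # y' \<Rightarrow> (- h (Suc ?m) * t_coeff w + h ?m *
       ((if y' = [] then 0 else fst (snd w)) - (if x = [] then 0 else fst w))) * dt_prod x * dt_prod y'"
  have "?C (\<lambda>ws. h (Suc (length ws)) * (?c * dt_prod ws)) u = ?c * ?C (\<lambda>ws. h (Suc (length ws)) * dt_prod ws) u"
    by (simp add: coder_additive[OF additive_times] mult.left_commute)
  also have "\<dots> = ?c * splits ?A u"
    unfolding Cons.IH[of "\<lambda>n. h (Suc n)"]
    by (intro arg_cong[of _ _ "\<lambda>z. ?c * z"] splits_cong) (auto split: list.splits)
  finally have rec: "?C (\<lambda>ws. h (Suc (length ws)) * (?c * dt_prod ws)) u = ?c * splits ?A u" .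
  have "splits (\<lambda>x y. case y of [] \<Rightarrow> 0 | w # y' \<Rightarrow> (- h (Suc ?m) * t_coeff w + h ?m *
       ((if y' = [] then 0 else fst (snd w)) - fst w)) * (?c * dt_prod x) * dt_prod y') u =
     splits (\<lambda>x y. ?c * ?A x y + (if x = [] then (case y of [] \<Rightarrow> 0 | w # y' \<Rightarrow> - h ?m * (?c * fst w) * dt_prod y') else 0)) u"
    by (intro splits_cong) (auto simp: algebra_simps split: list.splits)
  also have "\<dots> = ?c * splits ?A u + (case u of [] \<Rightarrow> 0 | w # y' \<Rightarrow> - h ?m * (?c * fst w) * dt_prod y')"
    by (simp only: splits_add splits_left_Nil splits_times)
  finally show ?case
    unfolding coder_cup_taylor[OF multiadd_dt_prod]
    by (simp add: rec, simp add: algebra_simps split: list.splits)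
qed simp

lemma log_conv_power:
  "reduced_conv_power (\<lambda>x. snd (snd (log_taylor x))) k u = (log_series ^ k) $ length u * dt_prod u"
proof (induction k arbitrary: u)
  case 0 then show ?case by (simp add: fps_one_nth)
next
  case (Suc k)
  have "reduced_conv_power (\<lambda>x. snd (snd (log_taylor x))) (Suc k) u =
      (\<Sum>i\<le>length u. log_coeff i * (log_series ^ k) $ (length u - i) * dt_prod u)"
    unfolding reduced_conv_power.simps splits_eq_sum
  proof (intro sum.cong refl)
    fix i assume i: "i \<in> {..length u}"
    have u: "dt_prod u = dt_prod (take i u) * dt_prod (drop i u)"
      by (simp flip: dt_prod_append)
    show "(if take i u = [] then 0 else snd (snd (log_taylor (take i u))) *
        reduced_conv_power (\<lambda>x. snd (snd (log_taylor x))) k (drop i u)) =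
        log_coeff i * (log_series ^ k) $ (length u - i) * dt_prod u"
    proof (cases "take i u = []")
      case True
      then have "i = 0" using i by auto
      then show ?thesis by simp
    next
      case False
      then show ?thesis
        unfolding u using i by (simp add: log_taylor_components Suc mult.assoc mult.left_commute)
    qed
  qed
  then show ?case
    by (simp add: fps_mult_nth sum_distrib_right atLeast0AtMost log_series_def)
qed

lemma comorph_log_dt_prod:
  assumes "length u \<le> N"
  shows "comorph log_taylor (\<lambda>ws. h (length ws) * dt_prod ws) u =
    (\<Sum>k\<le>N. h k * (log_series ^ k) $ length u) * dt_prod u"
proof -
  have "comorph log_taylor (\<lambda>ws. h (length ws) * dt_prod ws) u =
      comorph (\<lambda>x. snd (snd (log_taylor x))) (\<lambda>ks. h (length ks) * prod_list ks) u"
    using comorph_map_out[of log_taylor "\<lambda>ks. h (length ks) * prod_list ks" "\<lambda>w. snd (snd w)" u]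
    by (simp add: dt_prod_def)
  also have "\<dots> = (\<Sum>k\<le>N. h k * reduced_conv_power (\<lambda>x. snd (snd (log_taylor x))) k u)"
    by (rule comorph_eq_conv_power[OF assms])
  finally show ?thesis by (simp add: log_conv_power sum_distrib_right mult.assoc)
qed

text \<open>The function must be a block of its own.  The blocks on either side contribute powers of the
  logarithm series, and the sum over their numbers is \<open>bernoulli_log_identity\<close>.\<close>
lemma comorph_log_dt_part:
  fixes u :: "'k::field_char_0 whitney list"
  shows "comorph log_taylor (splits dt_part_summand) u =
    splits (\<lambda>x y. case y of [] \<Rightarrow> 0 | v # y' \<Rightarrow>
      - (log_coeff (length u) + (if x = [] then 0 else log_coeff (length u - 1))) *
      t_coeff v * dt_prod x * dt_prod y') u"
  unfolding comorph_splits
proof (intro splits_cong)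
  fix x y assume xy: "x @ y = u"
  show "comorph log_taylor (\<lambda>x'. comorph log_taylor (dt_part_summand x') y) x =
    (case y of [] \<Rightarrow> 0 | v # y' \<Rightarrow>
      - (log_coeff (length u) + (if x = [] then 0 else log_coeff (length u - 1))) *
      t_coeff v * dt_prod x * dt_prod y')"
  proof (cases y)
    case (Cons v y')
    define n where "n = length x + length y'"
    have u: "length u = Suc n" using xy Cons by (auto simp: n_def)
    have inner: "comorph log_taylor (dt_part_summand x') y =
        (\<Sum>l\<le>n. mn_coeff (length x') l * (log_series ^ l) $ length y') * t_coeff v * dt_prod y' * dt_prod x'" for x'
    proof -
      have "comorph log_taylor (dt_part_summand x') y = splits (\<lambda>p q. case p of [v] \<Rightarrow>
          comorph log_taylor (\<lambda>ws. (mn_coeff (length x') (length ws) * t_coeff v * dt_prod x') * dt_prod ws) q | _ \<Rightarrow> 0) y"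
        unfolding comorph_rec[of y, unfolded Cons, OF list.distinct(2)] Cons
      proof (intro splits_cong)
        fix p q :: "'k whitney list"
        have "t_coeff (log_taylor p) = (case p of [v] \<Rightarrow> t_coeff v | _ \<Rightarrow> 0)" if "p \<noteq> []"
          using that by (auto simp: t_coeff_def log_taylor_components split: list.splits)
        then show "(if p = [] then 0 else comorph log_taylor (\<lambda>ws. dt_part_summand x' (log_taylor p # ws)) q) =
          (case p of [v] \<Rightarrow> comorph log_taylor
            (\<lambda>ws. (mn_coeff (length x') (length ws) * t_coeff v * dt_prod x') * dt_prod ws) q | _ \<Rightarrow> 0)"
          by (auto split: list.splits)
      qed
      also have "\<dots> = comorph log_taylor (\<lambda>ws. (mn_coeff (length x') (length ws) * t_coeff v * dt_prod x') * dt_prod ws) y'"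
        unfolding Cons by (rule splits_left_single)
      also have "\<dots> = (\<Sum>l\<le>n. (mn_coeff (length x') l * t_coeff v * dt_prod x') * (log_series ^ l) $ length y') * dt_prod y'"
        by (rule comorph_log_dt_prod[where h = "\<lambda>l. mn_coeff (length x') l * t_coeff v * dt_prod x'"]) (simp add: n_def)
      finally show ?thesis by (simp only: sum_distrib_left sum_distrib_right mult_ac)
    qed
    have "comorph log_taylor (\<lambda>x'. comorph log_taylor (dt_part_summand x') y) x =
        (\<Sum>k\<le>n. ((\<Sum>l\<le>n. mn_coeff k l * (log_series ^ l) $ length y') * t_coeff v * dt_prod y') *
          (log_series ^ k) $ length x) * dt_prod x"
      unfolding inner
      by (rule comorph_log_dt_prod[where h = "\<lambda>k. (\<Sum>l\<le>n. mn_coeff k l * (log_series ^ l) $ length y') * t_coeff v * dt_prod y'"])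
        (simp add: n_def)
    also have "\<dots> = (\<Sum>k\<le>n. \<Sum>l\<le>n. mn_coeff k l * (log_series ^ k) $ length x * (log_series ^ l) $ length y') *
        t_coeff v * dt_prod x * dt_prod y'"
      by (simp only: sum_distrib_right sum_distrib_left mult_ac)
    also have "(\<Sum>k\<le>n. \<Sum>l\<le>n. mn_coeff k l * (log_series ^ k) $ length x * (log_series ^ l) $ length y') =
        - (log_coeff (Suc n) + (if length x = 0 then 0 else log_coeff n) :: 'k)"
      by (rule bernoulli_log_identity) (simp add: n_def)
    finally show ?thesis using u Cons by simp
  qed simp
qed

lemma comorph_log_pair:
  fixes L L' :: "'k::field_char_0 whitney \<Rightarrow> 'k"
  assumes u: "u \<noteq> []"
  shows "comorph log_taylor (\<lambda>ws. case ws of [v, w] \<Rightarrow> L v * L' w | _ \<Rightarrow> 0) u =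
    splits (\<lambda>x y. if x = [] \<or> y = [] then 0 else L (log_taylor x) * L' (log_taylor y)) u"
  by (subst comorph_quadratic) (simp_all add: u cong: if_cong)

lemma coder_cup_log_single:
  fixes L :: "'k::field_char_0 whitney \<Rightarrow> 'k"
  assumes L: "Modules.additive L" and dt: "\<And>c. L (0, 0, c) = 0" and u: "u \<noteq> []"
    and mult: "\<And>v w c. L (fst v * fst w, fst (snd v) * fst (snd w), c) = L v * L w"
  shows "coder (sgn_map (susp whitney_gvs)) cup_taylor (\<lambda>ws. case ws of [w] \<Rightarrow> L w | _ \<Rightarrow> 0) u =
    (case u of [v, w] \<Rightarrow> L v * L w | _ \<Rightarrow> 0)"
proof -
  let ?E = "\<lambda>ws. case ws of [w] \<Rightarrow> L w | _ \<Rightarrow> 0"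
  have E: "multiadd ?E"
    unfolding multiadd_def
  proof (intro allI)
    fix us ws :: "'k whitney list"
    show "Modules.additive (\<lambda>v. ?E (us @ v # ws))"
      using Modules.additive.add[OF L]
      by (cases rule: mlin_short_cases[of us ws]) (auto simp: Modules.additive_def)
  qed
  obtain v u' where uv: "u = v # u'" using u by (cases u) auto
  have "coder (sgn_map (susp whitney_gvs)) cup_taylor (\<lambda>ws. ?E (a # ws)) u' =
      coder (sgn_map (susp whitney_gvs)) cup_taylor (\<lambda>ws. 0) u'" for a
    by (intro coder_cong) (auto simp: neq_Nil_conv)
  then show ?thesis
    unfolding uv coder_cup_taylor[OF E] by (auto simp: dt mult split: list.splits)
qed

text \<open>Both sides are sums over the position of the function.  They differ by a telescoping sum in the
  coefficients of the unit, which is the contribution of the products with the unit (\<open>rest\<close>).\<close>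
lemma log_intertwines:
  fixes u :: "'k::field_char_0 whitney list"
  assumes u: "u \<noteq> []"
  shows "coder (sgn_map (susp whitney_gvs)) cup_taylor log_taylor u = comorph log_taylor whitney_Cinf_taylor u"
proof -
  let ?C = "coder (sgn_map (susp whitney_gvs)) cup_taylor"
  let ?N = "length u"
  have single: "fst (?C log_taylor u) = fst (comorph log_taylor whitney_Cinf_taylor u)"
  proof -
    have "fst (?C log_taylor u) = ?C (\<lambda>ws. case ws of [w] \<Rightarrow> fst w | _ \<Rightarrow> 0) u"
      unfolding coder_additive[OF additive_fst_whitney] by (intro coder_cong) (simp add: log_taylor_components)
    also have "\<dots> = (case u of [v, w] \<Rightarrow> fst v * fst w | _ \<Rightarrow> 0)"
      by (rule coder_cup_log_single) (simp_all add: u Modules.additive_def)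
    also have "\<dots> = splits (\<lambda>x y. (case x of [v] \<Rightarrow> fst v | _ \<Rightarrow> 0) * (case y of [v] \<Rightarrow> fst v | _ \<Rightarrow> 0)) u"
      by (simp add: splits_two_singles)
    also have "\<dots> = comorph log_taylor (\<lambda>ws. case ws of [v, w] \<Rightarrow> fst v * fst w | _ \<Rightarrow> 0) u"
      unfolding comorph_log_pair[OF u] by (intro splits_cong) (auto simp: log_taylor_components)
    finally show ?thesis
      by (simp add: comorph_additive[OF additive_fst_whitney] whitney_Cinf_taylor_components)
  qed
  have single': "fst (snd (?C log_taylor u)) = fst (snd (comorph log_taylor whitney_Cinf_taylor u))"
  proof -
    have "fst (snd (?C log_taylor u)) = ?C (\<lambda>ws. case ws of [w] \<Rightarrow> fst (snd w) | _ \<Rightarrow> 0) u"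
      unfolding coder_additive[OF additive_fst_snd_whitney] by (intro coder_cong) (simp add: log_taylor_components)
    also have "\<dots> = (case u of [v, w] \<Rightarrow> fst (snd v) * fst (snd w) | _ \<Rightarrow> 0)"
      by (rule coder_cup_log_single) (simp_all add: u Modules.additive_def)
    also have "\<dots> = splits (\<lambda>x y. (case x of [v] \<Rightarrow> fst (snd v) | _ \<Rightarrow> 0) * (case y of [v] \<Rightarrow> fst (snd v) | _ \<Rightarrow> 0)) u"
      by (simp add: splits_two_singles)
    also have "\<dots> = comorph log_taylor (\<lambda>ws. case ws of [v, w] \<Rightarrow> fst (snd v) * fst (snd w) | _ \<Rightarrow> 0) u"
      unfolding comorph_log_pair[OF u] by (intro splits_cong) (auto simp: log_taylor_components)
    finally show ?thesis
      by (simp add: comorph_additive[OF additive_fst_snd_whitney] whitney_Cinf_taylor_components)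
  qed
  define rest where "rest = log_coeff (?N - 1) *
     (fst (snd (hd u)) * dt_prod (tl u) - dt_prod (butlast u) * fst (snd (last u)))"
  have L: "snd (snd (?C log_taylor u)) = comorph log_taylor (splits dt_part_summand) u + rest"
  proof -
    let ?b = "\<lambda>v :: 'k whitney. fst (snd v)"
    have "snd (snd (?C log_taylor u)) = ?C (\<lambda>ws. log_coeff (length ws) * dt_prod ws) u"
      unfolding coder_additive[OF additive_snd_snd_whitney] by (intro coder_cong) (simp add: log_taylor_components)
    also have "\<dots> = splits (\<lambda>x y. (case y of [] \<Rightarrow> 0 | v # y' \<Rightarrow>
        - (log_coeff ?N + (if x = [] then 0 else log_coeff (?N - 1))) * t_coeff v * dt_prod x * dt_prod y') +
        ((if x = [] then (case y of [] \<Rightarrow> 0 | v # y' \<Rightarrow> log_coeff (?N - 1) * (?b v * dt_prod y')) else 0) +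
         (case y of [v] \<Rightarrow> - log_coeff (?N - 1) * (dt_prod x * ?b v) | _ \<Rightarrow> 0))) u"
      unfolding coder_cup_dt_prod
      by (intro splits_cong) (auto simp: t_coeff_def algebra_simps split: list.splits)
    also have "\<dots> = comorph log_taylor (splits dt_part_summand) u +
        ((case u of [] \<Rightarrow> 0 | v # y' \<Rightarrow> log_coeff (?N - 1) * (?b v * dt_prod y')) +
         (- log_coeff (?N - 1) * (dt_prod (butlast u) * ?b (last u))))"
      using splits_right_single[of "\<lambda>x v. - log_coeff (?N - 1) * (dt_prod x * ?b v)" "butlast u" "last u"] u
      by (simp add: splits_add splits_left_Nil comorph_log_dt_part)
    also have "\<dots> = comorph log_taylor (splits dt_part_summand) u + rest"
      using u by (cases u) (simp_all add: rest_def right_diff_distrib)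
    finally show ?thesis .
  qed
  let ?U = "\<lambda>ws :: 'k whitney list. case ws of [v, w] \<Rightarrow> fst (snd v) * snd (snd w) | _ \<Rightarrow> 0"
  let ?U' = "\<lambda>ws :: 'k whitney list. case ws of [v, w] \<Rightarrow> snd (snd v) * fst (snd w) | _ \<Rightarrow> 0"
  have U: "comorph log_taylor ?U u + - comorph log_taylor ?U' u = rest"
  proof (cases "?N = 1")
    case True
    then obtain v where "u = [v]" by (auto simp: length_Suc_conv)
    then show ?thesis by (simp add: comorph_log_pair rest_def)
  next
    case False
    let ?g = "\<lambda>x :: 'k whitney list. log_coeff (length x) * dt_prod x"
    have short: "x = [] \<Longrightarrow> length y \<noteq> 1" "y = [] \<Longrightarrow> length x \<noteq> 1" if "x @ y = u" for x y
      using that False by auto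
    have "comorph log_taylor ?U u = splits (\<lambda>x y. case x of [v] \<Rightarrow> fst (snd v) * ?g y | _ \<Rightarrow> 0) u"
      unfolding comorph_log_pair[OF u]
      by (intro splits_cong) (auto simp: log_taylor_components dest: short split: list.splits)
    also have "\<dots> = fst (snd (hd u)) * ?g (tl u)"
      using splits_left_single[of "\<lambda>v y. fst (snd v) * ?g y" "hd u" "tl u"] u by simp
    finally have 1: "comorph log_taylor ?U u = fst (snd (hd u)) * ?g (tl u)" .
    have "comorph log_taylor ?U' u = splits (\<lambda>x y. case y of [v] \<Rightarrow> ?g x * fst (snd v) | _ \<Rightarrow> 0) u"
      unfolding comorph_log_pair[OF u]
      by (intro splits_cong) (auto simp: log_taylor_components dest: short split: list.splits)
    also have "\<dots> = ?g (butlast u) * fst (snd (last u))"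
      using splits_right_single[of "\<lambda>x v. ?g x * fst (snd v)" "butlast u" "last u"] u by simp
    finally show ?thesis using 1 by (simp add: rest_def algebra_simps)
  qed
  have "snd (snd (comorph log_taylor whitney_Cinf_taylor u)) =
      comorph log_taylor (\<lambda>ws. splits dt_part_summand ws + (?U ws + - ?U' ws)) u"
    by (simp add: comorph_additive[OF additive_snd_snd_whitney] whitney_Cinf_taylor_components)
  also have "\<dots> = comorph log_taylor (splits dt_part_summand) u + (comorph log_taylor ?U u + - comorph log_taylor ?U' u)"
    unfolding comorph_add using comorph_additive[of uminus log_taylor ?U' u] by (simp add: Modules.additive_def)
  finally have "snd (snd (?C log_taylor u)) = snd (snd (comorph log_taylor whitney_Cinf_taylor u))"
    using L U by simp
  with single single' show ?thesis by (intro prod_eqI)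
qed


lemma comorph_fun_cong:
  assumes "\<And>x. x \<noteq> [] \<Longrightarrow> f x = g x"
  shows "comorph f M u = comorph g M u"
  unfolding comorph_def
proof (intro sum.cong refl arg_cong[of _ _ M] map_cong)
  fix bs b assume "bs \<in> blocks u" "b \<in> set bs"
  then have "b \<noteq> []" by (auto simp: blocks_def)
  then show "f b = g b" by (rule assms)
qed

lemma shuffle_map: "shuffle (\<lambda>z. M (map g z)) u w = shuffle M (map (apsnd g) u) (map (apsnd g) w)"
proof -
  have parity: "parity (map (apsnd g) u) = parity u" for u by (induction u) simp_all
  show ?thesis
  proof (induction "\<lambda>z. M (map g z)" u w arbitrary: M rule: shuffle.induct)
    case (3 a u b w)
    have "shuffle (\<lambda>z. M (g (snd a) # map g z)) u (b # w) =
        shuffle (\<lambda>z. M (g (snd a) # z)) (map (apsnd g) u) (map (apsnd g) (b # w))"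
      using 3(1)[of "\<lambda>z. M (g (snd a) # z)"] by simp
    moreover have "shuffle (\<lambda>z. M (g (snd b) # map g z)) (a # u) w =
        shuffle (\<lambda>z. M (g (snd b) # z)) (map (apsnd g) (a # u)) (map (apsnd g) w)"
      using 3(2)[of "\<lambda>z. M (g (snd b) # z)"] by simp
    ultimately show ?case using parity[of "a # u"] by simp
  qed (simp_all add: comp_def)
qed

context iter_int begin

text \<open>The convolution logarithm of the iterated integrals.\<close>
definition Phi :: "'a list \<Rightarrow> 'k" where
  "Phi = comorph I (\<lambda>ks. log_coeff (length ks) * prod_list ks)"

abbreviation phi :: "'a form list \<Rightarrow> 'k whitney" where
  "phi \<equiv> lambda_taylor ev1 ev0 Phi"

lemma mlin_Phi: "mlin s (*) Phi"
  unfolding Phi_def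
  by (rule mlin_comorph[OF additive_times' mlin_I]) (simp add: mlin_def algebra_simps)

lemma Phi_single: "Phi [a] = I [a]"
  by (simp add: Phi_def comorph_rec log_coeff_def)

text \<open>So \<open>\<phi>\<close> is built like \<open>\<lambda>\<close>, with \<open>I\<close> replaced by its logarithm.\<close>
lemma log_lambda_eq_phi:
  assumes u: "u \<noteq> []"
  shows "comorph lam log_taylor u = phi u"
proof -
  have single: "comorph lam (\<lambda>ws. case ws of [w] \<Rightarrow> L w | _ \<Rightarrow> 0) u = (L (lam u) :: 'k)" for L
  proof -
    have "comorph lam (\<lambda>ws. case ws of [w] \<Rightarrow> L w | _ \<Rightarrow> 0) u =
        splits (\<lambda>x y. if y = [] then L (lam x) else 0) u"
      unfolding comorph_rec[OF u]
    proof (intro splits_cong)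
      fix x y assume xy: "x @ y = u"
      have "comorph lam (\<lambda>ws. case lam x # ws of [w] \<Rightarrow> L w | _ \<Rightarrow> 0) y = comorph lam (\<lambda>ws. 0) y" if "y \<noteq> []"
        using that by (intro comorph_cong) (auto simp: neq_Nil_conv)
      with xy u show "(if x = [] then 0 else comorph lam (\<lambda>ws. case lam x # ws of [w] \<Rightarrow> L w | _ \<Rightarrow> 0) y) =
          (if y = [] then L (lam x) else 0)" by auto
    qed
    then show ?thesis by (simp add: splits_right_Nil)
  qed
  have "fst (comorph lam log_taylor u) = comorph lam (\<lambda>ws. case ws of [w] \<Rightarrow> fst w | _ \<Rightarrow> 0) u"
    unfolding comorph_additive[OF additive_fst_whitney] by (intro comorph_cong) (simp add: u log_taylor_components)
  moreover have "fst (snd (comorph lam log_taylor u)) = comorph lam (\<lambda>ws. case ws of [w] \<Rightarrow> fst (snd w) | _ \<Rightarrow> 0) u"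
    unfolding comorph_additive[OF additive_fst_snd_whitney] by (intro comorph_cong) (simp add: u log_taylor_components)
  moreover have "snd (snd (comorph lam log_taylor u)) = Phi (map snd u)"
  proof -
    have "snd (snd (comorph lam log_taylor u)) = comorph lam (\<lambda>ws. log_coeff (length ws) * dt_prod ws) u"
      unfolding comorph_additive[OF additive_snd_snd_whitney] by (intro comorph_cong) (simp add: u log_taylor_components)
    also have "\<dots> = comorph (\<lambda>x. snd (snd (lam x))) (\<lambda>ks. log_coeff (length ks) * prod_list ks) u"
      using comorph_map_out[of lam "\<lambda>ks. log_coeff (length ks) * prod_list ks" "\<lambda>w. snd (snd w)" u]
      by (simp add: dt_prod_def)
    also have "\<dots> = comorph (\<lambda>x. I (map snd x)) (\<lambda>ks. log_coeff (length ks) * prod_list ks) u"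
      by (rule comorph_fun_cong) (simp add: lambda_taylor_components)
    finally show ?thesis by (simp add: Phi_def comorph_map)
  qed
  ultimately show ?thesis
    using u single[of fst] single[of "\<lambda>w. fst (snd w)"]
    by (intro prod_eqI) (simp_all add: lambda_taylor_components)
qed

lemma comorph_of_log_lambda:
  "comorph_of Ws log_taylor (comorph_of Ws lam x) = comorph_of Ws phi x"
proof -
  have "comorph_of Ws log_taylor (comorph_of Ws lam x) = comorph_of Ws (comorph lam log_taylor) x"
    by (rule comorph_of_comorph_of[OF graded_susp_whitney mlin_log_taylor])
  also have "\<dots> = comorph_of Ws phi x"
  proof
    fix M :: "'k whitney list \<Rightarrow> 'k"
    have "comorph (comorph lam log_taylor) M = comorph phi M" by (rule ext, rule comorph_fun_cong, rule log_lambda_eq_phi)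
    then show "comorph_of Ws (comorph lam log_taylor) x M = comorph_of Ws phi x M"
      by (simp add: comorph_of_apply)
  qed
  finally show ?thesis .
qed

text \<open>If a letter is a function, its one-form part is 0 and \<open>Phi\<close> vanishes by multilinearity.  Otherwise all
  letters are even, and the shuffle product has no signs.\<close>
lemma phi_kills_shuffles:
  assumes u: "u \<noteq> []" "set u \<subseteq> graded.pure Vs" and w: "w \<noteq> []" "set w \<subseteq> graded.pure Vs"
  shows "shuffle phi u w = 0"
proof -
  have len: "length z \<ge> 2" if "mset z = mset (map snd u) + mset (map snd w)" for z
    using arg_cong[OF that, of size] u(1) w(1) by (cases u; cases w) simp_all
  have "shuffle phi u w = shuffle (\<lambda>z. (0, 0, Phi (map snd z))) u w"
  proof (rule shuffle_cong)
    fix z assume "mset z = mset (map snd u) + mset (map snd w)"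
    from len[OF this] obtain x y z' where "z = x # y # z'"
      by (metis Suc_le_length_iff numeral_2_eq_2)
    then show "phi z = (0, 0, Phi (map snd z))" by simp
  qed
  also have "\<dots> = (0, 0, shuffle (\<lambda>z. Phi (map snd z)) u w)"
    by (rule shuffle_additive[symmetric]) (simp add: Modules.additive_def)
  also have "shuffle (\<lambda>z. Phi (map snd z)) u w = 0"
  proof (cases "set u \<union> set w \<subseteq> {a. \<not> fst a}")
    case True
    have "shuffle Phi (map (apsnd snd) u) (map (apsnd snd) w) = 0"
      unfolding Phi_def log_coeff_def
      by (rule log_character_kills_shuffles[where g = I, OF I_Nil]) (use u(1) w(1) True I_shuffle in auto)
    then show ?thesis by (simp add: shuffle_map)
  next
    case False
    then obtain a where a: "a \<in> set u \<union> set w" "fst a" by auto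
    then have "a \<in> graded.pure Vs" using u w by auto
    with a(2) have snd0: "snd (snd a) = 0" by (cases a) (auto simp: pure_susp_forms split: if_splits)
    have "shuffle (\<lambda>z. Phi (map snd z)) u w = shuffle (\<lambda>z. 0) u w"
    proof (rule shuffle_cong)
      fix z assume z: "mset z = mset (map snd u) + mset (map snd w)"
      have "set z = snd ` (set u \<union> set w)" using arg_cong[OF z, of set_mset] by (simp add: image_Un)
      then have "snd a \<in> set z" using a(1) by auto
      then have "0 \<in> set (map snd z)" using snd0 by force
      then show "Phi (map snd z) = 0" by (rule mlin_zero_letter[OF mlin_Phi]) simp
    qed
    then show ?thesis by simp
  qed
  finally show ?thesis by (simp add: zero_prod_def)
qed

lemma mlin_phi: "mlin (scl Vs) (scl Ws) phi"
  by (rule mlin_lambda_taylor[OF ev1_linear ev0_linear mlin_Phi])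

lemma mlin_lam: "mlin (scl Vs) (scl Ws) lam"
  by (rule mlin_lambda_taylor[OF ev1_linear ev0_linear mlin_I])

lemma coalgebra_morphism_phi: "coalgebra_morphism Vs Ws (comorph_of Ws phi)"
  by (rule coalgebra_morphism_comorph_of[OF mlin_phi])
    (rule lambda_taylor_degree[OF _ _ mlin_Phi], simp_all add: ev_simps)

text \<open>The Whitney forms are a section: \<open>a t + b (1 - t) + c dt\<close> restricts to itself.\<close>
lemma phi_surj: "\<exists>v. phi [v] = w"
proof -
  obtain a b c where w: "w = (a, b, c)" by (cases w)
  have "phi [(s (a - b) (J e) + s b e, s c e)] = w"
    by (simp add: w Phi_single I_def e_mult mult_s J_scale ev_simps ev_scale ev_e ev1_J_e ev0_J)
  then show ?thesis ..
qed

lemma phi_forms_Q: "comorph_of Ws phi (forms_Q x) = whitney_Cinf_Q (comorph_of Ws phi x)"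
proof -
  have lam: "comorph_of Ws lam (forms_Q y) = coder_of Ws cup_taylor (comorph_of Ws lam y)" for y
    unfolding forms_Q_def
    by (rule comorph_of_coder_of[OF graded_susp_forms graded_susp_whitney mlin_lam mlin_cup_taylor lambda_intertwines
          lambda_taylor_sgn]) (simp_all add: ev_simps)
  have log: "comorph_of Ws log_taylor (coder_of Ws cup_taylor y) =
      coder_of Ws whitney_Cinf_taylor (comorph_of Ws log_taylor y)" for y
    by (rule comorph_of_coder_of[OF graded_susp_whitney graded_susp_whitney mlin_log_taylor
          mlin_whitney_Cinf_taylor log_intertwines log_taylor_sgn]) simp_all
  show ?thesis
    unfolding comorph_of_log_lambda[symmetric] lam log whitney_Cinf_Q_def ..
qed

lemma phi_shuffle:
  assumes "x \<in> Tbar Vs" "y \<in> Tbar Vs"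
  shows "comorph_of Ws phi (shuffle_prod Vs x y) = shuffle_prod Ws (comorph_of Ws phi x) (comorph_of Ws phi y)"
proof (rule comorph_of_shuffle_prod[OF graded_susp_forms graded_susp_whitney mlin_phi _ _ _ assms])
  show "comorph_of Ws phi ` Tbar Vs \<subseteq> Tbar Ws"
    using coalgebra_morphism_phi by (simp add: coalgebra_morphism_def tbar_linear_def)
  show "tag_comorph phi x \<in> graded.pure Ws" if "x \<noteq> []" "set x \<subseteq> graded.pure Vs" for x
    using that by (intro lambda_taylor_parity[OF _ _ mlin_Phi]) (simp_all add: ev_simps)
qed (rule phi_kills_shuffles)

lemma Cinf_algebra_whitney: "Cinf_algebra (whitney_gvs :: ('k, 'k whitney) gvs) whitney_Cinf_Q"
proof (rule Cinf_algebra_image[OF Cinf_algebra_forms, where F = "comorph_of Ws phi"])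
  let ?F = "comorph_of Ws phi"
  interpret W: graded Ws by standard (rule graded_susp_whitney)
  interpret V: graded Vs by standard (rule graded_susp_forms)
  show "graded_vs (whitney_gvs :: ('k, 'k whitney) gvs)" by (rule graded_whitney)
  show "coderivation Ws whitney_Cinf_Q"
    unfolding whitney_Cinf_Q_def
    by (rule W.coderivation_coder_of[OF mlin_whitney_Cinf_taylor whitney_Cinf_taylor_degree])
  show "?F ` Tbar Vs \<subseteq> Tbar Ws"
    using coalgebra_morphism_phi by (simp add: coalgebra_morphism_def tbar_linear_def)
  show "Tbar Ws \<subseteq> ?F ` Tbar Vs"
    using comorph_of_surj[OF mlin_phi phi_surj] by blast
  show "?F 0 = 0" "?F (x + y) = ?F x + ?F y" for x y
    by (auto simp: comorph_of_apply fun_eq_iff)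
  show "?F (forms_Q x) = whitney_Cinf_Q (?F x)" for x by (rule phi_forms_Q)
  show "?F (tsgn Vs x) = tsgn Ws (?F x)" for x
    by (rule comorph_of_tsgn[OF graded_susp_forms graded_susp_whitney mlin_phi lambda_taylor_sgn])
      (simp_all add: ev_simps)
  show "tsgn Vs x \<in> Tbar Vs" if "x \<in> Tbar Vs" for x
    using that by (rule V.tsgn_Tbar)
qed (rule phi_shuffle)

theorem Cinf_morphism_phi:
  "Cinf_morphism (forms_gvs s) forms_Q whitney_gvs whitney_Cinf_Q (log_morphism \<circ> comorph_of Ws lam)"
proof -
  have F: "log_morphism \<circ> comorph_of Ws lam = comorph_of Ws phi"
    by (rule ext) (simp add: log_morphism_def comorph_of_log_lambda)
  show ?thesis
    unfolding F Cinf_morphism_def Ainf_morphism_def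
    using Cinf_algebra_forms Cinf_algebra_whitney coalgebra_morphism_phi phi_forms_Q phi_shuffle
    by (simp add: Cinf_algebra_def)
qed

end

section \<open>Polynomial and smooth forms\<close>

lemma pderiv_poly_antideriv: "pderiv (poly_antideriv p) = p"
proof -
  have "pderiv (poly_antideriv p) = (\<Sum>i\<le>degree p. pderiv (monom (coeff p i / of_nat (Suc i)) (Suc i)))"
    unfolding poly_antideriv_def by (rule Modules.additive.sum) (simp add: Modules.additive_def pderiv_add)
  also have "\<dots> = (\<Sum>i\<le>degree p. monom (coeff p i) i)"
    by (intro sum.cong refl) (simp add: pderiv_monom del: of_nat_Suc)
  finally show ?thesis by (simp add: poly_as_sum_of_monoms)
qed

lemma iter_int_poly:
  "iter_int smult (pderiv :: 'k::field_char_0 poly \<Rightarrow> 'k poly) 1 poly_antideriv (\<lambda>f. poly f 0) (\<lambda>f. poly f 1)"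
proof
  show "f = 0" if "pderiv f = 0" "poly f 0 = 0" for f :: "'k poly"
    using that by (auto simp: pderiv_eq_0_iff elim!: degree_eq_zeroE)
  show "pderiv (poly_antideriv f) = f" for f :: "'k poly" by (rule pderiv_poly_antideriv)
qed (simp_all add: smult_add_right smult_add_left pderiv_add pderiv_smult pderiv_mult
    poly_antideriv_def poly_sum poly_monom)

lemma Cinf_morphism_poly:
  "Cinf_morphism (poly_forms :: ('k::field_char_0, 'k poly form) gvs) poly_forms_Q
    whitney_gvs whitney_Cinf_Q (log_morphism \<circ> poly_lambda)"
proof -
  interpret P: iter_int smult "pderiv :: 'k poly \<Rightarrow> 'k poly" 1 poly_antideriv "\<lambda>f. poly f 0" "\<lambda>f. poly f 1"
    by (rule iter_int_poly)
  have "P.I = poly_simplex_integral"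
    by (rule ext) (simp add: P.I_def P.K_def poly_simplex_integral_def)
  with P.Cinf_morphism_phi show ?thesis
    by (simp add: poly_forms_def poly_forms_Q_def P.forms_Q_def poly_lambda_def)
qed


lemma smooth_eqI:
  assumes "\<And>x. x \<in> {0..1} \<Longrightarrow> Rep_smooth01 f x = Rep_smooth01 g x"
  shows "f = g"
proof -
  have "Rep_smooth01 f x = Rep_smooth01 g x" for x
    using assms Rep_smooth01[of f] Rep_smooth01[of g] by (cases "x \<in> {0..1}") auto
  then show ?thesis by (simp add: Rep_smooth01_inject[symmetric] fun_eq_iff)
qed

lemma smooth_deriv_eqI:
  assumes "(Rep_smooth01 f has_real_derivative d) (at x within {0..1})" "x \<in> {0..1}"
  shows "Rep_smooth01 (smooth_deriv f) x = d"
  using vector_derivative_within_cbox[of 0 1 x "Rep_smooth01 f" d] assms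
  by (simp add: smooth_deriv.rep_eq has_real_derivative_iff_has_vector_derivative)

lemma has_derivative_smooth:
  assumes "x \<in> {0..1}"
  shows "(Rep_smooth01 f has_real_derivative Rep_smooth01 (smooth_deriv f) x) (at x within {0..1})"
proof -
  have "C_k (Suc 0) (Rep_smooth01 f)" using Rep_smooth01[of f] by blast
  then have "\<exists>d. (Rep_smooth01 f has_real_derivative d) (at x within {0..1})"
    using assms by (metis C_k.simps(2))
  then obtain d where "(Rep_smooth01 f has_real_derivative d) (at x within {0..1})" ..
  with smooth_deriv_eqI[OF this assms] show ?thesis by simp
qed

lemma continuous_on_smooth: "continuous_on {0..1} (Rep_smooth01 f)"
  using Rep_smooth01[of f] by (metis (mono_tags) C_k.simps(1) mem_Collect_eq)

lift_definition smooth_one :: smooth01 is "\<lambda>x. if x \<in> {0..1} then 1 else 0"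
proof (intro conjI allI impI)
  show "C_k k (\<lambda>x. if x \<in> {0..1} then 1 else 0)" for k
    using C_k_cong[of "\<lambda>x. if x \<in> {0..1} then 1 else 0" "\<lambda>_. 1" k] C_k_const[of k 1] by simp
qed auto

lift_definition smooth_antideriv :: "smooth01 \<Rightarrow> smooth01" is
  "\<lambda>f x. if x \<in> {0..1} then integral {0..x} f else 0"
proof (intro conjI allI impI)
  fix f :: "real \<Rightarrow> real" and k
  assume f: "(\<forall>k. C_k k f) \<and> (\<forall>x. x \<notin> {0..1} \<longrightarrow> f x = 0)"
  then have cont: "continuous_on {0..1} f" by (metis C_k.simps(1))
  have "C_k (Suc k) (\<lambda>x. integral {0..x} f)"
    unfolding C_k.simps using f integral_has_real_derivative[OF cont] by (intro exI[of _ f]) blast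
  then have "C_k k (\<lambda>x. integral {0..x} f)" by (rule C_k_SucD)
  then show "C_k k (\<lambda>x. if x \<in> {0..1} then integral {0..x} f else 0)"
    using C_k_cong[of "\<lambda>x. if x \<in> {0..1} then integral {0..x} f else 0" "\<lambda>x. integral {0..x} f" k] by simp
qed auto

lemma smooth_deriv_antideriv: "smooth_deriv (smooth_antideriv f) = f"
proof (rule smooth_eqI)
  fix x :: real assume x: "x \<in> {0..1}"
  have "((\<lambda>x. integral {0..x} (Rep_smooth01 f)) has_real_derivative Rep_smooth01 f x) (at x within {0..1})"
    by (rule integral_has_real_derivative[OF continuous_on_smooth x])
  then have "(Rep_smooth01 (smooth_antideriv f) has_real_derivative Rep_smooth01 f x) (at x within {0..1})"
    by (rule has_field_derivative_transform_within[where d = 1])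
      (use x in \<open>auto simp: smooth_antideriv.rep_eq\<close>)
  then show "Rep_smooth01 (smooth_deriv (smooth_antideriv f)) x = Rep_smooth01 f x"
    using x by (rule smooth_deriv_eqI)
qed

lemma iter_int_smooth:
  "iter_int scaleR smooth_deriv smooth_one smooth_antideriv (\<lambda>f. Rep_smooth01 f 0) (\<lambda>f. Rep_smooth01 f 1)"
proof
  fix c :: real and f g :: smooth01
  show "c *\<^sub>R f * g = c *\<^sub>R (f * g)" by transfer (simp add: fun_eq_iff)
  show "smooth_deriv (c *\<^sub>R f + g) = c *\<^sub>R smooth_deriv f + smooth_deriv g"
  proof (rule smooth_eqI)
    fix x :: real assume x: "x \<in> {0..1}"
    have "Rep_smooth01 (smooth_deriv (c *\<^sub>R f + g)) x =
        c * Rep_smooth01 (smooth_deriv f) x + Rep_smooth01 (smooth_deriv g) x"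
      by (rule smooth_deriv_eqI[OF _ x], unfold plus_smooth01.rep_eq scaleR_smooth01.rep_eq)
        (intro DERIV_add DERIV_cmult has_derivative_smooth[OF x])
    then show "Rep_smooth01 (smooth_deriv (c *\<^sub>R f + g)) x =
        Rep_smooth01 (c *\<^sub>R smooth_deriv f + smooth_deriv g) x"
      by (simp add: plus_smooth01.rep_eq scaleR_smooth01.rep_eq)
  qed
  show "smooth_deriv (f * g) = smooth_deriv f * g + f * smooth_deriv g"
  proof (rule smooth_eqI)
    fix x :: real assume x: "x \<in> {0..1}"
    have "Rep_smooth01 (smooth_deriv (f * g)) x =
        Rep_smooth01 (smooth_deriv f) x * Rep_smooth01 g x + Rep_smooth01 (smooth_deriv g) x * Rep_smooth01 f x"
      by (rule smooth_deriv_eqI[OF _ x], unfold times_smooth01.rep_eq)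
        (intro DERIV_mult has_derivative_smooth[OF x])
    then show "Rep_smooth01 (smooth_deriv (f * g)) x = Rep_smooth01 (smooth_deriv f * g + f * smooth_deriv g) x"
      by (simp add: plus_smooth01.rep_eq times_smooth01.rep_eq mult.commute)
  qed
  show "smooth_one * f = f"
    by (rule smooth_eqI) (simp add: times_smooth01.rep_eq smooth_one.rep_eq)
  show "smooth_deriv (smooth_antideriv f) = f" by (rule smooth_deriv_antideriv)
  show "f = 0" if f: "smooth_deriv f = 0" "Rep_smooth01 f 0 = 0"
  proof -
    have z: "(Rep_smooth01 f has_real_derivative 0) (at x within {0..1})" if "x \<in> {0..1}" for x
      using has_derivative_smooth[OF that, of f] unfolding f(1) zero_smooth01.rep_eq .
    obtain c where c: "\<forall>x\<in>{0..1}. Rep_smooth01 f x = c"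
      by (rule exE[OF has_field_derivative_zero_constant[OF convex_real_interval(5) z]])
    show ?thesis
    proof (rule smooth_eqI)
      fix x :: real assume "x \<in> {0..1}"
      then have "Rep_smooth01 f x = c" using c by blast
      also have "c = Rep_smooth01 f 0" using c by simp
      finally show "Rep_smooth01 f x = Rep_smooth01 0 x"
        unfolding f(2) zero_smooth01.rep_eq .
    qed
  qed
  have "integral {0..1} (Rep_smooth01 smooth_one) = integral {0..1 :: real} (\<lambda>x. 1 :: real)"
    by (rule Henstock_Kurzweil_Integration.integral_cong) (simp add: smooth_one.rep_eq)
  then show "Rep_smooth01 (smooth_antideriv smooth_one) 1 = 1"
    by (simp add: smooth_antideriv.rep_eq)
qed (simp_all add: plus_smooth01.rep_eq scaleR_smooth01.rep_eq times_smooth01.rep_eq smooth_antideriv.rep_eq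
    smooth_one.rep_eq scaleR_add_right scaleR_add_left)


definition in_simplex :: "nat \<Rightarrow> real \<Rightarrow> (nat \<Rightarrow> real) \<Rightarrow> bool" where
  "in_simplex n T t \<longleftrightarrow> (\<forall>i<n. 0 \<le> t i \<and> t i \<le> T) \<and> (\<forall>i j. i \<le> j \<and> j < n \<longrightarrow> t i \<le> t j)"

text \<open>The simplex, sliced along its largest coordinate.\<close>
lemma in_simplex_Suc:
  "in_simplex (Suc n) T t \<longleftrightarrow> 0 \<le> t n \<and> t n \<le> T \<and> in_simplex n (t n) t"
proof
  assume "in_simplex (Suc n) T t"
  then show "0 \<le> t n \<and> t n \<le> T \<and> in_simplex n (t n) t"
    unfolding in_simplex_def by (auto simp: less_Suc_eq_le)
next
  assume *: "0 \<le> t n \<and> t n \<le> T \<and> in_simplex n (t n) t"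
  then have "\<forall>i<Suc n. 0 \<le> t i \<and> t i \<le> T"
    unfolding in_simplex_def less_Suc_eq by (auto intro: order_trans)
  moreover have "t i \<le> t j" if "i \<le> j" "j < Suc n" for i j
    using * that unfolding in_simplex_def by (cases "j = n"; cases "i = n") (auto simp: less_Suc_eq)
  ultimately show "in_simplex (Suc n) T t" unfolding in_simplex_def by blast
qed

lemma in_simplex_cong: "(\<And>i. i < n \<Longrightarrow> t i = t' i) \<Longrightarrow> in_simplex n T t \<longleftrightarrow> in_simplex n T t'"
  unfolding in_simplex_def by (auto dest: le_less_trans)

text \<open>The simplex is cut out of the product space by finitely many inequalities between coordinates.\<close>
lemma sets_in_simplex:
  "{t \<in> space (\<Pi>\<^sub>M i\<in>{..<n}. lborel). in_simplex n T t} \<in> sets (\<Pi>\<^sub>M i\<in>{..<n}. lborel)"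
proof -
  let ?M = "\<Pi>\<^sub>M i\<in>{..<n}. (lborel :: real measure)"
  have meas: "(\<lambda>t. t i) \<in> borel_measurable ?M" if "i < n" for i
    using measurable_component_singleton[of i "{..<n}" "\<lambda>_. lborel :: real measure"] that by simp
  have eq: "in_simplex n T t \<longleftrightarrow> (\<forall>i\<in>{..<n}. 0 \<le> t i) \<and> (\<forall>i\<in>{..<n}. t i \<le> T) \<and> (\<forall>j\<in>{..<n}. \<forall>i\<in>{..j}. t i \<le> t j)" for t
    unfolding in_simplex_def by auto
  show ?thesis
    unfolding eq
    by (intro sets.sets_Collect_conj sets.sets_Collect_finite_All borel_measurable_le meas borel_measurable_const) auto
qed

lemma integrable_smooth: "integrable lborel (Rep_smooth01 f)"
proof -
  have "set_integrable lborel {0..1} (Rep_smooth01 f)"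
    by (rule borel_integrable_atLeastAtMost'[OF continuous_on_smooth])
  moreover have "(\<lambda>x. indicator {0..1} x *\<^sub>R Rep_smooth01 f x) = Rep_smooth01 f"
    using Rep_smooth01[of f] by (auto simp: fun_eq_iff indicator_def)
  ultimately show ?thesis by (simp add: set_integrable_def)
qed

definition simplex_integrand :: "smooth01 list \<Rightarrow> real \<Rightarrow> (nat \<Rightarrow> real) \<Rightarrow> real" where
  "simplex_integrand as T t =
     (if in_simplex (length as) T t then \<Prod>i<length as. Rep_smooth01 (as ! i) (t i) else 0)"

lemma product_sigma_finite_lborel: "product_sigma_finite (\<lambda>_ :: nat. lborel :: real measure)"
  by standard

lemma integrable_simplex_integrand:
  "integrable (\<Pi>\<^sub>M i\<in>{..<length as}. lborel) (simplex_integrand as T)"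
proof -
  let ?n = "length as"
  let ?M = "\<Pi>\<^sub>M i\<in>{..<?n}. (lborel :: real measure)"
  interpret product_sigma_finite "\<lambda>_ :: nat. lborel :: real measure" by (rule product_sigma_finite_lborel)
  have "integrable ?M (\<lambda>t. \<Prod>i\<in>{..<?n}. Rep_smooth01 (as ! i) (t i))"
    by (rule product_integrable_prod) (simp_all add: integrable_smooth)
  from integrable_mult_indicator[OF sets_in_simplex this, of T]
  show ?thesis
    by (rule Bochner_Integration.integrable_cong[THEN iffD1, OF refl, rotated])
      (simp add: simplex_integrand_def indicator_def)
qed

text \<open>Fubini, with the largest coordinate outermost: for fixed \<open>t\<^sub>n\<close> the others range over the
  simplex with upper limit \<open>t\<^sub>n\<close>.\<close>
lemma integral_simplex_integrand:
  assumes "T \<in> {0..1}"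
  shows "(\<integral>t. simplex_integrand as T t \<partial>(\<Pi>\<^sub>M i\<in>{..<length as}. lborel)) =
    Rep_smooth01 (fold (\<lambda>a X. smooth_antideriv (X * a)) as smooth_one) T"
  using assms
proof (induction as arbitrary: T rule: rev_induct)
  case Nil
  interpret product_sigma_finite "\<lambda>_ :: nat. lborel :: real measure" by (rule product_sigma_finite_lborel)
  have "simplex_integrand [] T = (\<lambda>t. 1)" by (auto simp: simplex_integrand_def in_simplex_def fun_eq_iff)
  then show ?case using Nil by (simp add: smooth_one.rep_eq measure_def space_PiM_empty emeasure_PiM_empty)
next
  case (snoc a as)
  interpret product_sigma_finite "\<lambda>_ :: nat. lborel :: real measure" by (rule product_sigma_finite_lborel)
  let ?m = "length as"
  let ?X = "fold (\<lambda>a X. smooth_antideriv (X * a)) as smooth_one"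
  let ?g = "\<lambda>y. indicator {0..T} y *\<^sub>R Rep_smooth01 (?X * a) y"
  have set_eq: "{..<length (as @ [a])} = {?m} \<union> {..<?m}" by auto
  have cont: "continuous_on {0..T} (Rep_smooth01 (?X * a))"
    using continuous_on_subset[OF continuous_on_smooth] snoc.prems by auto
  have int: "set_integrable lborel {0..T} (Rep_smooth01 (?X * a))"
    by (rule borel_integrable_atLeastAtMost'[OF cont])
  have inner: "(\<integral>y. simplex_integrand (as @ [a]) T (merge {?m} {..<?m} (x, y)) \<partial>(\<Pi>\<^sub>M i\<in>{..<?m}. lborel)) =
      ?g (x ?m)" for x
  proof -
    have "simplex_integrand (as @ [a]) T (merge {?m} {..<?m} (x, y)) =
        indicator {0..T} (x ?m) * Rep_smooth01 a (x ?m) * simplex_integrand as (x ?m) y" for y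
    proof -
      let ?t = "merge {?m} {..<?m} (x, y)"
      have t: "?t ?m = x ?m" "i < ?m \<Longrightarrow> ?t i = y i" for i by (auto simp: merge_def)
      have "in_simplex (Suc ?m) T ?t \<longleftrightarrow> x ?m \<in> {0..T} \<and> in_simplex ?m (x ?m) y"
        unfolding in_simplex_Suc t(1) using in_simplex_cong[of ?m ?t y "x ?m"] t(2) by auto
      moreover have "(\<Prod>i<Suc ?m. Rep_smooth01 ((as @ [a]) ! i) (?t i)) =
          (\<Prod>i<?m. Rep_smooth01 (as ! i) (y i)) * Rep_smooth01 a (x ?m)"
        by (simp add: t nth_append)
      ultimately show ?thesis
        by (simp add: simplex_integrand_def indicator_def del: prod.lessThan_Suc)
    qed
    then have "(\<integral>y. simplex_integrand (as @ [a]) T (merge {?m} {..<?m} (x, y)) \<partial>(\<Pi>\<^sub>M i\<in>{..<?m}. lborel)) =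
        indicator {0..T} (x ?m) * Rep_smooth01 a (x ?m) *
        (\<integral>y. simplex_integrand as (x ?m) y \<partial>(\<Pi>\<^sub>M i\<in>{..<?m}. lborel))"
      by simp
    also have "\<dots> = ?g (x ?m)"
      using snoc.IH[of "x ?m"] snoc.prems by (auto simp: indicator_def times_smooth01.rep_eq)
    finally show ?thesis .
  qed
  have "(\<integral>t. simplex_integrand (as @ [a]) T t \<partial>(\<Pi>\<^sub>M i\<in>{..<length (as @ [a])}. lborel)) =
      (\<integral>x. ?g (x ?m) \<partial>(\<Pi>\<^sub>M i\<in>{?m}. lborel))"
    unfolding set_eq inner[symmetric]
    using integrable_simplex_integrand[of "as @ [a]" T] unfolding set_eq
    by (intro product_integral_fold) auto
  also have "\<dots> = (\<integral>y. ?g y \<partial>lborel)"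
    using int by (intro product_integral_singleton) (auto simp: set_integrable_def)
  also have "\<dots> = integral {0..T} (Rep_smooth01 (?X * a))"
    using set_borel_integral_eq_integral(2)[OF int] by (simp add: set_lebesgue_integral_def)
  also have "\<dots> = Rep_smooth01 (smooth_antideriv (?X * a)) T"
    using snoc.prems by (simp add: smooth_antideriv.rep_eq)
  finally show ?case by simp
qed

lemma smooth_simplex_integral_eq:
  "smooth_simplex_integral as = Rep_smooth01 (fold (\<lambda>a X. smooth_antideriv (X * a)) as smooth_one) 1"
proof -
  have "smooth_simplex_integral as = (\<integral>t. simplex_integrand as 1 t \<partial>(\<Pi>\<^sub>M i\<in>{..<length as}. lborel))"
    unfolding smooth_simplex_integral_def Let_def set_lebesgue_integral_def
    by (intro Bochner_Integration.integral_cong refl)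
      (simp add: simplex_integrand_def in_simplex_def indicator_def)
  then show ?thesis by (simp add: integral_simplex_integrand)
qed

lemma Cinf_morphism_smooth:
  "Cinf_morphism smooth_forms smooth_forms_Q whitney_gvs whitney_Cinf_Q (log_morphism \<circ> smooth_lambda)"
proof -
  interpret P: iter_int scaleR smooth_deriv smooth_one smooth_antideriv
      "\<lambda>f. Rep_smooth01 f 0" "\<lambda>f. Rep_smooth01 f 1"
    by (rule iter_int_smooth)
  have "P.I = smooth_simplex_integral"
    by (rule ext) (simp add: P.I_def P.K_def smooth_simplex_integral_eq)
  with P.Cinf_morphism_phi show ?thesis
    by (simp add: smooth_forms_def smooth_forms_Q_def P.forms_Q_def smooth_lambda_def)
qed

theorem corollary2p7:
  shows "Cinf_morphism
      (poly_forms :: ('k::field_char_0, 'k poly form) gvs) poly_forms_Q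
      whitney_gvs whitney_Cinf_Q
      (log_morphism \<circ> poly_lambda)
    \<and> Cinf_morphism
      smooth_forms smooth_forms_Q
      whitney_gvs whitney_Cinf_Q
      (log_morphism \<circ> smooth_lambda)"
  using Cinf_morphism_poly Cinf_morphism_smooth by blast

end
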